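(* Let $\gamma>-\frac12$, and let the wind forcing $f=f(x,z,\tau)$ have a time average $f_0=f_0(x,z)$ in the following sense: $f(\tau),f_0\in D(\mathcal A_1^{\gamma})$ and there are a constant $M_\gamma>0$ and a function $\sigma_\gamma$ with $\sigma_\gamma(\ell)\to0$ as $\ell\to\infty$ such that, for all $t\ge 0$ and $\ell>0$, $$\Big\|\mathcal A_1^{\gamma}\Big(\frac1{\ell}\int_t^{t+\ell}f(s)\,ds-f_0\Big)\Big\|\le\min(M_\gamma,\sigma_\gamma(\ell)).$$ Let $T>0$ be arbitrary and fixed. For $\epsilon>0$ let $(\omega,\rho)$ solve $$\omega_\tau+\epsilon\mathcal A_1\omega+\epsilon J(\omega,\Delta^{-1}\omega)=\epsilon\rho_x+\epsilon f(x,z,\tau),\qquad \rho_\tau+\epsilon\mathcal A_2\rho+\epsilon J(\rho,\Delta^{-1}\omega)=-\epsilon N^2\Delta^{-1}\omega_x,$$ and let $(\bar\omega,\bar\rho)$ solve the averaged system $$\bar\omega_\tau+\epsilon\mathcal A_1\bar\omega+\epsilon J(\bar\omega,\Delta^{-1}\bar\omega)=\epsilon\bar\rho_x+\epsilon f_0(x,z),\qquad \bar\rho_\tau+\epsilon\mathcal A_2\bar\rho+\epsilon J(\bar\rho,\Delta^{-1}\bar\omega)=-\epsilon N^2\Delta^{-1}\bar\omega_x,$$ with the same initial data $(\omega(0),\rho(0))=(\bar\omega(0),\bar\rho(0))\in B_{\mathbf V}(R_0)$, where $B_{\mathbf V}(R_0)$ (depending on $\gamma$) is an absorbing ball of the averaged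 system in $\mathbf V$. Then there exist $\epsilon_0>0$ and a function $\eta_T^1:(0,\epsilon_0]\to[0,\infty)$, depending on $T$, $\gamma$, $R_0$, the forcing and the parameters of the system but not on $\tau$ or on the particular initial data in $B_{\mathbf V}(R_0)$, with $\eta_T^1(\epsilon)\to0$ as $\epsilon\to0$, such that for all $\epsilon\in(0,\epsilon_0]$ and all $\tau\in[0,\frac{T}{\epsilon}]$ $$\|\omega(\tau)-\bar\omega(\tau)\|_{\frac12}+\|\rho(\tau)-\bar\rho(\tau)\|_{\frac12}\le\eta_T^1(\epsilon).$$
   Context: All functions are on $D=\{(x,z):0\le x,z\le1\}$, periodic with period $1$ in $x$ and $z$ and with zero mean. $J(a,b)=a_xb_z-a_zb_x$, $\Delta=\partial_{xx}+\partial_{zz}$, and $\Delta^{-1}$ is the inverse of $\Delta$ on periodic zero-mean functions. The constants $\nu>0$, $N^2>0$, $Pr>0$ are given. $\mathcal A_1=-\nu\Delta$ and $\mathcal A_2=-\frac{\nu}{Pr}\Delta$ with periodic boundary conditions and zero mean, acting in $H=L^2_{per0}$ (periodic zero-mean $L^2(D)$ functions, norm $\|\cdot\|$). $\mathcal A^{\alpha}$ denotes fractional powers, $D(\mathcal A^{\alpha})$ their domains with norm $\|x\|_\alpha=\|\mathcal A^{\alpha}x\|$ (for $\alpha<0$, the corresponding completion of $H$); $D(\mathcal A_1^{\alpha})=D(\mathcal A_2^{\alpha})$ with equivalent norms. $\|\cdot\|_{\frac12}$ is the norm of $H^1_{per0}=\{u\in H:\nabla u\in H\}=D(\mathcal A_1^{1/2})=D(\mathcal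 A_2^{1/2})$, and $\mathbf V=H^1_{per0}\times H^1_{per0}$; $B_{\mathbf V}(R)$ is the ball of radius $R$ centered at $0$ in $\mathbf V$. The first system arises from the vorticity form of a thermohaline circulation model with rapidly oscillating wind forcing, $$\omega_t+\mathcal A_1\omega=-J(\omega,\Delta^{-1}\omega)+\rho_x+f(x,z,\eta t),\qquad \rho_t+\mathcal A_2\rho=-J(\rho,\Delta^{-1}\omega)-N^2\Delta^{-1}\omega_x,$$ with $\eta\gg1$, through the change of variables $\tau=\eta t$, $\epsilon=\eta^{-1}$. Here $\omega$ is the vorticity, $\Delta^{-1}\omega$ the stream function, and $\rho$ the density fluctuation. The forcing satisfies $f\in L^\infty(0,S;H)$ for every $S>0$, and solutions are the solutions of the equivalent integral (variation-of-constants) equations with values in $\mathbf V$. Absorbing ball: let $S_t$ be the semigroup on $\mathbf V$ generated by the averaged system in the original time $t=\epsilon\tau$. $B_{\mathbf V}(R_0)$ is absorbing if for every bounded set $B\subset\mathbf V$ there is $t_0(B,R_0)$ such that $S_tB\subset B_{\mathbf V}(R_0)$ for $t>t_0(B,R_0)$. The averaged system possesses such absorbing balls for $R_0$ large enough, and $S_t$ is uniformly bounded: for the ball $B_{\mathbf V}(R_0)$ there is $R$ with $S_tB_{\mathbf V}(R_0)\subset B_{\mathbf V}(R)$ for all $t>0$. *)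

theory Defs
  imports "HOL-Analysis.Analysis"
begin

section \<open>Periodic functions with zero mean\<close>

abbreviation cell :: "(real \<times> real) measure" where
  "cell \<equiv> restrict_space lborel ({0..1} \<times> {0..1})"

definition periodic :: "(real \<times> real \<Rightarrow> real) \<Rightarrow> bool" where
  "periodic u \<longleftrightarrow> (\<forall>x z. u (x + 1, z) = u (x, z) \<and> u (x, z + 1) = u (x, z))"

text \<open>Elements of \<open>H\<close> are represented by functions on the whole plane; two functions that agree
  almost everywhere represent the same element.\<close>

definition per0_L2 :: "(real \<times> real \<Rightarrow> real) set" where
  "per0_L2 = {u. periodic u \<and> u \<in> borel_measurable borel \<and>
     integrable cell (\<lambda>p. (u p)\<^sup>2) \<and> (\<integral>p. u p \<partial>cell) = 0}"

definition L2_nrm :: "(real \<times> real \<Rightarrow> real) \<Rightarrow> real" where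
  "L2_nrm u = sqrt (\<integral>p. (u p)\<^sup>2 \<partial>cell)"

definition C1_periodic ::
  "(real \<times> real \<Rightarrow> real) \<Rightarrow> (real \<times> real \<Rightarrow> real) \<Rightarrow> (real \<times> real \<Rightarrow> real) \<Rightarrow> bool" where
  "C1_periodic \<phi> \<phi>x \<phi>z \<longleftrightarrow> periodic \<phi> \<and> continuous_on UNIV \<phi>x \<and> continuous_on UNIV \<phi>z \<and>
     (\<forall>p. (\<phi> has_derivative (\<lambda>h. \<phi>x p * fst h + \<phi>z p * snd h)) (at p))"

text \<open>Weak derivatives on the torus: the test functions are periodic, so no boundary terms occur.\<close>

definition has_weak_dx :: "(real \<times> real \<Rightarrow> real) \<Rightarrow> (real \<times> real \<Rightarrow> real) \<Rightarrow> bool" where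
  "has_weak_dx u g \<longleftrightarrow> u \<in> per0_L2 \<and> g \<in> per0_L2 \<and>
     (\<forall>\<phi> \<phi>x \<phi>z. C1_periodic \<phi> \<phi>x \<phi>z \<longrightarrow>
        (\<integral>p. u p * \<phi>x p \<partial>cell) = - (\<integral>p. g p * \<phi> p \<partial>cell))"

definition has_weak_dz :: "(real \<times> real \<Rightarrow> real) \<Rightarrow> (real \<times> real \<Rightarrow> real) \<Rightarrow> bool" where
  "has_weak_dz u g \<longleftrightarrow> u \<in> per0_L2 \<and> g \<in> per0_L2 \<and>
     (\<forall>\<phi> \<phi>x \<phi>z. C1_periodic \<phi> \<phi>x \<phi>z \<longrightarrow>
        (\<integral>p. u p * \<phi>z p \<partial>cell) = - (\<integral>p. g p * \<phi> p \<partial>cell))"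

definition per0_H1 :: "(real \<times> real \<Rightarrow> real) set" where
  "per0_H1 = {u \<in> per0_L2. (\<exists>g. has_weak_dx u g) \<and> (\<exists>g. has_weak_dz u g)}"

text \<open>The choices below pick representatives: weak derivatives and zero-mean solutions of
  \<open>\<Delta> \<psi> = w\<close> are unique up to null sets. The values are meaningful only where a weak derivative
  exists (\<open>u \<in> per0_H1\<close>) and where \<open>w \<in> per0_L2\<close>, respectively.\<close>

definition dx :: "(real \<times> real \<Rightarrow> real) \<Rightarrow> real \<times> real \<Rightarrow> real" where
  "dx u = (SOME g. has_weak_dx u g)"

definition dz :: "(real \<times> real \<Rightarrow> real) \<Rightarrow> real \<times> real \<Rightarrow> real" where
  "dz u = (SOME g. has_weak_dz u g)"

definition has_laplacian :: "(real \<times> real \<Rightarrow> real) \<Rightarrow> (real \<times> real \<Rightarrow> real) \<Rightarrow> bool" where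
  "has_laplacian \<psi> w \<longleftrightarrow> w \<in> per0_L2 \<and>
     (\<exists>\<psi>x \<psi>z \<psi>xx \<psi>zz. has_weak_dx \<psi> \<psi>x \<and> has_weak_dz \<psi> \<psi>z \<and>
        has_weak_dx \<psi>x \<psi>xx \<and> has_weak_dz \<psi>z \<psi>zz \<and>
        (AE p in cell. w p = \<psi>xx p + \<psi>zz p))"

definition inv_laplacian :: "(real \<times> real \<Rightarrow> real) \<Rightarrow> real \<times> real \<Rightarrow> real" where
  "inv_laplacian w = (SOME \<psi>. has_laplacian \<psi> w)"

definition jacobian ::
  "(real \<times> real \<Rightarrow> real) \<Rightarrow> (real \<times> real \<Rightarrow> real) \<Rightarrow> real \<times> real \<Rightarrow> real" where
  "jacobian a b = (\<lambda>p. dx a p * dz b p - dz a p * dx b p)"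

section \<open>Fractional powers of \<open>- \<kappa> \<Delta>\<close>\<close>

definition fourier :: "(real \<times> real \<Rightarrow> real) \<Rightarrow> int \<times> int \<Rightarrow> complex" where
  "fourier u k = (\<integral>p. of_real (u p) *
     cis (- (2 * pi * (of_int (fst k) * fst p + of_int (snd k) * snd p))) \<partial>cell)"

text \<open>The eigenvalue of \<open>- \<kappa> \<Delta>\<close> at the eigenfunction \<open>exp (2 \<pi> i (m x + n z))\<close>.\<close>

definition eigval :: "real \<Rightarrow> int \<times> int \<Rightarrow> real" where
  "eigval \<kappa> k = \<kappa> * (4 * pi\<^sup>2 * ((of_int (fst k))\<^sup>2 + (of_int (snd k))\<^sup>2))"

text \<open>For negative exponents the domain of the fractional power is a completion of \<open>H\<close> whose
  elements need not be functions. All the domains are therefore realised as spaces of families of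
  Fourier coefficients, into which functions \<open>u\<close> in \<open>H\<close> embed as \<open>fourier u\<close>. The
  conditions in \<open>hat_L2\<close> say: zero mean, real-valued, square integrable. By Parseval's identity
  \<open>hat_nrm (fourier u) = L2_nrm u\<close>.\<close>

definition hat_L2 :: "(int \<times> int \<Rightarrow> complex) set" where
  "hat_L2 = {c. c (0, 0) = 0 \<and> (\<forall>m n. c (- m, - n) = cnj (c (m, n))) \<and>
     (\<lambda>k. (cmod (c k))\<^sup>2) summable_on UNIV}"

definition hat_nrm :: "(int \<times> int \<Rightarrow> complex) \<Rightarrow> real" where
  "hat_nrm c = sqrt (\<Sum>\<^sub>\<infinity>k. (cmod (c k))\<^sup>2)"

definition frac_pow :: "real \<Rightarrow> real \<Rightarrow> (int \<times> int \<Rightarrow> complex) \<Rightarrow> int \<times> int \<Rightarrow> complex" where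
  "frac_pow \<kappa> \<alpha> c = (\<lambda>k. of_real (eigval \<kappa> k powr \<alpha>) * c k)"

text \<open>The condition at \<open>(0, 0)\<close> is needed because \<open>frac_pow\<close> erases the mean.\<close>

definition frac_dom :: "real \<Rightarrow> real \<Rightarrow> (int \<times> int \<Rightarrow> complex) set" where
  "frac_dom \<kappa> \<alpha> = {c. c (0, 0) = 0 \<and> frac_pow \<kappa> \<alpha> c \<in> hat_L2}"

definition frac_nrm :: "real \<Rightarrow> real \<Rightarrow> (int \<times> int \<Rightarrow> complex) \<Rightarrow> real" where
  "frac_nrm \<kappa> \<alpha> c = hat_nrm (frac_pow \<kappa> \<alpha> c)"

definition heat :: "real \<Rightarrow> real \<Rightarrow> (int \<times> int \<Rightarrow> complex) \<Rightarrow> int \<times> int \<Rightarrow> complex" where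
  "heat \<kappa> t c = (\<lambda>k. of_real (exp (- (t * eigval \<kappa> k))) * c k)"

text \<open>Fourier coefficients are bounded functionals on every \<open>frac_dom \<kappa> \<alpha>\<close> and separate its
  points, so a Bochner integral in such a space is computed coefficientwise.\<close>

definition hat_integral ::
  "real \<Rightarrow> real \<Rightarrow> (real \<Rightarrow> int \<times> int \<Rightarrow> complex) \<Rightarrow> int \<times> int \<Rightarrow> complex" where
  "hat_integral a b F = (\<lambda>k. LINT s:{a..b}|lebesgue. F s k)"

section \<open>The forcing\<close>

text \<open>Strong (Bochner) measurability of a map from the half line to \<open>H\<close>.\<close>

definition strongly_measurable_H :: "(real \<Rightarrow> real \<times> real \<Rightarrow> real) \<Rightarrow> bool" where
  "strongly_measurable_H f \<longleftrightarrow> (\<exists>\<phi> :: nat \<Rightarrow> real \<Rightarrow> real \<times> real \<Rightarrow> real.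
     (\<forall>n. finite (\<phi> n ` {0..}) \<and> \<phi> n ` {0..} \<subseteq> per0_L2 \<and>
          (\<forall>h. {s \<in> {0..}. \<phi> n s = h} \<in> sets lebesgue)) \<and>
     (AE s in lebesgue. 0 \<le> s \<longrightarrow> (\<lambda>n. L2_nrm (\<lambda>p. \<phi> n s p - f s p)) \<longlonglongrightarrow> 0))"

definition Linfty_loc_H :: "(real \<Rightarrow> real \<times> real \<Rightarrow> real) \<Rightarrow> bool" where
  "Linfty_loc_H f \<longleftrightarrow> (AE s in lebesgue. 0 \<le> s \<longrightarrow> f s \<in> per0_L2) \<and> strongly_measurable_H f \<and>
     (\<forall>S>0. \<exists>C. AE s in lebesgue. 0 \<le> s \<and> s \<le> S \<longrightarrow> L2_nrm (f s) \<le> C)"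

section \<open>The phase space\<close>

definition half_nrm :: "real \<Rightarrow> (real \<times> real \<Rightarrow> real) \<Rightarrow> real" where
  "half_nrm \<kappa> u = frac_nrm \<kappa> (1/2) (fourier u)"

definition V_space :: "((real \<times> real \<Rightarrow> real) \<times> (real \<times> real \<Rightarrow> real)) set" where
  "V_space = per0_H1 \<times> per0_H1"

text \<open>Convention: the vorticity component is measured with \<open>A\<^sub>1 = - \<nu> \<Delta>\<close>, the density component with
  \<open>A\<^sub>2 = - (\<nu> / Pr) \<Delta>\<close>, and balls are closed.\<close>

definition V_nrm ::
  "real \<Rightarrow> real \<Rightarrow> (real \<times> real \<Rightarrow> real) \<times> (real \<times> real \<Rightarrow> real) \<Rightarrow> real" where
  "V_nrm \<nu> Pr v = half_nrm \<nu> (fst v) + half_nrm (\<nu> / Pr) (snd v)"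

definition V_ball ::
  "real \<Rightarrow> real \<Rightarrow> real \<Rightarrow> ((real \<times> real \<Rightarrow> real) \<times> (real \<times> real \<Rightarrow> real)) set" where
  "V_ball \<nu> Pr R = {v \<in> V_space. V_nrm \<nu> Pr v \<le> R}"

section \<open>Solutions of the integral equations\<close>

text \<open>Solution on the time interval \<open>I\<close> (an interval with left end point \<open>0\<close>), with initial data
  \<open>(a, b)\<close>, of
  \<open>\<omega>' + \<epsilon> A\<^sub>1 \<omega> + \<epsilon> J(\<omega>, \<Delta>\<^sup>-\<^sup>1 \<omega>) = \<epsilon> \<rho>\<^sub>x + \<epsilon> F\<close> and
  \<open>\<rho>' + \<epsilon> A\<^sub>2 \<rho> + \<epsilon> J(\<rho>, \<Delta>\<^sup>-\<^sup>1 \<omega>) = - \<epsilon> N\<^sup>2 \<Delta>\<^sup>-\<^sup>1 \<omega>\<^sub>x\<close>,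
  that is, a continuous curve in \<open>V\<close> satisfying the variation-of-constants formula. The forcing
  \<open>F\<close> is given by its Fourier coefficients, since the averaged forcing need not be a function.\<close>

definition mild_solution ::
  "real \<Rightarrow> real \<Rightarrow> real \<Rightarrow> real \<Rightarrow> (real \<Rightarrow> int \<times> int \<Rightarrow> complex) \<Rightarrow> real set \<Rightarrow>
   (real \<times> real \<Rightarrow> real) \<times> (real \<times> real \<Rightarrow> real) \<Rightarrow>
   (real \<Rightarrow> real \<times> real \<Rightarrow> real) \<Rightarrow> (real \<Rightarrow> real \<times> real \<Rightarrow> real) \<Rightarrow> bool" where
  "mild_solution \<nu> Pr N \<epsilon> F I v0 \<omega> \<rho> \<longleftrightarrow>
     (\<forall>\<tau>\<in>I. (\<omega> \<tau>, \<rho> \<tau>) \<in> V_space) \<and>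
     (\<forall>\<tau>\<in>I. ((\<lambda>s. V_nrm \<nu> Pr (\<lambda>p. \<omega> s p - \<omega> \<tau> p, \<lambda>p. \<rho> s p - \<rho> \<tau> p)) \<longlongrightarrow> 0) (at \<tau> within I)) \<and>
     (\<forall>\<tau>\<in>I. \<forall>k. fourier (\<omega> \<tau>) k =
        heat \<nu> (\<epsilon> * \<tau>) (fourier (fst v0)) k +
        of_real \<epsilon> * hat_integral 0 \<tau> (\<lambda>s. heat \<nu> (\<epsilon> * (\<tau> - s))
          (\<lambda>j. - fourier (jacobian (\<omega> s) (inv_laplacian (\<omega> s))) j + fourier (dx (\<rho> s)) j + F s j)) k) \<and>
     (\<forall>\<tau>\<in>I. \<forall>k. fourier (\<rho> \<tau>) k =
        heat (\<nu> / Pr) (\<epsilon> * \<tau>) (fourier (snd v0)) k +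
        of_real \<epsilon> * hat_integral 0 \<tau> (\<lambda>s. heat (\<nu> / Pr) (\<epsilon> * (\<tau> - s))
          (\<lambda>j. - fourier (jacobian (\<rho> s) (inv_laplacian (\<omega> s))) j
               - of_real (N\<^sup>2) * fourier (inv_laplacian (dx (\<omega> s))) j)) k)"

section \<open>The averaged semigroup and its absorbing balls\<close>

text \<open>\<open>S\<close> is the solution operator of the averaged system in the original time \<open>t = \<epsilon> \<tau>\<close>, in
  which \<open>\<epsilon>\<close> no longer appears.\<close>

definition averaged_semigroup ::
  "real \<Rightarrow> real \<Rightarrow> real \<Rightarrow> (int \<times> int \<Rightarrow> complex) \<Rightarrow>
   (real \<Rightarrow> (real \<times> real \<Rightarrow> real) \<times> (real \<times> real \<Rightarrow> real) \<Rightarrow>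
             (real \<times> real \<Rightarrow> real) \<times> (real \<times> real \<Rightarrow> real)) \<Rightarrow> bool" where
  "averaged_semigroup \<nu> Pr N f0 S \<longleftrightarrow>
     (\<forall>v\<in>V_space. mild_solution \<nu> Pr N 1 (\<lambda>_. f0) {0..} v (\<lambda>t. fst (S t v)) (\<lambda>t. snd (S t v)))"

definition absorbing_ball ::
  "real \<Rightarrow> real \<Rightarrow>
   (real \<Rightarrow> (real \<times> real \<Rightarrow> real) \<times> (real \<times> real \<Rightarrow> real) \<Rightarrow>
             (real \<times> real \<Rightarrow> real) \<times> (real \<times> real \<Rightarrow> real)) \<Rightarrow> real \<Rightarrow> bool" where
  "absorbing_ball \<nu> Pr S R \<longleftrightarrow>
     (\<forall>B. B \<subseteq> V_space \<and> (\<exists>r. \<forall>v\<in>B. V_nrm \<nu> Pr v \<le> r) \<longrightarrow>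
        (\<exists>t0\<ge>0. \<forall>t>t0. S t ` B \<subseteq> V_ball \<nu> Pr R))"

end

theory Submission
  imports Defs
begin

text \<open>In the time \<open>t = \<epsilon> \<tau>\<close> the forcing of the first system becomes \<open>f (t / \<epsilon>)\<close>, and both solutions live on
  the fixed interval \<open>[0, T]\<close>. Subtracting the two variation-of-constants formulas, the
  difference \<open>z\<close> of the solutions, measured in \<open>V\<close>, satisfies
  \<open>z(t) \<le> a(t) + K \<integral>\<^sub>0\<^sup>t (t - s)\<^sup>-\<^sup>1\<^sup>/\<^sup>2 z(s) ds\<close>. Here the kernel is the price of the derivative
  that the heat semigroup gains, and \<open>K\<close> comes from the Lipschitz continuity of the nonlinearity from
  bounded subsets of \<open>V\<close> to \<open>L\<^sup>2\<close> (\<open>ell2_le_rhs_diff\<close>), which holds because \<open>\<nabla>\<Delta>\<^sup>-\<^sup>1\<close> maps \<open>H\<^sup>1\<close>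
  into the bounded functions. The two systems differ only in the forcing, so \<open>a\<close> is the norm of the
  integral of \<open>f (s / \<epsilon>) - f\<^sub>0\<close> against the heat semigroup.

  That integral is small uniformly in \<open>t\<close> (\<open>averaged_forcing_small\<close>). An integration by parts replaces
  \<open>f (s / \<epsilon>) - f\<^sub>0\<close> by its primitive over \<open>[s, t]\<close>, which by hypothesis has size
  \<open>(t - s) min M (\<sigma> ((t - s) / \<epsilon>))\<close> in the domain of \<open>A\<^sub>1\<^sup>\<gamma>\<close>. The semigroup has to supply
  \<open>3/2 - \<gamma>\<close> further powers of \<open>A\<^sub>1\<close>; with the factor \<open>t - s\<close> this leaves the singularity
  \<open>(t - s)\<close> to the power \<open>\<gamma> - 1/2 > -1\<close>, which is integrable, and \<open>\<sigma> ((t - s) / \<epsilon>)\<close> tends to zero except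
  for \<open>s\<close> close to \<open>t\<close>.

  Gronwall's inequality then bounds \<open>z\<close>, provided that the constant \<open>K\<close> is the same for all data in the
  ball, that is, provided that the solutions stay in a common bounded set. For the averaged system this is
  a compactness argument (\<open>averaged_solutions_uniformly_bounded\<close>): bounded data have weak limits, whose
  solutions exist for all time, and since the heat semigroup turns weak convergence of the data into
  strong convergence for \<open>t > 0\<close>, the stability estimate (\<open>mild_solution_stability\<close>) carries the bound for
  the limit over to its neighbours. For the oscillating system a bootstrap suffices: as long as
  \<open>z \<le> 1\<close> the estimate applies, and it yields much less than \<open>1\<close> when \<open>\<epsilon>\<close> is small.

  All estimates are made on Fourier coefficients, as bounds for the square sums over finite sets of
  frequencies. They rest on three facts about the torus: the coefficients determine an
  integrable function (\<open>fourier_eq_0_imp_AE_eq_0\<close>), every square-summable family of coefficients belongs to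
  a function (\<open>Riesz_Fischer\<close>), and the \<open>L\<^sup>2\<close> norm is the \<open>\<ell>\<^sup>2\<close> norm of the coefficients (\<open>Parseval\<close>).
  The second one is behind the existence of the inverse Laplacian and of the weak limits.\<close>

section \<open>Plane waves on the unit cell\<close>

definition wave :: "int \<times> int \<Rightarrow> real \<times> real \<Rightarrow> complex" where
  "wave k p = cis (2 * pi * (of_int (fst k) * fst p + of_int (snd k) * snd p))"

lemma fourier_eq_wave: "fourier u k = (\<integral>p. of_real (u p) * cnj (wave k p) \<partial>cell)"
  unfolding fourier_def wave_def cis_cnj by simp

lemma wave_0 [simp]: "wave (0, 0) p = 1"
  by (simp add: wave_def)

lemma norm_wave [simp]: "norm (wave k p) = 1"
  by (simp add: wave_def)

lemma wave_mult: "wave j p * wave k p = wave (j + k) p"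
  unfolding wave_def cis_mult by (simp add: algebra_simps)

lemma cnj_wave: "cnj (wave k p) = wave (- k) p"
  unfolding wave_def cis_cnj by (simp add: algebra_simps)

lemma continuous_on_wave [continuous_intros]: "continuous_on A (wave k)"
  unfolding wave_def cis_conv_exp by (intro continuous_intros)

lemma measurable_wave [measurable]: "wave k \<in> borel_measurable borel"
  by (intro borel_measurable_continuous_onI continuous_on_wave)

lemma cell_sets: "({0..1::real} \<times> {0..1::real}) \<in> sets borel"
  by (intro borel_closed closed_Times closed_atLeastAtMost)

lemma cell_sets' [simp]: "({0..1::real} \<times> {0..1::real}) \<inter> space lborel \<in> sets lborel"
  using cell_sets by simp

lemma measurable_cell:
  "u \<in> borel_measurable borel \<Longrightarrow> u \<in> borel_measurable cell"
  by (rule measurable_restrict_space1) simp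

lemma measurable_wave_cell [measurable]: "wave k \<in> borel_measurable cell"
  by (intro measurable_cell measurable_wave)

lemma measurable_cnj_wave [measurable]: "(\<lambda>p. cnj (wave k p)) \<in> borel_measurable cell"
  unfolding cnj_wave by measurable

lemma space_cell: "space cell = {0..1} \<times> {0..1}"
  by (simp add: space_restrict_space)

lemma emeasure_unit_square: "emeasure lborel ({0..1::real} \<times> {0..1::real}) = 1"
proof -
  have "emeasure (lborel \<Otimes>\<^sub>M lborel) ({0..1::real} \<times> {0..1::real}) = 1"
    by (subst lborel.emeasure_pair_measure_Times) auto
  then show ?thesis by (simp add: lborel_prod)
qed

lemma emeasure_cell: "emeasure cell (space cell) = 1"
  unfolding space_cell by (subst emeasure_restrict_space) (use cell_sets in \<open>auto simp: emeasure_unit_square\<close>)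

interpretation cell: finite_measure cell
  using emeasure_cell by (intro finite_measureI) simp

lemma measure_cell [simp]: "measure cell (space cell) = 1"
  by (simp add: measure_def emeasure_cell)

lemma integrable_cell_continuous:
  fixes g :: "real \<times> real \<Rightarrow> 'a::euclidean_space"
  assumes "continuous_on UNIV g" shows "integrable cell g"
proof -
  have "compact ({0..1::real} \<times> {0..1::real})" by (intro compact_Times) auto
  then obtain B where B: "\<And>p. p \<in> {0..1} \<times> {0..1} \<Longrightarrow> norm (g p) \<le> B"
    using compact_imp_bounded[OF compact_continuous_image[OF continuous_on_subset[OF assms]]]
    by (metis bounded_iff imageI top_greatest)
  show ?thesis
  proof (rule cell.integrable_const_bound[where B=B])
    show "AE p in cell. norm (g p) \<le> B"
      using B by (intro AE_I2) (simp add: space_cell)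
    show "g \<in> borel_measurable cell"
      by (intro measurable_cell borel_measurable_continuous_onI assms)
  qed
qed

text \<open>Integration by parts on the torus: the values at opposite sides of the cell cancel.\<close>

lemma integral_cell_C1:
  assumes "C1_periodic \<phi> \<phi>x \<phi>z"
  shows "(\<integral>p. \<phi>x p \<partial>cell) = 0" and "(\<integral>p. \<phi>z p \<partial>cell) = 0"
proof -
  note C1 = assms[unfolded C1_periodic_def]
  note per = conjunct1[OF C1, unfolded periodic_def, rule_format]
  note cx = C1[THEN conjunct2, THEN conjunct1]
  note cz = C1[THEN conjunct2, THEN conjunct2, THEN conjunct1]
  note D = C1[THEN conjunct2, THEN conjunct2, THEN conjunct2, rule_format]
  have cxz: "continuous_on UNIV (\<lambda>x. \<phi>x (x, z))" and czx: "continuous_on UNIV (\<lambda>z. \<phi>z (x, z))" for x z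
    using continuous_on_compose2[OF cx, of UNIV "\<lambda>x. (x, z)"] continuous_on_compose2[OF cz, of UNIV "\<lambda>z. (x, z)"]
    by (simp_all add: continuous_on_Pair continuous_on_id continuous_on_const)
  have ind: "indicator ({0..1} \<times> {0..1}) (x, z) = (indicator {0..1} x * indicator {0..1} z :: real)"
    for x z :: real by (simp add: indicator_def)
  have Dx: "((\<lambda>x. \<phi> (x, z)) has_vector_derivative \<phi>x (x, z)) (at x within A)" for x z A
  proof -
    have "((\<lambda>x. \<phi> (x, z)) has_derivative (\<lambda>h. \<phi>x (x,z) * fst (h, 0::real) + \<phi>z (x,z) * snd (h, 0::real))) (at x)"
      by (rule has_derivative_compose[where f="\<lambda>x. (x, z)" and g=\<phi>, OF _ D])
         (auto intro!: derivative_eq_intros)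
    then show ?thesis
      by (auto simp: has_vector_derivative_def mult.commute intro: has_derivative_at_withinI)
  qed
  have Dz: "((\<lambda>z. \<phi> (x, z)) has_vector_derivative \<phi>z (x, z)) (at z within A)" for x z A
  proof -
    have "((\<lambda>z. \<phi> (x, z)) has_derivative (\<lambda>h. \<phi>x (x,z) * fst (0::real, h) + \<phi>z (x,z) * snd (0::real, h))) (at z)"
      by (rule has_derivative_compose[where f="\<lambda>z. (x, z)" and g=\<phi>, OF _ D])
         (auto intro!: derivative_eq_intros)
    then show ?thesis
      by (auto simp: has_vector_derivative_def mult.commute intro: has_derivative_at_withinI)
  qed
  have intx: "integrable (lborel \<Otimes>\<^sub>M lborel) (\<lambda>(x, z). indicator ({0..1} \<times> {0..1}) (x, z) *\<^sub>R \<phi>x (x, z))"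
    using integrable_cell_continuous[OF cx]
    by (subst (asm) integrable_restrict_space) (use cell_sets in \<open>auto simp: lborel_prod case_prod_unfold\<close>)
  have intz: "integrable (lborel \<Otimes>\<^sub>M lborel) (\<lambda>(x, z). indicator ({0..1} \<times> {0..1}) (x, z) *\<^sub>R \<phi>z (x, z))"
    using integrable_cell_continuous[OF cz]
    by (subst (asm) integrable_restrict_space) (use cell_sets in \<open>auto simp: lborel_prod case_prod_unfold\<close>)
  have Ix: "(\<integral>x. indicator {0..1} x *\<^sub>R \<phi>x (x, z) \<partial>lborel) = 0" for z
    using per[of 0 z, THEN conjunct1]
    by (subst integral_FTC_atLeastAtMost[where F="\<lambda>x. \<phi> (x, z)"])
       (auto intro!: Dx continuous_on_subset[OF cxz])
  have Iz: "(\<integral>z. indicator {0..1} z *\<^sub>R \<phi>z (x, z) \<partial>lborel) = 0" for x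
    using per[of x 0, THEN conjunct2]
    by (subst integral_FTC_atLeastAtMost[where F="\<lambda>z. \<phi> (x, z)"])
       (auto intro!: Dz continuous_on_subset[OF czx])
  have "(\<integral>p. \<phi>x p \<partial>cell) = (\<integral>(x, z). indicator ({0..1} \<times> {0..1}) (x, z) *\<^sub>R \<phi>x (x, z) \<partial>(lborel \<Otimes>\<^sub>M lborel))"
    by (subst integral_restrict_space) (use cell_sets in \<open>auto simp: lborel_prod case_prod_unfold\<close>)
  also have "\<dots> = (\<integral>z. (\<integral>x. indicator ({0..1} \<times> {0..1}) (x, z) *\<^sub>R \<phi>x (x, z) \<partial>lborel) \<partial>lborel)"
    using lborel_pair.integral_snd[of "\<lambda>x z. indicator ({0..1} \<times> {0..1}) (x, z) *\<^sub>R \<phi>x (x, z)"] intx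
    by simp
  also have "\<dots> = (\<integral>z. indicator {0..1} z * (\<integral>x. indicator {0..1} x *\<^sub>R \<phi>x (x, z) \<partial>lborel) \<partial>lborel)"
    unfolding integral_mult_right_zero[symmetric]
    by (intro Bochner_Integration.integral_cong refl) (simp add: ind)
  finally show "(\<integral>p. \<phi>x p \<partial>cell) = 0" unfolding Ix by simp
  have "(\<integral>p. \<phi>z p \<partial>cell) = (\<integral>(x, z). indicator ({0..1} \<times> {0..1}) (x, z) *\<^sub>R \<phi>z (x, z) \<partial>(lborel \<Otimes>\<^sub>M lborel))"
    by (subst integral_restrict_space) (use cell_sets in \<open>auto simp: lborel_prod case_prod_unfold\<close>)
  also have "\<dots> = (\<integral>x. (\<integral>z. indicator ({0..1} \<times> {0..1}) (x, z) *\<^sub>R \<phi>z (x, z) \<partial>lborel) \<partial>lborel)"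
    using lborel_pair.integral_fst[of "\<lambda>x z. indicator ({0..1} \<times> {0..1}) (x, z) *\<^sub>R \<phi>z (x, z)"] intz
    by simp
  also have "\<dots> = (\<integral>x. indicator {0..1} x * (\<integral>z. indicator {0..1} z *\<^sub>R \<phi>z (x, z) \<partial>lborel) \<partial>lborel)"
    unfolding integral_mult_right_zero[symmetric]
    by (intro Bochner_Integration.integral_cong refl) (simp add: ind)
  finally show "(\<integral>p. \<phi>z p \<partial>cell) = 0" unfolding Iz by simp
qed

lemma wave_Re: "Re (wave k p) = cos (2 * pi * (of_int (fst k) * fst p + of_int (snd k) * snd p))"
  and wave_Im: "Im (wave k p) = sin (2 * pi * (of_int (fst k) * fst p + of_int (snd k) * snd p))"
  by (simp_all add: wave_def)

lemma wave_periodic: "wave k (x + 1, z) = wave k (x, z)" "wave k (x, z + 1) = wave k (x, z)"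
proof -
  have c: "cis (a + 2 * pi * of_int m) = cis a" for a m
  proof -
    have "cis (a + 2 * pi * of_int m) = cis a * cis (2 * pi * of_int m)"
      by (rule cis_mult[symmetric])
    also have "cis (2 * pi * of_int m) = 1"
      by (rule cis_multiple_2pi) (rule Ints_of_int)
    finally show ?thesis by (simp only: mult_1_right)
  qed
  have "2 * pi * (of_int (fst k) * (x + 1) + of_int (snd k) * z)
      = 2 * pi * (of_int (fst k) * x + of_int (snd k) * z) + 2 * pi * of_int (fst k)"
    by (simp only: distrib_left mult_1_right add.assoc add.commute add.left_commute)
  then show "wave k (x + 1, z) = wave k (x, z)"
    unfolding wave_def fst_conv snd_conv by (simp only: c)
  have "2 * pi * (of_int (fst k) * x + of_int (snd k) * (z + 1))
      = 2 * pi * (of_int (fst k) * x + of_int (snd k) * z) + 2 * pi * of_int (snd k)"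
    by (simp only: distrib_left mult_1_right add.assoc add.commute add.left_commute)
  then show "wave k (x, z + 1) = wave k (x, z)"
    unfolding wave_def fst_conv snd_conv by (simp only: c)
qed

lemma C1_periodic_cos:
  "C1_periodic (\<lambda>p. Re (wave k p)) (\<lambda>p. - 2 * pi * of_int (fst k) * Im (wave k p))
     (\<lambda>p. - 2 * pi * of_int (snd k) * Im (wave k p))"
  unfolding C1_periodic_def
proof (intro conjI allI)
  show "periodic (\<lambda>p. Re (wave k p))"
    by (simp add: periodic_def wave_periodic)
  fix p
  show "((\<lambda>p. Re (wave k p)) has_derivative (\<lambda>h. - 2 * pi * of_int (fst k) * Im (wave k p) * fst h +
      - 2 * pi * of_int (snd k) * Im (wave k p) * snd h)) (at p)"
    unfolding wave_Re wave_Im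
    by (rule derivative_eq_intros refl | simp add: algebra_simps)+
qed (intro continuous_intros)+

lemma C1_periodic_sin:
  "C1_periodic (\<lambda>p. Im (wave k p)) (\<lambda>p. 2 * pi * of_int (fst k) * Re (wave k p))
     (\<lambda>p. 2 * pi * of_int (snd k) * Re (wave k p))"
  unfolding C1_periodic_def
proof (intro conjI allI)
  show "periodic (\<lambda>p. Im (wave k p))"
    by (simp add: periodic_def wave_periodic)
  fix p
  show "((\<lambda>p. Im (wave k p)) has_derivative (\<lambda>h. 2 * pi * of_int (fst k) * Re (wave k p) * fst h +
      2 * pi * of_int (snd k) * Re (wave k p) * snd h)) (at p)"
    unfolding wave_Re wave_Im
    by (rule derivative_eq_intros refl | simp add: algebra_simps)+
qed (intro continuous_intros)+

lemma integrable_wave [simp]: "integrable cell (wave k)"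
  by (intro integrable_cell_continuous continuous_intros)

lemma integral_wave: "(\<integral>p. wave k p \<partial>cell) = (if k = (0, 0) then 1 else 0)"
proof (cases "k = (0, 0)")
  case True
  then show ?thesis by simp
next
  case False
  then have *: "fst k \<noteq> 0 \<or> snd k \<noteq> 0" by (cases k) auto
  have "(\<integral>p. Re (wave k p) \<partial>cell) = 0" "(\<integral>p. Im (wave k p) \<partial>cell) = 0"
    using integral_cell_C1[OF C1_periodic_cos[of k]] integral_cell_C1[OF C1_periodic_sin[of k]] *
    by auto
  then show ?thesis using False by (simp add: complex_eq_iff)
qed

lemma wave_orthonormal: "(\<integral>p. wave k p * cnj (wave j p) \<partial>cell) = (if k = j then 1 else 0)"
  unfolding cnj_wave wave_mult integral_wave by (cases k, cases j) auto

section \<open>Fourier coefficients determine an integrable function\<close>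

text \<open>The bounded functions \<open>h\<close> for which \<open>u h\<close> again has vanishing Fourier coefficients. Asking for all
  coefficients of \<open>u h\<close>, and not only for its integral to vanish, makes the class stable under
  multiplication by exponentials. With bounded limits it then reaches the indicators of rectangles, and
  so the integral of \<open>u\<close> over every rectangle is zero.\<close>

definition null_multiplier :: "(real \<times> real \<Rightarrow> real) \<Rightarrow> (real \<times> real \<Rightarrow> real) \<Rightarrow> bool" where
  "null_multiplier u h \<longleftrightarrow> h \<in> borel_measurable cell \<and> (\<exists>B. \<forall>p\<in>space cell. \<bar>h p\<bar> \<le> B) \<and>
     (\<forall>k. fourier (\<lambda>p. u p * h p) k = 0)"

lemma integrable_mult_bounded:
  fixes u :: "'a \<Rightarrow> 'b::{real_normed_algebra,banach,second_countable_topology}"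
  assumes "integrable M u" and "h \<in> borel_measurable M" and "\<And>p. p \<in> space M \<Longrightarrow> norm (h p) \<le> B"
  shows "integrable M (\<lambda>p. u p * h p)"
proof (rule Bochner_Integration.integrable_bound[where f="\<lambda>p. B * norm (u p)"])
  show "AE p in M. norm (u p * h p) \<le> norm (B * norm (u p))"
  proof (rule AE_I2)
    fix p assume "p \<in> space M"
    then have "norm (u p * h p) \<le> norm (u p) * B"
      by (meson assms(3) mult_left_mono norm_ge_zero norm_mult_ineq order_trans)
    then show "norm (u p * h p) \<le> norm (B * norm (u p))"
      by (simp add: mult.commute)
  qed
qed (use assms in auto)

lemma integrable_fourier_integrand:
  assumes "integrable cell u"
  shows "integrable cell (\<lambda>p. of_real (u p) * cnj (wave k p))"
  using assms by (intro integrable_mult_bounded[where B=1]) (auto simp: cnj_wave)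

lemma fourier_add:
  assumes "integrable cell u" "integrable cell v"
  shows "fourier (\<lambda>p. u p + v p) k = fourier u k + fourier v k"
  unfolding fourier_eq_wave using assms
  by (simp add: distrib_right integrable_fourier_integrand)

lemma fourier_diff:
  assumes "integrable cell u" "integrable cell v"
  shows "fourier (\<lambda>p. u p - v p) k = fourier u k - fourier v k"
  unfolding fourier_eq_wave using assms
  by (simp add: left_diff_distrib integrable_fourier_integrand)

lemma fourier_scale: "fourier (\<lambda>p. c * u p) k = of_real c * fourier u k"
  unfolding fourier_eq_wave by (simp add: mult.assoc)

lemma fourier_cong_AE:
  assumes "AE p in cell. u p = v p" "u \<in> borel_measurable cell" "v \<in> borel_measurable cell"
  shows "fourier u k = fourier v k"
  unfolding fourier_eq_wave
  by (intro integral_cong_AE) (use assms in auto)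

lemma null_multiplier_1:
  assumes "\<And>k. fourier u k = 0" shows "null_multiplier u (\<lambda>_. 1)"
  using assms unfolding null_multiplier_def by auto

lemma null_multiplier_integrable:
  assumes "integrable cell u" "null_multiplier u h"
  shows "integrable cell (\<lambda>p. u p * h p)"
proof -
  obtain B where "\<forall>p\<in>space cell. \<bar>h p\<bar> \<le> B" "h \<in> borel_measurable cell"
    using assms(2) unfolding null_multiplier_def by blast
  then show ?thesis
    by (intro integrable_mult_bounded[where B=B] assms(1)) auto
qed

lemma null_multiplier_measurable: "null_multiplier u h \<Longrightarrow> h \<in> borel_measurable cell"
  unfolding null_multiplier_def by simp

lemma null_multiplierI:
  assumes "h \<in> borel_measurable cell" "\<forall>p\<in>space cell. \<bar>h p\<bar> \<le> B" "\<And>k. fourier (\<lambda>p. u p * h p) k = 0"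
  shows "null_multiplier u h"
  using assms unfolding null_multiplier_def by blast

lemma null_multiplier_fourier: "null_multiplier u h \<Longrightarrow> fourier (\<lambda>p. u p * h p) k = 0"
  unfolding null_multiplier_def by blast

lemma null_multiplier_add:
  assumes "integrable cell u" "null_multiplier u g" "null_multiplier u h"
  shows "null_multiplier u (\<lambda>p. g p + h p)"
proof -
  obtain A B where A: "\<forall>p\<in>space cell. \<bar>g p\<bar> \<le> A" and B: "\<forall>p\<in>space cell. \<bar>h p\<bar> \<le> B"
    using assms(2,3) unfolding null_multiplier_def by blast
  have "\<forall>p\<in>space cell. \<bar>g p + h p\<bar> \<le> A + B" using A B by (auto intro: order_trans[OF abs_triangle_ineq] add_mono)
  moreover have "fourier (\<lambda>p. u p * (g p + h p)) k = 0" for k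
    using fourier_add[OF null_multiplier_integrable[OF assms(1,2)] null_multiplier_integrable[OF assms(1,3)]]
    by (simp add: distrib_left null_multiplier_fourier[OF assms(2)] null_multiplier_fourier[OF assms(3)])
  ultimately show ?thesis
    using assms(2,3)[THEN null_multiplier_measurable] by (intro null_multiplierI) auto
qed

lemma null_multiplier_scale:
  assumes "null_multiplier u h" shows "null_multiplier u (\<lambda>p. c * h p)"
proof -
  obtain B where B: "\<forall>p\<in>space cell. \<bar>h p\<bar> \<le> B" using assms unfolding null_multiplier_def by blast
  then have "\<forall>p\<in>space cell. \<bar>c * h p\<bar> \<le> \<bar>c\<bar> * B" by (auto simp: abs_mult mult_left_mono)
  moreover have "fourier (\<lambda>p. u p * (c * h p)) k = 0" for k
    using fourier_scale[of c "\<lambda>p. u p * h p" k]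
    by (simp add: null_multiplier_fourier[OF assms] mult.left_commute)
  ultimately show ?thesis
    using assms[THEN null_multiplier_measurable] by (intro null_multiplierI) auto
qed

lemma null_multiplier_limit:
  assumes u: "integrable cell u" and h: "\<And>n::nat. null_multiplier u (h n)"
    and B: "\<And>n p. p \<in> space cell \<Longrightarrow> \<bar>h n p\<bar> \<le> B"
    and g: "g \<in> borel_measurable cell" "\<And>p. p \<in> space cell \<Longrightarrow> \<bar>g p\<bar> \<le> C"
    and lim: "AE p in cell. (\<lambda>n. h n p) \<longlonglongrightarrow> g p"
  shows "null_multiplier u g"
proof -
  have "fourier (\<lambda>p. u p * g p) k = 0" for k
  proof -
    have "(\<lambda>n. fourier (\<lambda>p. u p * h n p) k) \<longlonglongrightarrow> fourier (\<lambda>p. u p * g p) k"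
      unfolding fourier_eq_wave
    proof (rule integral_dominated_convergence[where w="\<lambda>p. \<bar>u p\<bar> * B"])
      show "AE p in cell. (\<lambda>n. of_real (u p * h n p) * cnj (wave k p)) \<longlonglongrightarrow> of_real (u p * g p) * cnj (wave k p)"
        using lim by eventually_elim (intro tendsto_intros)
      show "AE p in cell. norm (of_real (u p * h n p) * cnj (wave k p)) \<le> \<bar>u p\<bar> * B" for n
        using B by (intro AE_I2) (simp add: norm_mult abs_mult mult_left_mono)
    qed (use u g null_multiplier_measurable[OF h] in \<open>auto simp: cnj_wave\<close>)
    moreover have "fourier (\<lambda>p. u p * h n p) k = 0" for n
      using h by (rule null_multiplier_fourier)
    ultimately show ?thesis by (simp add: LIMSEQ_const_iff)
  qed
  then show ?thesis using g unfolding null_multiplier_def by blast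
qed

lemma null_multiplier_AE:
  assumes u: "integrable cell u" and h: "null_multiplier u h" and eq: "AE p in cell. h p = g p"
    and g: "g \<in> borel_measurable cell" "\<And>p. p \<in> space cell \<Longrightarrow> \<bar>g p\<bar> \<le> C"
  shows "null_multiplier u g"
proof -
  obtain B where B: "\<forall>p\<in>space cell. \<bar>h p\<bar> \<le> B" using h unfolding null_multiplier_def by blast
  show ?thesis
    by (rule null_multiplier_limit[OF u h, where B=B and C=C]) (use B g eq in auto)
qed

text \<open>Multiplying by an exponential only shifts the Fourier coefficients.\<close>

lemma null_multiplier_wave:
  assumes u: "integrable cell u" and h: "null_multiplier u h"
  shows "null_multiplier u (\<lambda>p. h p * Re (a * wave j p))"
proof -
  have m [measurable]: "h \<in> borel_measurable cell" by (rule null_multiplier_measurable[OF h])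
  obtain B where B: "\<forall>p\<in>space cell. \<bar>h p\<bar> \<le> B" using h unfolding null_multiplier_def by blast
  have "\<forall>p\<in>space cell. \<bar>h p * Re (a * wave j p)\<bar> \<le> B * norm a"
  proof
    fix p assume "p \<in> space cell"
    then show "\<bar>h p * Re (a * wave j p)\<bar> \<le> B * norm a"
      using B abs_Re_le_cmod[of "a * wave j p"] unfolding abs_mult
      by (intro mult_mono) (auto simp: norm_mult intro: order_trans[of 0 "\<bar>h p\<bar>"])
  qed
  moreover have "fourier (\<lambda>p. u p * (h p * Re (a * wave j p))) k = 0" for k
  proof -
    have eq: "of_real (u p * (h p * Re (a * wave j p))) * cnj (wave k p) =
        (a / 2) * (of_real (u p * h p) * cnj (wave (k - j) p)) +
        (cnj a / 2) * (of_real (u p * h p) * cnj (wave (k + j) p))" for p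
    proof -
      have "complex_of_real (Re (a * wave j p)) = (a * wave j p + cnj a * wave (- j) p) / 2"
        using complex_add_cnj[of "a * wave j p"] by (simp add: cnj_wave)
      note R = this
      have W: "cnj (wave (k - j) p) = wave j p * cnj (wave k p)"
        "cnj (wave (k + j) p) = wave (- j) p * cnj (wave k p)"
        by (simp_all add: cnj_wave wave_mult algebra_simps)
      show ?thesis unfolding of_real_mult R W by (simp add: field_simps)
    qed
    show ?thesis
      using integrable_fourier_integrand[OF null_multiplier_integrable[OF u h]]
      unfolding fourier_eq_wave eq
      using null_multiplier_fourier[OF h] by (simp add: fourier_eq_wave)
  qed
  ultimately show ?thesis by (intro null_multiplierI[where B="B * norm a"]) auto
qed

text \<open>Powers of \<open>Re (a * wave j p)\<close> are reached by iterating multiplication with it, which is why the factor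
  \<open>h\<close> has to be arbitrary in the induction.\<close>

lemma null_multiplier_poly:
  assumes u: "integrable cell u" and g: "real_polynomial_function g"
  shows "null_multiplier u h \<Longrightarrow> null_multiplier u (\<lambda>p. h p * g (Re (a * wave j p)))"
  using g
proof (induction g arbitrary: h rule: real_polynomial_function.induct)
  case (linear f)
  then obtain c where "f = (\<lambda>x. x * c)" by (auto simp: real_bounded_linear)
  then show ?case
    using null_multiplier_scale[OF null_multiplier_wave[OF u linear(2), of a j], of c]
    by (simp add: mult.commute mult.left_commute)
next
  case (const c)
  then show ?case using null_multiplier_scale[of u h c] by (simp add: mult.commute)
next
  case (add f g)
  then show ?case using null_multiplier_add[OF u] by (simp add: distrib_left)
next
  case (mult f g)
  then show ?case by (simp add: mult.assoc[symmetric])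
qed

text \<open>The Weierstrass theorem in one variable suffices, because \<open>G\<close> is only evaluated at the real number
  \<open>Re (a * wave j p)\<close>, which stays in \<open>[-1, 1]\<close>.\<close>

lemma null_multiplier_continuous:
  assumes u: "integrable cell u" and h: "null_multiplier u h"
    and G: "continuous_on {-1..1} G" and a: "norm a = 1"
    and m: "(\<lambda>p. G (Re (a * wave j p))) \<in> borel_measurable cell"
  shows "null_multiplier u (\<lambda>p. h p * G (Re (a * wave j p)))"
proof -
  have "\<exists>g. real_polynomial_function g \<and> (\<forall>x\<in>{-1..1}. \<bar>G x - g x\<bar> < inverse (real (Suc n)))" for n
    by (rule Stone_Weierstrass_real_polynomial_function[OF compact_Icc G, of "inverse (real (Suc n))"]) auto
  then obtain g where g: "\<And>n. real_polynomial_function (g n)"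
    and gG: "\<And>n x. x \<in> {-1..1} \<Longrightarrow> \<bar>G x - g n x\<bar> < inverse (real (Suc n))" by metis
  obtain B where B: "\<And>p. p \<in> space cell \<Longrightarrow> \<bar>h p\<bar> \<le> B" using h unfolding null_multiplier_def by blast
  obtain C where C: "\<And>x. x \<in> {-1..1} \<Longrightarrow> \<bar>G x\<bar> \<le> C"
    using compact_imp_bounded[OF compact_continuous_image[OF G]] unfolding bounded_iff real_norm_def
    by (metis compact_Icc imageI)
  have in1: "Re (a * wave j p) \<in> {-1..1}" for p
    using abs_Re_le_cmod[of "a * wave j p"] a by (auto simp: norm_mult abs_le_iff)
  have B0: "0 \<le> B" using B[of "(0,0)"] by (auto simp: space_cell)
  show ?thesis
  proof (rule null_multiplier_limit[OF u null_multiplier_poly[OF u g h]])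
    show "\<bar>h p * g n (Re (a * wave j p))\<bar> \<le> B * (C + 1)" if "p \<in> space cell" for n p
    proof -
      have "inverse (real (Suc n)) \<le> 1" by (simp add: field_simps)
      then have "\<bar>g n (Re (a * wave j p))\<bar> \<le> C + 1"
        using C[OF in1[of p]] gG[OF in1[of p], of n] by linarith
      then show ?thesis unfolding abs_mult using B[OF that] B0 by (intro mult_mono) auto
    qed
    show "\<bar>h p * G (Re (a * wave j p))\<bar> \<le> B * C" if "p \<in> space cell" for p
      unfolding abs_mult using B[OF that] C[OF in1[of p]] B0 by (intro mult_mono) auto
    show "(\<lambda>p. h p * G (Re (a * wave j p))) \<in> borel_measurable cell"
      using m null_multiplier_measurable[OF h] by simp
    have "(\<lambda>n. g n x) \<longlonglongrightarrow> G x" if "x \<in> {-1..1}" for x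
    proof (rule LIMSEQ_I)
      fix r :: real assume "0 < r"
      then obtain N where N: "inverse (real (Suc N)) < r" using reals_Archimedean by blast
      have "norm (g n x - G x) < r" if "n \<ge> N" for n
      proof -
        have "inverse (real (Suc n)) \<le> inverse (real (Suc N))" using that by (simp add: field_simps)
        with gG[OF \<open>x \<in> {-1..1}\<close>, of n] N show ?thesis unfolding real_norm_def by linarith
      qed
      then show "\<exists>no. \<forall>n\<ge>no. norm (g n x - G x) < r" by blast
    qed
    then show "AE p in cell. (\<lambda>n. h p * g n (Re (a * wave j p))) \<longlonglongrightarrow> h p * G (Re (a * wave j p))"
      using in1 by (intro AE_I2 tendsto_intros) blast
  qed
qed

lemma null_multiplier_arc:
  assumes u: "integrable cell u" and h: "null_multiplier u h" and a: "norm a = 1"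
  shows "null_multiplier u (\<lambda>p. h p * indicator {d<..} (Re (a * wave j p)))"
proof -
  obtain B where B: "\<And>p. p \<in> space cell \<Longrightarrow> \<bar>h p\<bar> \<le> B" using h unfolding null_multiplier_def by blast
  have B0: "0 \<le> B" using B[of "(0,0)"] by (auto simp: space_cell)
  have m [measurable]: "h \<in> borel_measurable cell" by (rule null_multiplier_measurable[OF h])
  \<comment> \<open>Ramps that increase to the indicator of \<open>{d<..}\<close>; they are \<open>0\<close> at \<open>d\<close>, whence the open half line.\<close>
  define G where "G n y = min 1 (max 0 (real n * (y - d)))" for n y
  have G1: "\<bar>G n y\<bar> \<le> 1" for n y by (auto simp: G_def)
  have cG: "continuous_on A (G n)" for A n unfolding G_def by (intro continuous_intros)
  have [measurable]: "(\<lambda>p. Re (a * wave j p)) \<in> borel_measurable cell"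
    by (intro measurable_cell borel_measurable_continuous_onI continuous_intros)
  have lim: "(\<lambda>n. G n y) \<longlonglongrightarrow> indicator {d<..} y" for y
  proof (cases "d < y")
    case True
    obtain N where N: "1 < real N * (y - d)" using reals_Archimedean3[of "y - d"] True by auto
    have "G n y = 1" if "n \<ge> N" for n
    proof -
      have "real N * (y - d) \<le> real n * (y - d)" using that True by (intro mult_right_mono) auto
      then show ?thesis using N by (simp add: G_def)
    qed
    then show ?thesis using True
      by (intro tendsto_eventually) (auto simp: eventually_sequentially)
  next
    case False
    then have "G n y = 0" for n by (simp add: G_def mult_nonneg_nonpos)
    then show ?thesis using False by simp
  qed
  have meas: "(\<lambda>p. G n (Re (a * wave j p))) \<in> borel_measurable cell" for n
    unfolding G_def by measurable
  show ?thesis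
  proof (rule null_multiplier_limit[OF u null_multiplier_continuous[OF u h cG a meas]])
    show "\<bar>h p * G n (Re (a * wave j p))\<bar> \<le> B * 1" if "p \<in> space cell" for n p
      unfolding abs_mult using B[OF that] G1 B0 by (intro mult_mono) auto
    show "\<bar>h p * indicator {d<..} (Re (a * wave j p))\<bar> \<le> B" if "p \<in> space cell" for p
      using B[OF that] B0 by (auto simp: indicator_def)
    show "AE p in cell. (\<lambda>n. h p * G n (Re (a * wave j p))) \<longlonglongrightarrow> h p * indicator {d<..} (Re (a * wave j p))"
      by (intro AE_I2 tendsto_intros lim)
  qed measurable
qed

lemma AE_cell_coordinate_neq: "AE p in cell. fst p \<noteq> c" "AE p in cell. snd p \<noteq> c"
proof -
  have e: "emeasure lborel ({c} \<times> (UNIV :: real set)) = 0" "emeasure lborel ((UNIV :: real set) \<times> {c}) = 0"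
    unfolding lborel_prod[symmetric] by (subst lborel.emeasure_pair_measure_Times; simp)+
  have s: "{c} \<times> (UNIV :: real set) \<in> sets borel" "(UNIV :: real set) \<times> {c} \<in> sets borel"
    by (intro borel_closed closed_Times; simp)+
  have "AE p in (lborel :: (real \<times> real) measure). fst p \<noteq> c"
    by (rule AE_I[of _ _ "{c} \<times> UNIV"]) (auto simp: e(1) s(1) simp del: sets_lborel intro!: s(1)[folded sets_lborel])
  moreover have "AE p in (lborel :: (real \<times> real) measure). snd p \<noteq> c"
    by (rule AE_I[of _ _ "UNIV \<times> {c}"]) (auto simp: e(2) s(2) simp del: sets_lborel intro!: s(2)[folded sets_lborel])
  ultimately show "AE p in cell. fst p \<noteq> c" "AE p in cell. snd p \<noteq> c"
    by (auto simp: AE_restrict_space_iff[OF cell_sets'] elim: eventually_mono)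
qed

text \<open>Modulo the period, \<open>{x. x < a}\<close> is the arc with centre \<open>a / 2\<close> on which the cosine
  exceeds its value at the end points.\<close>

lemma less_iff_cos_arc:
  assumes "0 < x" "x < 1" "0 < a" "a \<le> 1"
  shows "x < a \<longleftrightarrow> cos (pi * a) < cos (2 * pi * x - pi * a)"
proof -
  have c: "cos (2 * pi * x - pi * a) = cos \<bar>2 * pi * x - pi * a\<bar>" by simp
  have pa: "pi * a \<le> pi" "0 < pi * a" using assms by auto
  show ?thesis
  proof
    assume "x < a"
    then have "pi * x < pi * a" "0 < pi * x" using assms by auto
    then have "\<bar>2 * pi * x - pi * a\<bar> < pi * a" by (simp add: abs_less_iff)
    then show "cos (pi * a) < cos (2 * pi * x - pi * a)"
      unfolding c using pa by (intro cos_monotone_0_pi) auto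
  next
    assume *: "cos (pi * a) < cos (2 * pi * x - pi * a)"
    show "x < a"
    proof (rule ccontr)
      assume "\<not> x < a"
      then have 1: "pi * a \<le> pi * x" "pi * x < pi" using assms by auto
      show False
      proof (cases "2 * pi * x - pi * a \<le> pi")
        case True
        then have "cos (2 * pi * x - pi * a) \<le> cos (pi * a)"
          using 1 pa by (intro cos_monotone_0_pi_le) auto
        then show False using * by simp
      next
        case False
        have "cos (2 * pi * x - pi * a) = cos (2 * pi - (2 * pi * x - pi * a))"
          by (simp only: cos_2pi_minus)
        also have "\<dots> \<le> cos (pi * a)"
          using 1 pa False by (intro cos_monotone_0_pi_le) auto
        finally show False using * by simp
      qed
    qed
  qed
qed

lemma null_multiplier_halfplane:
  assumes u: "integrable cell u" and h: "null_multiplier u h"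
  shows "null_multiplier u (\<lambda>p. h p * indicator {..<a} (fst p))"
    and "null_multiplier u (\<lambda>p. h p * indicator {..<a} (snd p))"
proof -
  obtain B where B: "\<And>p. p \<in> space cell \<Longrightarrow> \<bar>h p\<bar> \<le> B" using h unfolding null_multiplier_def by blast
  have m [measurable]: "h \<in> borel_measurable cell" by (rule null_multiplier_measurable[OF h])
  have [measurable]: "fst \<in> borel_measurable cell" "snd \<in> borel_measurable cell"
    by (intro measurable_cell borel_measurable_continuous_onI continuous_intros)+
  have main: "null_multiplier u (\<lambda>p. h p * indicator {..<a} (pr p))"
    if pr: "pr = fst \<and> j = (1, 0) \<or> pr = snd \<and> j = (0, 1)" for pr and j :: "int \<times> int"
  proof -
    have [measurable]: "pr \<in> borel_measurable cell" using pr by auto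
    have rng: "AE p in cell. 0 < pr p \<and> pr p < 1"
      using AE_cell_coordinate_neq[of 0] AE_cell_coordinate_neq[of 1] AE_space[of cell] 
      by eventually_elim (use pr in \<open>auto simp: space_cell\<close>)
    have w: "wave j p = cis (2 * pi * pr p)" for p using pr by (auto simp: wave_def)
    have bd: "\<bar>h p * indicator {..<a} (pr p)\<bar> \<le> B" if "p \<in> space cell" for p
      using B[OF that] by (auto simp: indicator_def)
    have ms: "(\<lambda>p. h p * indicator {..<a} (pr p)) \<in> borel_measurable cell" by measurable
    \<comment> \<open>Up to the null set of the boundary of the cell the indicator is \<open>0\<close>, an arc, or \<open>1\<close>.\<close>
    consider "a \<le> 0" | "0 < a" "a \<le> 1" | "1 < a" by linarith
    then show ?thesis
    proof cases
      case 1
      have "null_multiplier u (\<lambda>p. 0 * h p)" by (rule null_multiplier_scale[OF h])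
      then show ?thesis
        by (rule null_multiplier_AE[OF u _ _ ms bd])
           (use rng 1 in \<open>auto elim!: eventually_mono simp: indicator_def\<close>)
    next
      case 2
      have "null_multiplier u (\<lambda>p. h p * indicator {cos (pi * a)<..} (Re (cis (- (pi * a)) * wave j p)))"
        by (rule null_multiplier_arc[OF u h]) simp
      then show ?thesis
      proof (rule null_multiplier_AE[OF u _ _ ms bd])
        show "AE p in cell. h p * indicator {cos (pi * a)<..} (Re (cis (- (pi * a)) * wave j p)) =
            h p * indicator {..<a} (pr p)"
          using rng
        proof eventually_elim
          case (elim p)
          have "Re (cis (- (pi * a)) * wave j p) = cos (2 * pi * pr p - pi * a)"
            unfolding w cis_mult by simp
          then show ?case using less_iff_cos_arc[of "pr p" a] elim 2 by (simp add: indicator_def)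
        qed
      qed
    next
      case 3
      show ?thesis
        by (rule null_multiplier_AE[OF u h _ ms bd])
           (rule eventually_mono[OF rng], use 3 in \<open>auto simp: indicator_def\<close>)
    qed
  qed
  show "null_multiplier u (\<lambda>p. h p * indicator {..<a} (fst p))" using main[of fst "(1, 0)"] by simp
  show "null_multiplier u (\<lambda>p. h p * indicator {..<a} (snd p))" using main[of snd "(0, 1)"] by simp
qed

lemma null_multiplier_interval:
  assumes u: "integrable cell u" and h: "null_multiplier u h"
  shows "null_multiplier u (\<lambda>p. h p * indicator {a<..<b} (fst p))"
    and "null_multiplier u (\<lambda>p. h p * indicator {a<..<b} (snd p))"
proof -
  obtain B where B: "\<And>p. p \<in> space cell \<Longrightarrow> \<bar>h p\<bar> \<le> B" using h unfolding null_multiplier_def by blast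
  have m [measurable]: "h \<in> borel_measurable cell" by (rule null_multiplier_measurable[OF h])
  have [measurable]: "fst \<in> borel_measurable cell" "snd \<in> borel_measurable cell"
    by (intro measurable_cell borel_measurable_continuous_onI continuous_intros)+
  have bd: "\<bar>h p * indicator {a<..<b} y\<bar> \<le> B" if "p \<in> space cell" for p y
    using B[OF that] by (auto simp: indicator_def)
  show "null_multiplier u (\<lambda>p. h p * indicator {a<..<b} (fst p))"
  proof -
    note 1 = null_multiplier_halfplane(1)[OF u h, of b]
    note 2 = null_multiplier_add[OF u 1 null_multiplier_scale[OF null_multiplier_halfplane(1)[OF u 1, of a], of "-1"]]
    show ?thesis
      by (rule null_multiplier_AE[OF u 2 _ _ bd])
         (use AE_cell_coordinate_neq(1)[of a] in \<open>auto elim!: eventually_mono simp: indicator_def\<close>)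
  qed
  show "null_multiplier u (\<lambda>p. h p * indicator {a<..<b} (snd p))"
  proof -
    note 1 = null_multiplier_halfplane(2)[OF u h, of b]
    note 2 = null_multiplier_add[OF u 1 null_multiplier_scale[OF null_multiplier_halfplane(2)[OF u 1, of a], of "-1"]]
    show ?thesis
      by (rule null_multiplier_AE[OF u 2 _ _ bd])
         (use AE_cell_coordinate_neq(2)[of a] in \<open>auto elim!: eventually_mono simp: indicator_def\<close>)
  qed
qed

text \<open>The integral of \<open>u\<close> vanishes over boxes, which are stable under intersection and generate the Borel sets;
  by Dynkin's theorem it vanishes over every Borel subset of the cell.\<close>

lemma fourier_eq_0_imp_AE_eq_0:
  assumes u: "integrable cell u" and f: "\<And>k. fourier u k = 0"
  shows "AE p in cell. u p = 0"
proof -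
  let ?P = "\<lambda>A. (LINT p:A \<inter> space cell|cell. u p) = 0"
  have sets: "A \<inter> space cell \<in> sets cell" if "A \<in> sets borel" for A
    using that unfolding sets_restrict_space space_cell by (auto simp: Int_commute)
  have si: "set_integrable cell A u" if "A \<in> sets cell" for A
    using u that unfolding set_integrable_def by (intro integrable_mult_indicator)
  have eq: "(LINT p:A \<inter> space cell|cell. u p) = (\<integral>p. u p * indicator A p \<partial>cell)" for A
    unfolding set_lebesgue_integral_def
    by (intro Bochner_Integration.integral_cong) (auto simp: indicator_def)
  have all: "?P UNIV"
    using f[of "(0, 0)"] unfolding eq by (simp add: fourier_eq_wave)
  have "?P A" if "A \<in> sigma_sets UNIV (range (\<lambda>(a, b). box a b :: (real \<times> real) set))" for A
  proof (rule sigma_sets_induct_disjoint[OF _ _ that])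
    show "Int_stable (range (\<lambda>(a, b). box a b :: (real \<times> real) set))"
      by (auto simp: Int_stable_def box_Int_box)
    show "?P A" if rA: "A \<in> range (\<lambda>(a, b). box a b)" for A
    proof -
      obtain ab :: "(real \<times> real) \<times> (real \<times> real)" where A': "A = box (fst ab) (snd ab)"
        using rA unfolding case_prod_unfold by (rule rangeE)
      define a b where "a = fst ab" and "b = snd ab"
      have A: "A = box a b" using A' by (simp add: a_def b_def)
      have "null_multiplier u (\<lambda>p. 1 * indicator {fst a<..<fst b} (fst p) * indicator {snd a<..<snd b} (snd p))"
        by (intro null_multiplier_interval u null_multiplier_1 f)
      moreover have "indicator A p = (1 * indicator {fst a<..<fst b} (fst p) * indicator {snd a<..<snd b} (snd p) :: real)" for p
        unfolding A by (auto simp: indicator_def mem_box Basis_prod_def inner_prod_def)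
      ultimately have "fourier (\<lambda>p. u p * indicator A p) (0, 0) = 0"
        unfolding null_multiplier_def by presburger
      then show ?thesis unfolding eq fourier_eq_wave by (simp del: of_real_mult)
    qed
  next
    fix A assume A: "A \<in> sigma_sets UNIV (range (\<lambda>(a, b). box a b :: (real \<times> real) set))" "?P A"
    have "A \<in> sets borel" using A(1) by (simp add: borel_eq_box)
    have "(LINT p:(UNIV - A) \<inter> space cell|cell. u p) + (LINT p:A \<inter> space cell|cell. u p) =
        (LINT p:UNIV \<inter> space cell|cell. u p)"
      using \<open>A \<in> sets borel\<close>
      by (subst set_integral_Un[symmetric]) (auto intro!: si sets arg_cong[where f="\<lambda>A. set_lebesgue_integral cell A u"])
    then show "?P (UNIV - A)" using all A(2) by simp
  next
    fix A :: "nat \<Rightarrow> _" assume A: "disjoint_family A" "range A \<subseteq> sigma_sets UNIV (range (\<lambda>(a, b). box a b :: (real \<times> real) set))"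
      "\<And>i. ?P (A i)"
    have s: "A i \<in> sets borel" for i using A(2) by (auto simp: borel_eq_box)
    have "(LINT p:(\<Union>i. A i \<inter> space cell)|cell. u p) = (\<Sum>i. (LINT p:A i \<inter> space cell|cell. u p))"
      using A(1) s
      by (intro lebesgue_integral_countable_add) (auto simp: disjoint_family_on_def intro!: si sets)
    moreover have "(\<Union>i. A i) \<inter> space cell = (\<Union>i. A i \<inter> space cell)" by auto
    ultimately show "?P (\<Union>i. A i)" by (simp only: A(3) suminf_zero)
  qed (auto simp: set_lebesgue_integral_def)
  then have P: "?P A" if "A \<in> sets borel" for A using that by (simp add: borel_eq_box)
  show ?thesis
  proof (rule density_unique_real[OF u])
    fix A assume "A \<in> sets cell"
    then obtain A' where "A' \<in> sets borel" "A = A' \<inter> space cell"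
      unfolding sets_restrict_space space_cell by auto
    then show "(LINT p:A|cell. u p) = (LINT p:A|cell. 0)" using P by simp
  qed simp
qed

section \<open>The theorems of Riesz--Fischer and Parseval\<close>

definition L2_cell :: "(real \<times> real \<Rightarrow> real) \<Rightarrow> bool" where
  "L2_cell u \<longleftrightarrow> u \<in> borel_measurable cell \<and> integrable cell (\<lambda>p. (u p)\<^sup>2)"

lemma L2_cell_measurable: "L2_cell u \<Longrightarrow> u \<in> borel_measurable cell"
  and L2_cell_square: "L2_cell u \<Longrightarrow> integrable cell (\<lambda>p. (u p)\<^sup>2)"
  by (simp_all add: L2_cell_def)

lemma L2_cell_mult_integrable:
  assumes "L2_cell u" "L2_cell v" shows "integrable cell (\<lambda>p. u p * v p)"
proof (rule Bochner_Integration.integrable_bound[where f="\<lambda>p. (u p)\<^sup>2 + (v p)\<^sup>2"])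
  show "integrable cell (\<lambda>p. (u p)\<^sup>2 + (v p)\<^sup>2)"
    using assms by (intro Bochner_Integration.integrable_add L2_cell_square)
  show "(\<lambda>p. u p * v p) \<in> borel_measurable cell"
    using assms[THEN L2_cell_measurable] by simp
  have "norm (a * b) \<le> norm (a\<^sup>2 + b\<^sup>2)" for a b :: real
  proof -
    have "2 * (\<bar>a\<bar> * \<bar>b\<bar>) \<le> a\<^sup>2 + b\<^sup>2" using sum_squares_bound[of "\<bar>a\<bar>" "\<bar>b\<bar>"] by simp
    moreover have "0 \<le> \<bar>a\<bar> * \<bar>b\<bar>" by simp
    ultimately have "\<bar>a\<bar> * \<bar>b\<bar> \<le> a\<^sup>2 + b\<^sup>2" by linarith
    then show ?thesis by (simp add: abs_mult)
  qed
  then show "AE p in cell. norm (u p * v p) \<le> norm ((u p)\<^sup>2 + (v p)\<^sup>2)" by simp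
qed

lemma L2_cell_const: "L2_cell (\<lambda>_. c)"
  by (simp add: L2_cell_def)

lemma L2_cell_integrable:
  assumes "L2_cell u" shows "integrable cell u"
  using L2_cell_mult_integrable[OF assms L2_cell_const[of 1]] by simp

lemma L2_cell_add:
  assumes "L2_cell u" "L2_cell v" shows "L2_cell (\<lambda>p. u p + v p)"
proof -
  have "integrable cell (\<lambda>p. (u p)\<^sup>2 + (v p)\<^sup>2 + 2 * (u p * v p))"
    using assms by (intro Bochner_Integration.integrable_add integrable_mult_right L2_cell_square L2_cell_mult_integrable)
  moreover have "(\<lambda>p. (u p)\<^sup>2 + (v p)\<^sup>2 + 2 * (u p * v p)) = (\<lambda>p. (u p + v p)\<^sup>2)"
    by (simp add: power2_sum algebra_simps)
  ultimately show ?thesis using assms by (auto simp: L2_cell_def)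
qed

lemma L2_cell_scale: "L2_cell u \<Longrightarrow> L2_cell (\<lambda>p. c * u p)"
  by (auto simp: L2_cell_def power_mult_distrib)

lemma L2_cell_diff:
  assumes "L2_cell u" "L2_cell v" shows "L2_cell (\<lambda>p. u p - v p)"
  using L2_cell_add[OF assms(1) L2_cell_scale[OF assms(2), of "-1"]] by simp

text \<open>The cell has measure one, so the difference of the squares of the two sides is the variance of \<open>|u|\<close>.\<close>

lemma integral_abs_le_sqrt:
  assumes "L2_cell u" shows "(\<integral>p. \<bar>u p\<bar> \<partial>cell) \<le> sqrt (\<integral>p. (u p)\<^sup>2 \<partial>cell)"
proof (rule real_le_rsqrt)
  let ?m = "\<integral>p. \<bar>u p\<bar> \<partial>cell"
  have "(\<integral>p. (\<bar>u p\<bar> - ?m)\<^sup>2 \<partial>cell) = (\<integral>p. (u p)\<^sup>2 + (?m\<^sup>2 - 2 * ?m * \<bar>u p\<bar>) \<partial>cell)"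
    by (intro Bochner_Integration.integral_cong) (auto simp: power2_diff algebra_simps)
  also have "\<dots> = (\<integral>p. (u p)\<^sup>2 \<partial>cell) + (?m\<^sup>2 - 2 * ?m * ?m)"
    using L2_cell_square[OF assms] L2_cell_integrable[OF assms] by simp
  finally have "(\<integral>p. (u p)\<^sup>2 \<partial>cell) - ?m\<^sup>2 = (\<integral>p. (\<bar>u p\<bar> - ?m)\<^sup>2 \<partial>cell)"
    by (simp add: power2_eq_square)
  moreover have "0 \<le> (\<integral>p. (\<bar>u p\<bar> - ?m)\<^sup>2 \<partial>cell)" by simp
  ultimately show "?m\<^sup>2 \<le> (\<integral>p. (u p)\<^sup>2 \<partial>cell)" by linarith
qed

lemma norm_fourier_le:
  assumes "L2_cell u" shows "norm (fourier u k) \<le> sqrt (\<integral>p. (u p)\<^sup>2 \<partial>cell)"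
proof -
  have "norm (fourier u k) \<le> (\<integral>p. norm (of_real (u p) * cnj (wave k p)) \<partial>cell)"
    unfolding fourier_eq_wave by (rule integral_norm_bound)
  also have "\<dots> = (\<integral>p. \<bar>u p\<bar> \<partial>cell)" by (simp add: norm_mult)
  finally show ?thesis using integral_abs_le_sqrt[OF assms] by simp
qed

lemma integral_trig_poly_square:
  assumes "finite F"
  shows "(\<integral>p. (cmod (\<Sum>k\<in>F. c k * wave k p))\<^sup>2 \<partial>cell) = (\<Sum>k\<in>F. (cmod (c k))\<^sup>2)"
proof -
  have i: "integrable cell (\<lambda>p. c k * wave k p * cnj (c j * wave j p))" for j k
    by (intro integrable_cell_continuous continuous_intros)
  have orth: "(\<integral>p. c k * wave k p * cnj (c j * wave j p) \<partial>cell) = (if k = j then c k * cnj (c k) else 0)" for j k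
  proof -
    have "(\<integral>p. c k * wave k p * cnj (c j * wave j p) \<partial>cell)
        = (\<integral>p. (c k * cnj (c j)) * (wave k p * cnj (wave j p)) \<partial>cell)"
      by (intro Bochner_Integration.integral_cong) (auto simp: mult_ac)
    then show ?thesis by (simp add: wave_orthonormal)
  qed
  have "complex_of_real (\<integral>p. (cmod (\<Sum>k\<in>F. c k * wave k p))\<^sup>2 \<partial>cell)
      = (\<integral>p. (\<Sum>k\<in>F. c k * wave k p) * cnj (\<Sum>k\<in>F. c k * wave k p) \<partial>cell)"
    unfolding complex_norm_square[symmetric] by (simp flip: of_real_power)
  also have "\<dots> = (\<integral>p. (\<Sum>k\<in>F. \<Sum>j\<in>F. c k * wave k p * cnj (c j * wave j p)) \<partial>cell)"
    by (simp only: cnj_sum sum_product)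
  also have "\<dots> = (\<Sum>k\<in>F. \<Sum>j\<in>F. \<integral>p. c k * wave k p * cnj (c j * wave j p) \<partial>cell)"
    by (subst Bochner_Integration.integral_sum, intro Bochner_Integration.integrable_sum i)
       (intro sum.cong refl Bochner_Integration.integral_sum i)
  also have "\<dots> = (\<Sum>k\<in>F. \<Sum>j\<in>F. if k = j then c k * cnj (c k) else 0)"
    unfolding orth ..
  also have "(\<Sum>k\<in>F. \<Sum>j\<in>F. if k = j then c k * cnj (c k) else 0) = (\<Sum>k\<in>F. c k * cnj (c k))"
  proof (rule sum.cong[OF refl])
    fix k assume "k \<in> F"
    then show "(\<Sum>j\<in>F. if k = j then c k * cnj (c k) else 0) = c k * cnj (c k)"
      by (simp only: sum.delta'[OF assms] if_True)
  qed
  also have "\<dots> = of_real (\<Sum>k\<in>F. (cmod (c k))\<^sup>2)"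
    unfolding of_real_sum by (intro sum.cong refl) (simp only: complex_norm_square)
  finally show ?thesis by (simp only: of_real_eq_iff)
qed

lemma Bessel:
  assumes u: "L2_cell u" and F: "finite F"
  shows "(\<Sum>k\<in>F. (cmod (fourier u k))\<^sup>2) \<le> (\<integral>p. (u p)\<^sup>2 \<partial>cell)"
proof -
  define S where "S p = (\<Sum>k\<in>F. fourier u k * wave k p)" for p
  have cS: "continuous_on UNIV S" unfolding S_def by (intro continuous_intros)
  have iS: "integrable cell (\<lambda>p. (cmod (S p))\<^sup>2)"
    by (intro integrable_cell_continuous continuous_intros cS)
  have ik: "integrable cell (\<lambda>p. of_real (u p) * cnj (fourier u k * wave k p))" for k
    using integrable_mult_right[OF integrable_fourier_integrand[OF L2_cell_integrable[OF u], of k], of "cnj (fourier u k)"]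
    by (simp add: mult.left_commute)
  have iuS: "integrable cell (\<lambda>p. of_real (u p) * cnj (S p))"
    unfolding S_def cnj_sum sum_distrib_left by (intro Bochner_Integration.integrable_sum ik)
  have "(\<integral>p. of_real (u p) * cnj (S p) \<partial>cell) = (\<Sum>k\<in>F. \<integral>p. of_real (u p) * cnj (fourier u k * wave k p) \<partial>cell)"
    unfolding S_def cnj_sum sum_distrib_left by (intro Bochner_Integration.integral_sum ik)
  also have "\<dots> = (\<Sum>k\<in>F. cnj (fourier u k) * fourier u k)"
  proof (intro sum.cong refl)
    fix k
    have "(\<integral>p. of_real (u p) * cnj (fourier u k * wave k p) \<partial>cell)
        = (\<integral>p. cnj (fourier u k) * (of_real (u p) * cnj (wave k p)) \<partial>cell)"
      by (intro Bochner_Integration.integral_cong) (auto simp: mult_ac)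
    also have "\<dots> = cnj (fourier u k) * fourier u k"
      by (simp only: integral_mult_right_zero fourier_eq_wave[of u k])
    finally show "(\<integral>p. of_real (u p) * cnj (fourier u k * wave k p) \<partial>cell) = cnj (fourier u k) * fourier u k" .
  qed
  also have "\<dots> = of_real (\<Sum>k\<in>F. (cmod (fourier u k))\<^sup>2)"
    unfolding of_real_sum by (intro sum.cong refl) (simp only: complex_norm_square mult.commute)
  finally have Re_uS: "(\<integral>p. Re (of_real (u p) * cnj (S p)) \<partial>cell) = (\<Sum>k\<in>F. (cmod (fourier u k))\<^sup>2)"
    using integral_Re[OF iuS] by simp
  have eq: "(cmod (of_real (u p) - S p))\<^sup>2 = (u p)\<^sup>2 - 2 * Re (of_real (u p) * cnj (S p)) + (cmod (S p))\<^sup>2" for p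
    unfolding cmod_power2 by (simp add: power2_eq_square algebra_simps)
  have "0 \<le> (\<integral>p. (cmod (of_real (u p) - S p))\<^sup>2 \<partial>cell)" by simp
  also have "\<dots> = (\<integral>p. (u p)\<^sup>2 \<partial>cell) - 2 * (\<Sum>k\<in>F. (cmod (fourier u k))\<^sup>2) + (\<integral>p. (cmod (S p))\<^sup>2 \<partial>cell)"
    unfolding eq using L2_cell_square[OF u] iS integrable_Re[OF iuS] Re_uS by (simp del: Re_complex_of_real times_complex.sel)
  also have "(\<integral>p. (cmod (S p))\<^sup>2 \<partial>cell) = (\<Sum>k\<in>F. (cmod (fourier u k))\<^sup>2)"
    unfolding S_def by (rule integral_trig_poly_square[OF F])
  finally show ?thesis by simp
qed

definition freq_box :: "nat \<Rightarrow> (int \<times> int) set" where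
  "freq_box n = {- int n..int n} \<times> {- int n..int n}"

lemma finite_freq_box [simp]: "finite (freq_box n)"
  by (simp add: freq_box_def)

lemma freq_box_mono: "m \<le> n \<Longrightarrow> freq_box m \<subseteq> freq_box n"
  by (auto simp: freq_box_def)

lemma mem_freq_box: "nat (max \<bar>fst k\<bar> \<bar>snd k\<bar>) \<le> n \<Longrightarrow> k \<in> freq_box n"
  by (cases k) (auto simp: freq_box_def)

lemma uminus_mem_freq_box: "- k \<in> freq_box n \<longleftrightarrow> k \<in> freq_box n"
  by (cases k) (auto simp: freq_box_def)

text \<open>Along a subsequence on which the increments are summable in \<open>L\<^sup>2\<close>, hence in \<open>L\<^sup>1\<close>, the
  partial sums converge almost everywhere with an integrable majorant; dominated convergence
  identifies the coefficients of the limit, and Fatou's lemma bounds its square.\<close>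

lemma Riesz_Fischer:
  fixes c :: "int \<times> int \<Rightarrow> complex"
  assumes sym: "\<And>k. c (- k) = cnj (c k)"
    and bd: "\<And>F. finite F \<Longrightarrow> (\<Sum>k\<in>F. (cmod (c k))\<^sup>2) \<le> B"
  obtains u where "periodic u" "u \<in> borel_measurable borel" "L2_cell u" "\<And>k. fourier u k = c k"
    "(\<integral>p. (u p)\<^sup>2 \<partial>cell) \<le> B"
proof -
  have B0: "0 \<le> B" using bd[of "{}"] by simp
  define S where "S n p = Re (\<Sum>k\<in>freq_box n. c k * wave k p)" for n p
  define a where "a n = (\<Sum>k\<in>freq_box n. (cmod (c k))\<^sup>2)" for n
  have S_complex: "of_real (S n p) = (\<Sum>k\<in>freq_box n. c k * wave k p)" for n p
  proof -
    have "cnj (\<Sum>k\<in>freq_box n. c k * wave k p) = (\<Sum>k\<in>freq_box n. c (- k) * wave (- k) p)"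
      by (simp add: sym cnj_wave)
    also have "\<dots> = (\<Sum>k\<in>freq_box n. c k * wave k p)"
      by (rule sum.reindex_bij_witness[of _ uminus uminus]) (auto simp: uminus_mem_freq_box)
    finally show ?thesis unfolding S_def
      by (metis Reals_cnj_iff of_real_Re)
  qed
  have cS: "continuous_on UNIV (S n)" for n unfolding S_def by (intro continuous_intros)
  have mS: "S n \<in> borel_measurable borel" for n by (intro borel_measurable_continuous_onI cS)
  have L2S: "L2_cell (S n)" for n
    unfolding L2_cell_def by (intro conjI measurable_cell mS integrable_cell_continuous continuous_intros cS)
  have perS: "S n (x + 1, z) = S n (x, z)" "S n (x, z + 1) = S n (x, z)" for n x z
    by (simp_all add: S_def wave_periodic)
  have S_fourier: "fourier (S n) k = c k" if "k \<in> freq_box n" for n k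
  proof -
    have "fourier (S n) k = (\<integral>p. (\<Sum>j\<in>freq_box n. c j * (wave j p * cnj (wave k p))) \<partial>cell)"
      unfolding fourier_eq_wave S_complex by (simp add: sum_distrib_right mult.assoc)
    also have "\<dots> = (\<Sum>j\<in>freq_box n. \<integral>p. c j * (wave j p * cnj (wave k p)) \<partial>cell)"
      by (intro Bochner_Integration.integral_sum integrable_cell_continuous continuous_intros)
    also have "\<dots> = (\<Sum>j\<in>freq_box n. if j = k then c j else 0)"
      by (intro sum.cong refl) (simp add: wave_orthonormal)
    finally show ?thesis using that by simp
  qed
  have norm_S: "(\<integral>p. (S n p)\<^sup>2 \<partial>cell) = a n" for n
  proof -
    have "(S n p)\<^sup>2 = (cmod (\<Sum>k\<in>freq_box n. c k * wave k p))\<^sup>2" for p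
      unfolding S_complex[symmetric] by simp
    then show ?thesis unfolding a_def using integral_trig_poly_square[of "freq_box n" c] by simp
  qed
  have norm_diff: "(\<integral>p. (S m p - S n p)\<^sup>2 \<partial>cell) = a m - a n" if "n \<le> m" for m n
  proof -
    have sub: "freq_box n \<subseteq> freq_box m" by (rule freq_box_mono[OF that])
    have "(S m p - S n p)\<^sup>2 = (cmod (\<Sum>k\<in>freq_box m - freq_box n. c k * wave k p))\<^sup>2" for p
    proof -
      have "of_real (S m p - S n p) = (\<Sum>k\<in>freq_box m - freq_box n. c k * wave k p)"
        unfolding of_real_diff S_complex by (simp add: sum_diff[OF finite_freq_box sub])
      then show ?thesis by (metis norm_of_real power2_abs)
    qed
    then show ?thesis unfolding a_def
      using integral_trig_poly_square[of "freq_box m - freq_box n" c] by (simp add: sum_diff[OF finite_freq_box sub])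
  qed
  have "incseq a" unfolding a_def by (intro monoI sum_mono2 freq_box_mono) auto
  then obtain L where aL: "a \<longlonglongrightarrow> L"
    using bd by (auto intro: incseq_convergent[of a B] simp: a_def)
  have "\<exists>N. \<forall>m\<ge>N. a m - a N \<le> (1/4) ^ n" for n
  proof -
    have "Cauchy a" using aL by (rule LIMSEQ_imp_Cauchy)
    then obtain N where N: "\<And>m n'. m \<ge> N \<Longrightarrow> n' \<ge> N \<Longrightarrow> norm (a m - a n') < (1/4) ^ n"
      unfolding Cauchy_iff by (meson zero_less_power zero_less_divide_1_iff zero_less_numeral)
    have "a m - a N \<le> (1/4) ^ n" if "m \<ge> N" for m
      using N[OF that order.refl] unfolding real_norm_def by linarith
    then show ?thesis by blast
  qed
  then obtain N where N: "\<And>n m. m \<ge> N n \<Longrightarrow> a m - a (N n) \<le> (1/4) ^ n" by metis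
  \<comment> \<open>A strictly increasing sequence above \<open>N\<close>. Beyond \<open>N n\<close> the square sums of the coefficients change by
     at most \<open>4\<^sup>-\<^sup>n\<close>, so the increments along \<open>r\<close> are at most \<open>2\<^sup>-\<^sup>n\<close> in \<open>L\<^sup>2\<close>.\<close>
  define r where "r n = (\<Sum>i\<le>n. Suc (N i))" for n
  have r: "r n \<ge> N n" "r n \<le> r (Suc n)" "n \<le> r n" for n
  proof -
    show "r n \<ge> N n" unfolding r_def by (rule order_trans[OF _ member_le_sum[of n]]) auto
    show "r n \<le> r (Suc n)" by (simp add: r_def)
    show "n \<le> r n" by (induction n) (auto simp: r_def)
  qed
  define g where "g n = S (r n)" for n
  define D where "D n p = \<bar>g (Suc n) p - g n p\<bar>" for n p
  have mg [measurable]: "g n \<in> borel_measurable cell" "g n \<in> borel_measurable borel" for n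
    unfolding g_def by (intro measurable_cell mS)+
  have L2g: "L2_cell (g n)" for n unfolding g_def by (rule L2S)
  have mD [measurable]: "D n \<in> borel_measurable cell" for n unfolding D_def by simp
  have iD: "integrable cell (D n)" for n
    unfolding D_def by (intro integrable_abs L2_cell_integrable L2_cell_diff L2g)
  have D_le: "(\<integral>p. D n p \<partial>cell) \<le> (1/2) ^ n" for n
  proof -
    have "(\<integral>p. D n p \<partial>cell) \<le> sqrt (\<integral>p. (g (Suc n) p - g n p)\<^sup>2 \<partial>cell)"
      unfolding D_def by (intro integral_abs_le_sqrt L2_cell_diff L2g)
    also have "\<dots> = sqrt (a (r (Suc n)) - a (r n))"
      unfolding g_def using norm_diff[OF r(2)] by simp
    also have "\<dots> \<le> sqrt ((1/4) ^ n)"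
    proof -
      have "a (N n) \<le> a (r n)" using \<open>incseq a\<close> r(1) by (simp add: incseq_def)
      then show ?thesis using N[of n "r (Suc n)"] r(1)[of n] r(2)[of n] by simp
    qed
    also have "\<dots> = (1/2) ^ n"
      by (simp add: real_sqrt_power real_sqrt_divide)
    finally show ?thesis .
  qed
  have "AE p in cell. (\<Sum>n. ennreal (D n p)) \<noteq> \<infinity>"
  proof (rule nn_integral_noteq_infinite)
    have "(\<integral>\<^sup>+p. (\<Sum>n. ennreal (D n p)) \<partial>cell) = (\<Sum>n. \<integral>\<^sup>+p. ennreal (D n p) \<partial>cell)"
      by (rule nn_integral_suminf) simp
    also have "\<dots> \<le> (\<Sum>n. ennreal ((1/2) ^ n))"
    proof (intro suminf_le summableI)
      fix n
      have "(\<integral>\<^sup>+p. ennreal (D n p) \<partial>cell) = ennreal (\<integral>p. D n p \<partial>cell)"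
        by (rule nn_integral_eq_integral[OF iD]) (simp add: D_def)
      then show "(\<integral>\<^sup>+p. ennreal (D n p) \<partial>cell) \<le> ennreal ((1/2) ^ n)" using D_le by (simp add: ennreal_leI)
    qed
    also have "\<dots> = ennreal (\<Sum>n. (1/2) ^ n)"
      by (intro suminf_ennreal2) auto
    also have "\<dots> < \<infinity>" by simp
    finally show "(\<integral>\<^sup>+p. (\<Sum>n. ennreal (D n p)) \<partial>cell) \<noteq> \<infinity>" by simp
  qed simp
  then have sumD: "AE p in cell. summable (\<lambda>n. D n p)"
    by eventually_elim (auto intro!: summable_suminf_not_top simp: D_def)
  define w where "w p = \<bar>g 0 p\<bar> + (\<Sum>n. D n p)" for p
  have "integrable cell (\<lambda>p. \<Sum>n. D n p)"
  proof (rule integrable_suminf[OF iD])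
    show "AE p in cell. summable (\<lambda>n. norm (D n p))" using sumD by (simp add: D_def)
    show "summable (\<lambda>n. \<integral>p. norm (D n p) \<partial>cell)"
    proof (rule summable_comparison_test')
      show "summable (\<lambda>n. (1/2 :: real) ^ n)" by simp
      show "norm (\<integral>p. norm (D n p) \<partial>cell) \<le> (1/2) ^ n" for n
        using D_le[of n] by (simp add: D_def)
    qed
  qed
  then have iw: "integrable cell w"
    unfolding w_def by (rule Bochner_Integration.integrable_add[OF integrable_abs[OF L2_cell_integrable[OF L2g]]])
  define u where "u p = lim (\<lambda>n. g n p)" for p
  have conv: "AE p in cell. (\<lambda>n. g n p) \<longlonglongrightarrow> u p \<and> (\<forall>n. \<bar>g n p\<bar> \<le> w p)"
    using sumD
  proof eventually_elim
    case (elim p)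
    have tel: "(\<Sum>i<n. g (Suc i) p - g i p) = g n p - g 0 p" for n
      by (rule sum_lessThan_telescope)
    have "summable (\<lambda>i. g (Suc i) p - g i p)"
      by (rule summable_rabs_cancel) (rule elim[unfolded D_def])
    then obtain s where "(\<lambda>n. \<Sum>i<n. g (Suc i) p - g i p) \<longlonglongrightarrow> s"
      unfolding summable_def sums_def by (rule exE)
    then have "(\<lambda>n. g n p - g 0 p + g 0 p) \<longlonglongrightarrow> s + g 0 p"
      unfolding tel by (intro tendsto_intros)
    then have "convergent (\<lambda>n. g n p)" by (auto simp: convergent_def)
    then have 1: "(\<lambda>n. g n p) \<longlonglongrightarrow> u p" unfolding u_def by (simp add: convergent_LIMSEQ_iff)
    have "\<bar>g n p\<bar> \<le> w p" for n
    proof -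
      have "\<bar>g n p - g 0 p\<bar> \<le> (\<Sum>i<n. D i p)"
        using sum_abs[of "\<lambda>i. g (Suc i) p - g i p" "{..<n}"] unfolding tel D_def .
      also have "\<dots> \<le> (\<Sum>i. D i p)"
        using elim by (intro sum_le_suminf) (auto simp: D_def)
      finally show ?thesis unfolding w_def by linarith
    qed
    with 1 show ?case by simp
  qed
  have mu: "u \<in> borel_measurable borel" unfolding u_def by (intro borel_measurable_lim_metric mg)
  then have muc [measurable]: "u \<in> borel_measurable cell" by (rule measurable_cell)
  have fou: "fourier u k = c k" for k
  proof -
    have "(\<lambda>n. fourier (g n) k) \<longlonglongrightarrow> fourier u k"
      unfolding fourier_eq_wave
    proof (rule integral_dominated_convergence[OF _ _ iw])
      show "AE p in cell. (\<lambda>n. of_real (g n p) * cnj (wave k p)) \<longlonglongrightarrow> of_real (u p) * cnj (wave k p)"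
        using conv by eventually_elim (intro tendsto_intros, simp)
      show "AE p in cell. norm (of_real (g n p) * cnj (wave k p)) \<le> w p" for n
        using conv by eventually_elim (simp add: norm_mult)
    qed measurable
    moreover have "(\<lambda>n. fourier (g n) k) \<longlonglongrightarrow> c k"
    proof (rule tendsto_eventually, unfold eventually_sequentially, intro exI allI impI)
      fix n assume "nat (max \<bar>fst k\<bar> \<bar>snd k\<bar>) \<le> n"
      then have "k \<in> freq_box (r n)" using r(3)[of n] by (intro mem_freq_box) linarith
      then show "fourier (g n) k = c k" unfolding g_def by (rule S_fourier)
    qed
    ultimately show ?thesis by (rule LIMSEQ_unique)
  qed
  have "(\<integral>\<^sup>+p. ennreal ((u p)\<^sup>2) \<partial>cell) \<le> (\<integral>\<^sup>+p. liminf (\<lambda>n. ennreal ((g n p)\<^sup>2)) \<partial>cell)"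
  proof (rule nn_integral_mono_AE)
    show "AE p in cell. ennreal ((u p)\<^sup>2) \<le> liminf (\<lambda>n. ennreal ((g n p)\<^sup>2))"
      using conv
    proof eventually_elim
      case (elim p)
      then have "(\<lambda>n. ennreal ((g n p)\<^sup>2)) \<longlonglongrightarrow> ennreal ((u p)\<^sup>2)"
        by (intro tendsto_ennrealI tendsto_intros) simp
      from lim_imp_Liminf[OF trivial_limit_sequentially this] show ?case by simp
    qed
  qed
  also have "\<dots> \<le> liminf (\<lambda>n. \<integral>\<^sup>+p. ennreal ((g n p)\<^sup>2) \<partial>cell)"
    by (rule nn_integral_liminf) simp
  also have "\<dots> \<le> liminf (\<lambda>n. ennreal B)"
  proof (rule Liminf_mono, rule always_eventually, rule allI)
    fix n
    have "(\<integral>\<^sup>+p. ennreal ((g n p)\<^sup>2) \<partial>cell) = ennreal (\<integral>p. (g n p)\<^sup>2 \<partial>cell)"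
      by (rule nn_integral_eq_integral[OF L2_cell_square[OF L2g]]) simp
    also have "(\<integral>p. (g n p)\<^sup>2 \<partial>cell) \<le> B"
      unfolding g_def norm_S a_def by (rule bd) simp
    finally show "(\<integral>\<^sup>+p. ennreal ((g n p)\<^sup>2) \<partial>cell) \<le> ennreal B" by (simp add: ennreal_leI)
  qed
  also have "\<dots> = ennreal B" by (simp add: Liminf_const)
  finally have nn: "(\<integral>\<^sup>+p. ennreal ((u p)\<^sup>2) \<partial>cell) \<le> ennreal B" .
  have isq: "integrable cell (\<lambda>p. (u p)\<^sup>2)"
  proof (rule integrableI_nonneg)
    show "(\<integral>\<^sup>+p. ennreal ((u p)\<^sup>2) \<partial>cell) < \<infinity>" using nn by (simp add: le_less_trans)
  qed auto
  show thesis
  proof (rule that[OF _ mu _ fou])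
    show "periodic u" unfolding periodic_def u_def g_def by (simp add: perS)
    show "L2_cell u" using isq by (simp add: L2_cell_def)
    have "ennreal (\<integral>p. (u p)\<^sup>2 \<partial>cell) \<le> ennreal B"
      using nn nn_integral_eq_integral[OF isq] by simp
    then show "(\<integral>p. (u p)\<^sup>2 \<partial>cell) \<le> B" using B0 by (simp add: ennreal_le_iff)
  qed
qed

lemma fourier_uminus: "fourier u (- k) = cnj (fourier u k)"
  unfolding fourier_eq_wave
  by (rule trans[OF Bochner_Integration.integral_cong[OF refl] Bochner_Integration.integral_cnj]) (simp add: cnj_wave)

text \<open>One inequality is Bessel's. For the other one, the Riesz--Fischer theorem gives a function with the same
  coefficients whose square integral is at most their square sum; since the coefficients determine the
  function, it equals \<open>u\<close> almost everywhere.\<close>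

theorem Parseval:
  assumes u: "L2_cell u"
  shows "((\<lambda>k. (cmod (fourier u k))\<^sup>2) has_sum (\<integral>p. (u p)\<^sup>2 \<partial>cell)) UNIV"
proof -
  let ?I = "\<integral>p. (u p)\<^sup>2 \<partial>cell"
  have "(\<lambda>k. (cmod (fourier u k))\<^sup>2) summable_on UNIV"
    using Bessel[OF u] by (intro nonneg_bdd_above_summable_on) (auto simp: bdd_above_def)
  then obtain s where s: "((\<lambda>k. (cmod (fourier u k))\<^sup>2) has_sum s) UNIV"
    by (auto simp: summable_on_def)
  have "s \<le> ?I" using s Bessel[OF u] by (intro has_sum_le_finite_sums[OF s]) auto
  moreover have "?I \<le> s"
  proof -
    have "(\<Sum>k\<in>F. (cmod (fourier u k))\<^sup>2) \<le> s" if "finite F" for F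
      using finite_sum_le_has_sum[OF s that] by auto
    then obtain v where v: "L2_cell v" "\<And>k. fourier v k = fourier u k" "(\<integral>p. (v p)\<^sup>2 \<partial>cell) \<le> s"
      using Riesz_Fischer[of "fourier u" s] fourier_uminus by metis
    have "AE p in cell. u p - v p = 0"
      using v u by (intro fourier_eq_0_imp_AE_eq_0) (auto simp: fourier_diff L2_cell_integrable)
    then have "?I = (\<integral>p. (v p)\<^sup>2 \<partial>cell)"
      using u v(1) by (intro integral_cong_AE) (auto simp: L2_cell_def)
    then show ?thesis using v by simp
  qed
  ultimately show ?thesis using s by simp
qed

text \<open>Polarization of Parseval's identity.\<close>

corollary Parseval_inner:
  assumes u: "L2_cell u" and v: "L2_cell v"
  shows "((\<lambda>k. Re (fourier u k * cnj (fourier v k))) has_sum (\<integral>p. u p * v p \<partial>cell)) UNIV"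
proof -
  note sq = L2_cell_square[OF u] L2_cell_square[OF v] L2_cell_mult_integrable[OF u v]
  have 1: "((\<lambda>k. (cmod (fourier u k + fourier v k))\<^sup>2) has_sum (\<integral>p. (u p + v p)\<^sup>2 \<partial>cell)) UNIV"
    using Parseval[OF L2_cell_add[OF u v]] u v by (simp add: fourier_add L2_cell_integrable)
  have 2: "((\<lambda>k. (cmod (fourier u k - fourier v k))\<^sup>2) has_sum (\<integral>p. (u p - v p)\<^sup>2 \<partial>cell)) UNIV"
    using Parseval[OF L2_cell_diff[OF u v]] u v by (simp add: fourier_diff L2_cell_integrable)
  have 3: "((\<lambda>k. (1/4) * ((cmod (fourier u k + fourier v k))\<^sup>2 - (cmod (fourier u k - fourier v k))\<^sup>2)) has_sum
      (1/4) * ((\<integral>p. (u p + v p)\<^sup>2 \<partial>cell) - (\<integral>p. (u p - v p)\<^sup>2 \<partial>cell))) UNIV"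
    using has_sum_cmult_right[OF has_sum_add[OF 1 has_sum_uminusI[OF 2]], of "1/4"] by simp
  have "(\<integral>p. (u p + v p)\<^sup>2 \<partial>cell) - (\<integral>p. (u p - v p)\<^sup>2 \<partial>cell) = (\<integral>p. 4 * (u p * v p) \<partial>cell)"
    using L2_cell_square[OF L2_cell_add[OF u v]] L2_cell_square[OF L2_cell_diff[OF u v]]
    by (subst Bochner_Integration.integral_diff[symmetric])
       (auto simp: power2_eq_square algebra_simps intro!: Bochner_Integration.integral_cong)
  then have I: "(1/4) * ((\<integral>p. (u p + v p)\<^sup>2 \<partial>cell) - (\<integral>p. (u p - v p)\<^sup>2 \<partial>cell)) = (\<integral>p. u p * v p \<partial>cell)"
    by simp
  have C: "(1/4) * ((cmod (a + b))\<^sup>2 - (cmod (a - b))\<^sup>2) = Re (a * cnj b)" for a b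
    by (simp add: cmod_power2) (simp add: power2_eq_square algebra_simps)
  show ?thesis using 3 unfolding I C .
qed

text \<open>The coefficients of an indicator function are at most the measure of the set, so the mean of
  \<open>b\<close> over any set is at most \<open>\<beta>\<close> in modulus.\<close>

lemma AE_abs_le_sum_fourier:
  assumes b: "L2_cell b" and bd: "\<And>F. finite F \<Longrightarrow> (\<Sum>k\<in>F. cmod (fourier b k)) \<le> \<beta>"
  shows "AE p in cell. \<bar>b p\<bar> \<le> \<beta>"
proof -
  have main: "AE p in cell. g p \<le> \<beta>"
    if g: "L2_cell g" and gb: "\<And>F. finite F \<Longrightarrow> (\<Sum>k\<in>F. cmod (fourier g k)) \<le> \<beta>" for g
  proof -
    have [measurable]: "g \<in> borel_measurable cell" by (rule L2_cell_measurable[OF g])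
    define A where "A = {p \<in> space cell. \<beta> < g p}"
    have [measurable]: "A \<in> sets cell" unfolding A_def by measurable
    define \<mu> where "\<mu> = measure cell A"
    have iA: "integrable cell (indicator A :: _ \<Rightarrow> real)" by (simp add: cell.emeasure_eq_measure)
    have L2A: "L2_cell (indicator A)"
    proof -
      have "(\<lambda>p. (indicator A p)\<^sup>2) = (indicator A :: _ \<Rightarrow> real)" by (auto simp: indicator_def fun_eq_iff)
      then show ?thesis using iA by (simp add: L2_cell_def)
    qed
    have fA: "cmod (fourier (indicator A) k) \<le> \<mu>" for k
    proof -
      have "cmod (fourier (indicator A) k) \<le> (\<integral>p. norm (of_real (indicator A p) * cnj (wave k p)) \<partial>cell)"
        unfolding fourier_eq_wave by (rule integral_norm_bound)
      also have "\<dots> = (\<integral>p. indicator A p \<partial>cell)" by (simp add: norm_mult)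
      also have "\<dots> = \<mu>" by (simp add: \<mu>_def A_def Int_absorb2 subset_iff)
      finally show ?thesis .
    qed
    have "(\<integral>p. g p * indicator A p \<partial>cell) \<le> \<beta> * \<mu>"
    proof (rule has_sum_le_finite_sums[OF Parseval_inner[OF g L2A]])
      fix F :: "(int \<times> int) set" assume F: "finite F"
      have "(\<Sum>k\<in>F. Re (fourier g k * cnj (fourier (indicator A) k))) \<le> (\<Sum>k\<in>F. cmod (fourier g k) * \<mu>)"
      proof (rule sum_mono)
        fix k
        have "Re (fourier g k * cnj (fourier (indicator A) k)) \<le> cmod (fourier g k) * cmod (fourier (indicator A) k)"
          by (metis complex_Re_le_cmod complex_mod_cnj norm_mult)
        also have "\<dots> \<le> cmod (fourier g k) * \<mu>" by (intro mult_left_mono fA) simp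
        finally show "Re (fourier g k * cnj (fourier (indicator A) k)) \<le> cmod (fourier g k) * \<mu>" .
      qed
      also have "\<dots> = (\<Sum>k\<in>F. cmod (fourier g k)) * \<mu>" by (simp add: sum_distrib_right)
      also have "\<dots> \<le> \<beta> * \<mu>" by (intro mult_right_mono gb F) (simp add: \<mu>_def)
      finally show "(\<Sum>k\<in>F. Re (fourier g k * cnj (fourier (indicator A) k))) \<le> \<beta> * \<mu>" .
    qed
    moreover have igA: "integrable cell (\<lambda>p. g p * indicator A p)"
      by (rule L2_cell_mult_integrable[OF g L2A])
    moreover have ib: "integrable cell (\<lambda>p. \<beta> * indicator A p)" using iA by simp
    moreover have "(\<integral>p. \<beta> * indicator A p \<partial>cell) = \<beta> * \<mu>"
      by (simp add: \<mu>_def A_def Int_absorb2 subset_iff)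
    moreover have "(\<integral>p. g p * indicator A p - \<beta> * indicator A p \<partial>cell)
        = (\<integral>p. g p * indicator A p \<partial>cell) - (\<integral>p. \<beta> * indicator A p \<partial>cell)"
      by (rule Bochner_Integration.integral_diff[OF igA ib])
    ultimately have le: "(\<integral>p. g p * indicator A p - \<beta> * indicator A p \<partial>cell) \<le> 0"
      by linarith
    have nonneg: "AE p in cell. 0 \<le> g p * indicator A p - \<beta> * indicator A p"
      by (intro AE_I2) (auto simp: A_def indicator_def)
    have "(\<integral>p. g p * indicator A p - \<beta> * indicator A p \<partial>cell) = 0"
      using le integral_nonneg_AE[OF nonneg] by simp
    then have "AE p in cell. g p * indicator A p - \<beta> * indicator A p = 0"
      using integral_nonneg_eq_0_iff_AE[OF Bochner_Integration.integrable_diff[OF igA ib] nonneg] by simp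
    with AE_space show ?thesis
      by eventually_elim (auto simp: A_def indicator_def split: if_splits)
  qed
  have "AE p in cell. b p \<le> \<beta>" by (rule main[OF b bd])
  moreover have "AE p in cell. - 1 * b p \<le> \<beta>"
  proof (rule main[OF L2_cell_scale[OF b]])
    show "(\<Sum>k\<in>F. cmod (fourier (\<lambda>p. - 1 * b p) k)) \<le> \<beta>" if "finite F" for F
      using bd[OF that] by (simp only: fourier_scale norm_mult norm_of_real) simp
  qed
  ultimately show ?thesis by eventually_elim (simp add: abs_le_iff)
qed

section \<open>Weak derivatives and the inverse Laplacian\<close>

lemma L2_cell_per0_L2: "u \<in> per0_L2 \<Longrightarrow> L2_cell u"
  unfolding per0_L2_def L2_cell_def by (blast intro: measurable_cell)

lemma fourier_mean: "fourier u (0, 0) = of_real (\<integral>p. u p \<partial>cell)"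
  by (simp add: fourier_eq_wave)

lemma fourier_0_per0_L2: "u \<in> per0_L2 \<Longrightarrow> fourier u (0, 0) = 0"
  unfolding fourier_mean per0_L2_def by simp

lemma per0_L2I:
  assumes "periodic u" "u \<in> borel_measurable borel" "L2_cell u" "fourier u (0, 0) = 0"
  shows "u \<in> per0_L2"
  using assms unfolding per0_L2_def L2_cell_def fourier_mean by simp

lemma per0_L2_diff:
  assumes "u \<in> per0_L2" "v \<in> per0_L2"
  shows "(\<lambda>p. u p - v p) \<in> per0_L2"
proof (rule per0_L2I)
  show "L2_cell (\<lambda>p. u p - v p)" by (intro L2_cell_diff L2_cell_per0_L2 assms)
  show "fourier (\<lambda>p. u p - v p) (0, 0) = 0"
    using assms by (simp add: fourier_diff L2_cell_integrable L2_cell_per0_L2 fourier_0_per0_L2)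
qed (use assms in \<open>auto simp: per0_L2_def periodic_def\<close>)

lemma fourier_Re_Im:
  assumes "L2_cell u"
  shows "Re (fourier u k) = (\<integral>p. u p * Re (wave k p) \<partial>cell)"
    and "Im (fourier u k) = - (\<integral>p. u p * Im (wave k p) \<partial>cell)"
  using integral_Re[OF integrable_fourier_integrand[OF L2_cell_integrable[OF assms], of k]]
    integral_Im[OF integrable_fourier_integrand[OF L2_cell_integrable[OF assms], of k]]
  by (simp_all add: fourier_eq_wave)

text \<open>Testing a weak derivative with cosine and sine gives its Fourier coefficients; \<open>m\<close> is the
  component of the frequency in the direction of differentiation.\<close>

lemma fourier_derivativeI:
  assumes u: "L2_cell u" and g: "L2_cell g"
    and c: "(\<integral>p. u p * (- 2 * pi * m * Im (wave k p)) \<partial>cell) = - (\<integral>p. g p * Re (wave k p) \<partial>cell)"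
    and s: "(\<integral>p. u p * (2 * pi * m * Re (wave k p)) \<partial>cell) = - (\<integral>p. g p * Im (wave k p) \<partial>cell)"
  shows "fourier g k = 2 * of_real pi * \<i> * of_real m * fourier u k"
proof -
  have 1: "(\<integral>p. u p * (- 2 * pi * m * Im (wave k p)) \<partial>cell) = - 2 * pi * m * (\<integral>p. u p * Im (wave k p) \<partial>cell)"
    unfolding integral_mult_right_zero[symmetric] by (intro Bochner_Integration.integral_cong) auto
  have 2: "(\<integral>p. u p * (2 * pi * m * Re (wave k p)) \<partial>cell) = 2 * pi * m * (\<integral>p. u p * Re (wave k p) \<partial>cell)"
    unfolding integral_mult_right_zero[symmetric] by (intro Bochner_Integration.integral_cong) auto
  show ?thesis
    using c s unfolding 1 2
    by (simp add: complex_eq_iff fourier_Re_Im[OF u] fourier_Re_Im[OF g])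
qed

text \<open>Multiplication by \<open>2 \<pi> i m\<close> is skew-Hermitian for the inner product of the coefficients.\<close>

lemma integral_by_parts_fourier:
  assumes "L2_cell u" "L2_cell g" "L2_cell \<phi>" "L2_cell \<phi>'"
    and g: "\<And>k. fourier g k = 2 * of_real pi * \<i> * of_real (m k) * fourier u k"
    and \<phi>': "\<And>k. fourier \<phi>' k = 2 * of_real pi * \<i> * of_real (m k) * fourier \<phi> k"
  shows "(\<integral>p. u p * \<phi>' p \<partial>cell) = - (\<integral>p. g p * \<phi> p \<partial>cell)"
proof -
  have "((\<lambda>k. Re (fourier u k * cnj (fourier \<phi>' k))) has_sum (\<integral>p. u p * \<phi>' p \<partial>cell)) UNIV"
    by (intro Parseval_inner assms)
  moreover have "Re (fourier u k * cnj (fourier \<phi>' k)) = - Re (fourier g k * cnj (fourier \<phi> k))" for k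
    unfolding g \<phi>' by (simp add: algebra_simps)
  moreover have "((\<lambda>k. - Re (fourier g k * cnj (fourier \<phi> k))) has_sum - (\<integral>p. g p * \<phi> p \<partial>cell)) UNIV"
    by (intro has_sum_uminusI Parseval_inner assms)
  ultimately show ?thesis by (simp only: has_sum_unique)
qed

lemma has_weak_dx_fourier:
  assumes "has_weak_dx u g"
  shows "fourier g k = 2 * of_real pi * \<i> * of_real (of_int (fst k)) * fourier u k"
proof (rule fourier_derivativeI)
  have *: "u \<in> per0_L2" "g \<in> per0_L2"
    "\<And>\<phi> \<phi>x \<phi>z. C1_periodic \<phi> \<phi>x \<phi>z \<Longrightarrow> (\<integral>p. u p * \<phi>x p \<partial>cell) = - (\<integral>p. g p * \<phi> p \<partial>cell)"
    using assms unfolding has_weak_dx_def by blast+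
  show "L2_cell u" "L2_cell g" using * by (auto intro: L2_cell_per0_L2)
  show "(\<integral>p. u p * (- 2 * pi * of_int (fst k) * Im (wave k p)) \<partial>cell) = - (\<integral>p. g p * Re (wave k p) \<partial>cell)"
    by (rule *(3)[OF C1_periodic_cos])
  show "(\<integral>p. u p * (2 * pi * of_int (fst k) * Re (wave k p)) \<partial>cell) = - (\<integral>p. g p * Im (wave k p) \<partial>cell)"
    by (rule *(3)[OF C1_periodic_sin])
qed

lemma has_weak_dz_fourier:
  assumes "has_weak_dz u g"
  shows "fourier g k = 2 * of_real pi * \<i> * of_real (of_int (snd k)) * fourier u k"
proof (rule fourier_derivativeI)
  have *: "u \<in> per0_L2" "g \<in> per0_L2"
    "\<And>\<phi> \<phi>x \<phi>z. C1_periodic \<phi> \<phi>x \<phi>z \<Longrightarrow> (\<integral>p. u p * \<phi>z p \<partial>cell) = - (\<integral>p. g p * \<phi> p \<partial>cell)"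
    using assms unfolding has_weak_dz_def by blast+
  show "L2_cell u" "L2_cell g" using * by (auto intro: L2_cell_per0_L2)
  show "(\<integral>p. u p * (- 2 * pi * of_int (snd k) * Im (wave k p)) \<partial>cell) = - (\<integral>p. g p * Re (wave k p) \<partial>cell)"
    by (rule *(3)[OF C1_periodic_cos])
  show "(\<integral>p. u p * (2 * pi * of_int (snd k) * Re (wave k p)) \<partial>cell) = - (\<integral>p. g p * Im (wave k p) \<partial>cell)"
    by (rule *(3)[OF C1_periodic_sin])
qed

lemma C1_periodic_continuous: "C1_periodic \<phi> \<phi>x \<phi>z \<Longrightarrow> continuous_on UNIV \<phi>"
  unfolding C1_periodic_def by (meson continuous_at_imp_continuous_on has_derivative_continuous)

lemma C1_periodic_mult:
  assumes "C1_periodic \<phi> \<phi>x \<phi>z" "C1_periodic \<psi> \<psi>x \<psi>z"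
  shows "C1_periodic (\<lambda>p. \<phi> p * \<psi> p) (\<lambda>p. \<phi> p * \<psi>x p + \<phi>x p * \<psi> p) (\<lambda>p. \<phi> p * \<psi>z p + \<phi>z p * \<psi> p)"
  unfolding C1_periodic_def
proof (intro conjI allI)
  note c = assms[THEN C1_periodic_continuous]
  note a = assms[unfolded C1_periodic_def]
  show "periodic (\<lambda>p. \<phi> p * \<psi> p)"
    using a(1)[THEN conjunct1] a(2)[THEN conjunct1] unfolding periodic_def by metis
  show "continuous_on UNIV (\<lambda>p. \<phi> p * \<psi>x p + \<phi>x p * \<psi> p)"
    "continuous_on UNIV (\<lambda>p. \<phi> p * \<psi>z p + \<phi>z p * \<psi> p)"
    using a c by (auto intro!: continuous_intros)
  fix p
  have "(\<phi> has_derivative (\<lambda>h. \<phi>x p * fst h + \<phi>z p * snd h)) (at p)"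
    "(\<psi> has_derivative (\<lambda>h. \<psi>x p * fst h + \<psi>z p * snd h)) (at p)"
    using a by blast+
  from has_derivative_mult[OF this]
  show "((\<lambda>p. \<phi> p * \<psi> p) has_derivative
      (\<lambda>h. (\<phi> p * \<psi>x p + \<phi>x p * \<psi> p) * fst h + (\<phi> p * \<psi>z p + \<phi>z p * \<psi> p) * snd h)) (at p)"
    by (rule back_subst[where P="\<lambda>f. (_ has_derivative f) _"]) (simp add: fun_eq_iff algebra_simps)
qed

lemma C1_periodic_by_parts:
  assumes \<phi>: "C1_periodic \<phi> \<phi>x \<phi>z" and \<psi>: "C1_periodic \<psi> \<psi>x \<psi>z"
  shows "(\<integral>p. \<phi> p * \<psi>x p \<partial>cell) = - (\<integral>p. \<phi>x p * \<psi> p \<partial>cell)"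
    and "(\<integral>p. \<phi> p * \<psi>z p \<partial>cell) = - (\<integral>p. \<phi>z p * \<psi> p \<partial>cell)"
proof -
  have c: "continuous_on UNIV \<phi>x" "continuous_on UNIV \<phi>z" "continuous_on UNIV \<psi>x" "continuous_on UNIV \<psi>z"
    using \<phi> \<psi> unfolding C1_periodic_def by blast+
  note c = c C1_periodic_continuous[OF \<phi>] C1_periodic_continuous[OF \<psi>]
  have i: "integrable cell (\<lambda>p. \<phi> p * \<psi>x p)" "integrable cell (\<lambda>p. \<phi>x p * \<psi> p)"
    "integrable cell (\<lambda>p. \<phi> p * \<psi>z p)" "integrable cell (\<lambda>p. \<phi>z p * \<psi> p)"
    by (intro integrable_cell_continuous continuous_on_mult c)+
  show "(\<integral>p. \<phi> p * \<psi>x p \<partial>cell) = - (\<integral>p. \<phi>x p * \<psi> p \<partial>cell)"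
    using integral_cell_C1(1)[OF C1_periodic_mult[OF \<phi> \<psi>]]
    unfolding Bochner_Integration.integral_add[OF i(1,2)] by linarith
  show "(\<integral>p. \<phi> p * \<psi>z p \<partial>cell) = - (\<integral>p. \<phi>z p * \<psi> p \<partial>cell)"
    using integral_cell_C1(2)[OF C1_periodic_mult[OF \<phi> \<psi>]]
    unfolding Bochner_Integration.integral_add[OF i(3,4)] by linarith
qed

lemma L2_cell_continuous: "continuous_on UNIV u \<Longrightarrow> L2_cell u"
  unfolding L2_cell_def
  by (intro conjI measurable_cell borel_measurable_continuous_onI integrable_cell_continuous continuous_intros)

lemma C1_periodic_fourier:
  assumes \<phi>: "C1_periodic \<phi> \<phi>x \<phi>z"
  shows "fourier \<phi>x k = 2 * of_real pi * \<i> * of_real (of_int (fst k)) * fourier \<phi> k"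
    and "fourier \<phi>z k = 2 * of_real pi * \<i> * of_real (of_int (snd k)) * fourier \<phi> k"
proof -
  have c: "continuous_on UNIV \<phi>x" "continuous_on UNIV \<phi>z"
    using \<phi> unfolding C1_periodic_def by blast+
  note c = c C1_periodic_continuous[OF \<phi>]
  show "fourier \<phi>x k = 2 * of_real pi * \<i> * of_real (of_int (fst k)) * fourier \<phi> k"
    by (rule fourier_derivativeI[OF c(3)[THEN L2_cell_continuous] c(1)[THEN L2_cell_continuous]
          C1_periodic_by_parts(1)[OF \<phi> C1_periodic_cos] C1_periodic_by_parts(1)[OF \<phi> C1_periodic_sin]])
  show "fourier \<phi>z k = 2 * of_real pi * \<i> * of_real (of_int (snd k)) * fourier \<phi> k"
    by (rule fourier_derivativeI[OF c(3)[THEN L2_cell_continuous] c(2)[THEN L2_cell_continuous]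
          C1_periodic_by_parts(2)[OF \<phi> C1_periodic_cos] C1_periodic_by_parts(2)[OF \<phi> C1_periodic_sin]])
qed

text \<open>The coefficients of a test function obey the same rule as those of \<open>u\<close> (\<open>C1_periodic_fourier\<close>), so the
  defining identity is an integration by parts on the side of the coefficients.\<close>

lemma has_weak_dxI:
  assumes u: "u \<in> per0_L2" and g: "g \<in> per0_L2"
    and f: "\<And>k. fourier g k = 2 * of_real pi * \<i> * of_real (of_int (fst k)) * fourier u k"
  shows "has_weak_dx u g"
  unfolding has_weak_dx_def
proof (intro conjI u g allI impI)
  fix \<phi> \<phi>x \<phi>z assume \<phi>: "C1_periodic \<phi> \<phi>x \<phi>z"
  then have "continuous_on UNIV \<phi>x" unfolding C1_periodic_def by blast
  then show "(\<integral>p. u p * \<phi>x p \<partial>cell) = - (\<integral>p. g p * \<phi> p \<partial>cell)"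
    by (intro integral_by_parts_fourier[OF _ _ _ _ f C1_periodic_fourier(1)[OF \<phi>]] L2_cell_per0_L2 u g
        L2_cell_continuous C1_periodic_continuous[OF \<phi>])
qed

lemma has_weak_dzI:
  assumes u: "u \<in> per0_L2" and g: "g \<in> per0_L2"
    and f: "\<And>k. fourier g k = 2 * of_real pi * \<i> * of_real (of_int (snd k)) * fourier u k"
  shows "has_weak_dz u g"
  unfolding has_weak_dz_def
proof (intro conjI u g allI impI)
  fix \<phi> \<phi>x \<phi>z assume \<phi>: "C1_periodic \<phi> \<phi>x \<phi>z"
  then have "continuous_on UNIV \<phi>z" unfolding C1_periodic_def by blast
  then show "(\<integral>p. u p * \<phi>z p \<partial>cell) = - (\<integral>p. g p * \<phi> p \<partial>cell)"
    by (intro integral_by_parts_fourier[OF _ _ _ _ f C1_periodic_fourier(2)[OF \<phi>]] L2_cell_per0_L2 u g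
        L2_cell_continuous C1_periodic_continuous[OF \<phi>])
qed

lemma dx_per0_H1:
  assumes "u \<in> per0_H1"
  shows "dx u \<in> per0_L2"
    and "fourier (dx u) k = 2 * of_real pi * \<i> * of_real (of_int (fst k)) * fourier u k"
proof -
  have "\<exists>g. has_weak_dx u g" using assms unfolding per0_H1_def by blast
  then have h: "has_weak_dx u (dx u)" unfolding dx_def by (rule someI_ex)
  then show "dx u \<in> per0_L2" unfolding has_weak_dx_def by blast
  show "fourier (dx u) k = 2 * of_real pi * \<i> * of_real (of_int (fst k)) * fourier u k"
    by (rule has_weak_dx_fourier[OF h])
qed

lemma dz_per0_H1:
  assumes "u \<in> per0_H1"
  shows "dz u \<in> per0_L2"
    and "fourier (dz u) k = 2 * of_real pi * \<i> * of_real (of_int (snd k)) * fourier u k"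
proof -
  have "\<exists>g. has_weak_dz u g" using assms unfolding per0_H1_def by blast
  then have h: "has_weak_dz u (dz u)" unfolding dz_def by (rule someI_ex)
  then show "dz u \<in> per0_L2" unfolding has_weak_dz_def by blast
  show "fourier (dz u) k = 2 * of_real pi * \<i> * of_real (of_int (snd k)) * fourier u k"
    by (rule has_weak_dz_fourier[OF h])
qed

lemma per0_L2_H1: "u \<in> per0_H1 \<Longrightarrow> u \<in> per0_L2"
  by (simp add: per0_H1_def)

lemma per0_L2_of_coeffs:
  assumes "c (0, 0) = 0" "\<And>k. c (- k) = cnj (c k)"
    and "\<And>F. finite F \<Longrightarrow> (\<Sum>k\<in>F. (cmod (c k))\<^sup>2) \<le> B"
  obtains u where "u \<in> per0_L2" "\<And>k. fourier u k = c k"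
  using Riesz_Fischer[of c B] assms per0_L2I by metis

lemma eigval_1: "eigval 1 k = (2 * pi * of_int (fst k))\<^sup>2 + (2 * pi * of_int (snd k))\<^sup>2"
  by (simp add: eigval_def power_mult_distrib algebra_simps)

lemma eigval_scale: "eigval \<kappa> k = \<kappa> * eigval 1 k"
  by (simp add: eigval_def)

lemma eigval_nonneg: "0 \<le> eigval 1 k"
  unfolding eigval_1 by simp

lemma eigval_uminus [simp]: "eigval \<kappa> (- k) = eigval \<kappa> k"
  by (simp add: eigval_def)

text \<open>The spectral gap. It makes negative powers of \<open>- \<Delta>\<close> contractions on functions of mean zero.\<close>

lemma eigval_1_ge_1:
  assumes "k \<noteq> (0, 0)" shows "1 \<le> eigval 1 k"
proof -
  have "0 < (fst k)\<^sup>2 + (snd k)\<^sup>2"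
    using assms by (simp only: sum_power2_gt_zero_iff) (metis prod.collapse)
  then have "1 \<le> (fst k)\<^sup>2 + (snd k)\<^sup>2" by linarith
  then have "of_int 1 \<le> (of_int ((fst k)\<^sup>2 + (snd k)\<^sup>2) :: real)" by (simp only: of_int_le_iff)
  then have "1 \<le> (of_int (fst k))\<^sup>2 + (of_int (snd k) :: real)\<^sup>2" by simp
  moreover have "1 \<le> 4 * pi\<^sup>2"
  proof -
    have "1 \<le> pi" using pi_gt3 by simp
    then have "1 \<le> pi\<^sup>2" by simp
    then show ?thesis by simp
  qed
  ultimately have "1 * 1 \<le> (4 * pi\<^sup>2) * ((of_int (fst k))\<^sup>2 + (of_int (snd k))\<^sup>2)"
    by (intro mult_mono) auto
  then show ?thesis by (simp add: eigval_def)
qed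

lemma eigval_0 [simp]: "eigval \<kappa> (0, 0) = 0"
  by (simp add: eigval_def)

text \<open>The bound makes \<open>c\<close> and both families \<open>2 \<pi> i k\<^sub>j c\<close> square summable. The Riesz--Fischer theorem turns
  all three into functions, which are then related by weak differentiation.\<close>

lemma per0_H1_of_coeffs:
  assumes c0: "c (0, 0) = 0" and sym: "\<And>k. c (- k) = cnj (c k)"
    and bd: "\<And>F. finite F \<Longrightarrow> (\<Sum>k\<in>F. eigval 1 k * (cmod (c k))\<^sup>2) \<le> B"
  obtains u where "u \<in> per0_H1" "\<And>k. fourier u k = c k"
proof -
  have le: "(cmod (c k))\<^sup>2 \<le> eigval 1 k * (cmod (c k))\<^sup>2" for k
    using eigval_1_ge_1[of k] c0 by (cases "k = (0,0)") (auto simp: mult_le_cancel_right1)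
  have bd0: "(\<Sum>k\<in>F. (cmod (c k))\<^sup>2) \<le> B" if "finite F" for F
    using sum_mono[of F "\<lambda>k. (cmod (c k))\<^sup>2", OF le] bd[OF that] by linarith
  obtain u where u: "u \<in> per0_L2" "\<And>k. fourier u k = c k"
    using per0_L2_of_coeffs[of c B] c0 sym bd0 by metis
  have ex: "\<exists>g\<in>per0_L2. \<forall>k. fourier g k = 2 * of_real pi * \<i> * of_real (m k) * c k"
    if m: "\<And>k. m (- k) = - m k" "\<And>k. (2 * pi * m k)\<^sup>2 \<le> eigval 1 k" for m :: "int \<times> int \<Rightarrow> real"
  proof -
    have b: "(\<Sum>k\<in>F. (cmod (2 * of_real pi * \<i> * of_real (m k) * c k))\<^sup>2) \<le> B" if "finite F" for F
    proof -
      have "(cmod (2 * of_real pi * \<i> * of_real (m k) * c k))\<^sup>2 \<le> eigval 1 k * (cmod (c k))\<^sup>2" for k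
      proof -
        have "(cmod (2 * of_real pi * \<i> * of_real (m k) * c k))\<^sup>2 = (2 * pi * m k)\<^sup>2 * (cmod (c k))\<^sup>2"
          by (simp add: norm_mult power_mult_distrib)
        then show ?thesis using mult_right_mono[OF m(2)[of k], of "(cmod (c k))\<^sup>2"] by simp
      qed
      then show ?thesis by (rule order_trans[OF sum_mono bd[OF that]])
    qed
    obtain g where "g \<in> per0_L2" "\<And>k. fourier g k = 2 * of_real pi * \<i> * of_real (m k) * c k"
      by (rule per0_L2_of_coeffs[of "\<lambda>k. 2 * of_real pi * \<i> * of_real (m k) * c k" B, OF _ _ b])
         (simp_all add: c0 sym m(1))
    then show ?thesis by blast
  qed
  obtain gx where gx: "gx \<in> per0_L2" "\<And>k. fourier gx k = 2 * of_real pi * \<i> * of_real (of_int (fst k)) * c k"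
    using ex[of "\<lambda>k. of_int (fst k)"] by (auto simp: eigval_1)
  obtain gz where gz: "gz \<in> per0_L2" "\<And>k. fourier gz k = 2 * of_real pi * \<i> * of_real (of_int (snd k)) * c k"
    using ex[of "\<lambda>k. of_int (snd k)"] by (auto simp: eigval_1)
  have "has_weak_dx u gx" "has_weak_dz u gz"
    using u gx gz by (auto intro!: has_weak_dxI has_weak_dzI)
  then have "u \<in> per0_H1" using u(1) unfolding per0_H1_def by blast
  then show thesis using that u(2) by blast
qed

lemma per0_L2_multiplier:
  assumes w: "w \<in> per0_L2" and \<mu>: "\<And>k. \<mu> (- k) = cnj (\<mu> k)" "\<And>k. cmod (\<mu> k) \<le> 1"
  obtains v where "v \<in> per0_L2" "\<And>k. fourier v k = \<mu> k * fourier w k"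
proof (rule per0_L2_of_coeffs[of "\<lambda>k. \<mu> k * fourier w k" "\<integral>p. (w p)\<^sup>2 \<partial>cell"])
  show "\<mu> (0, 0) * fourier w (0, 0) = 0" using w by (simp add: fourier_0_per0_L2)
  show "\<mu> (- k) * fourier w (- k) = cnj (\<mu> k * fourier w k)" for k by (simp add: \<mu> fourier_uminus)
  fix F :: "(int \<times> int) set" assume F: "finite F"
  have "(cmod (\<mu> k * fourier w k))\<^sup>2 \<le> (cmod (fourier w k))\<^sup>2" for k
    using mult_right_mono[OF \<mu>(2)[of k], of "cmod (fourier w k)"]
    by (intro power_mono) (auto simp: norm_mult)
  then show "(\<Sum>k\<in>F. (cmod (\<mu> k * fourier w k))\<^sup>2) \<le> (\<integral>p. (w p)\<^sup>2 \<partial>cell)"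
    using Bessel[OF L2_cell_per0_L2[OF w] F] by (meson order_trans sum_mono)
qed (use that in blast)

text \<open>The potential and its first and second derivatives are obtained from \<open>w\<close> by multiplying the coefficients
  by functions of the frequency that are bounded by one, since the nonzero eigenvalues are at least one.
  At the frequency zero, where the eigenvalue vanishes, division by zero gives the multiplier zero and
  hence functions of mean zero.\<close>

lemma has_laplacian_exists:
  assumes w: "w \<in> per0_L2" shows "\<exists>\<psi>. has_laplacian \<psi> w"
proof -
  define m n where "m k = 2 * pi * of_int (fst k)" and "n k = 2 * pi * of_int (snd k)" for k :: "int \<times> int"
  define E where "E k = eigval 1 k" for k
  have E: "E k = (m k)\<^sup>2 + (n k)\<^sup>2" "k \<noteq> (0, 0) \<Longrightarrow> 1 \<le> E k" "0 \<le> E k" for k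
    by (simp_all add: E_def m_def n_def eigval_1 eigval_1_ge_1 eigval_nonneg flip: eigval_1)
  have E1: "\<bar>x / E k\<bar> \<le> 1" if "\<bar>x\<bar> \<le> E k" for x k
    using that E(3)[of k] by (cases "E k = 0") (auto simp: divide_le_eq)
  have sq: "\<bar>x\<bar> \<le> E k" if "x\<^sup>2 \<le> E k" "k \<noteq> (0, 0)" for x k
  proof (cases "\<bar>x\<bar> \<le> 1")
    case True then show ?thesis using E(2)[OF that(2)] by linarith
  next
    case False
    then have "\<bar>x\<bar> * 1 \<le> \<bar>x\<bar> * \<bar>x\<bar>" by (intro mult_left_mono) auto
    then show ?thesis using that(1) by (simp add: power2_eq_square)
  qed
  have zero: "m (0, 0) = 0" "n (0, 0) = 0" "E (0, 0) = 0" by (simp_all add: m_def n_def E_def)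
  have sym: "m (- k) = - m k" "n (- k) = - n k" "E (- k) = E k" for k
    by (simp_all add: m_def n_def E_def)
  have b0: "\<bar>- 1 / E k\<bar> \<le> 1" for k
    using E1[of "-1" k] E(2)[of k] zero(3) by (cases "k = (0,0)") auto
  have b1: "\<bar>- m k / E k\<bar> \<le> 1" "\<bar>- n k / E k\<bar> \<le> 1" for k
    using E1[of "- m k" k] sq[of "- m k" k] E1[of "- n k" k] sq[of "- n k" k] E(1)[of k] zero
    by (cases "k = (0,0)"; simp)+
  have b2: "\<bar>(m k)\<^sup>2 / E k\<bar> \<le> 1" "\<bar>(n k)\<^sup>2 / E k\<bar> \<le> 1" for k
    using E1[of "(m k)\<^sup>2" k] E1[of "(n k)\<^sup>2" k] E(1)[of k] by auto
  obtain \<psi> where \<psi>: "\<psi> \<in> per0_L2" "\<And>k. fourier \<psi> k = of_real (- 1 / E k) * fourier w k"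
    by (rule per0_L2_multiplier[OF w, of "\<lambda>k. of_real (- 1 / E k)"])
       (auto simp: sym norm_of_real b0[unfolded abs_minus_cancel] simp del: of_real_divide, use b0 in auto)
  obtain \<psi>x where \<psi>x: "\<psi>x \<in> per0_L2" "\<And>k. fourier \<psi>x k = \<i> * of_real (- m k / E k) * fourier w k"
    by (rule per0_L2_multiplier[OF w, of "\<lambda>k. \<i> * of_real (- m k / E k)"])
       (auto simp: sym norm_mult simp del: of_real_divide of_real_minus, use b1 in auto)
  obtain \<psi>z where \<psi>z: "\<psi>z \<in> per0_L2" "\<And>k. fourier \<psi>z k = \<i> * of_real (- n k / E k) * fourier w k"
    by (rule per0_L2_multiplier[OF w, of "\<lambda>k. \<i> * of_real (- n k / E k)"])
       (auto simp: sym norm_mult simp del: of_real_divide of_real_minus, use b1 in auto)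
  obtain \<psi>xx where \<psi>xx: "\<psi>xx \<in> per0_L2" "\<And>k. fourier \<psi>xx k = of_real ((m k)\<^sup>2 / E k) * fourier w k"
    by (rule per0_L2_multiplier[OF w, of "\<lambda>k. of_real ((m k)\<^sup>2 / E k)"])
       (auto simp: sym norm_of_real simp del: of_real_divide, use b2 in auto)
  obtain \<psi>zz where \<psi>zz: "\<psi>zz \<in> per0_L2" "\<And>k. fourier \<psi>zz k = of_real ((n k)\<^sup>2 / E k) * fourier w k"
    by (rule per0_L2_multiplier[OF w, of "\<lambda>k. of_real ((n k)\<^sup>2 / E k)"])
       (auto simp: sym norm_of_real simp del: of_real_divide, use b2 in auto)
  have mn: "2 * of_real pi * \<i> * of_real (of_int (fst k)) = \<i> * of_real (m k)"
    "2 * of_real pi * \<i> * of_real (of_int (snd k)) = \<i> * of_real (n k)" for k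
    by (simp_all add: m_def n_def)
  have ii: "\<i> * of_real a * (\<i> * of_real (- a / b) * c) = of_real (a\<^sup>2 / b) * c" for a b :: real and c
  proof -
    have "\<i> * of_real a * (\<i> * of_real (- a / b) * c) = (\<i> * \<i>) * of_real (a * (- a / b)) * c"
      by (simp only: of_real_mult mult_ac)
    then show ?thesis by (simp add: power2_eq_square)
  qed
  have "has_weak_dx \<psi> \<psi>x"
    by (rule has_weak_dxI[OF \<psi>(1) \<psi>x(1)]) (simp add: \<psi>(2) \<psi>x(2) m_def)
  moreover have "has_weak_dz \<psi> \<psi>z"
    by (rule has_weak_dzI[OF \<psi>(1) \<psi>z(1)]) (simp add: \<psi>(2) \<psi>z(2) n_def)
  moreover have "has_weak_dx \<psi>x \<psi>xx"
    by (rule has_weak_dxI[OF \<psi>x(1) \<psi>xx(1)]) (simp only: \<psi>x(2) \<psi>xx(2) mn ii)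
  moreover have "has_weak_dz \<psi>z \<psi>zz"
    by (rule has_weak_dzI[OF \<psi>z(1) \<psi>zz(1)]) (simp only: \<psi>z(2) \<psi>zz(2) mn ii)
  moreover have "AE p in cell. w p = \<psi>xx p + \<psi>zz p"
  proof -
    note L = w[THEN L2_cell_per0_L2] \<psi>xx(1)[THEN L2_cell_per0_L2] \<psi>zz(1)[THEN L2_cell_per0_L2]
    have "fourier (\<lambda>p. w p - (\<psi>xx p + \<psi>zz p)) k = 0" for k
    proof -
      have "fourier (\<lambda>p. w p - (\<psi>xx p + \<psi>zz p)) k = fourier w k - (fourier \<psi>xx k + fourier \<psi>zz k)"
        using L by (simp add: fourier_diff fourier_add L2_cell_integrable)
      also have "\<dots> = (1 - of_real (((m k)\<^sup>2 + (n k)\<^sup>2) / E k)) * fourier w k"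
        unfolding \<psi>xx \<psi>zz add_divide_distrib of_real_add by (simp add: algebra_simps)
      also have "\<dots> = 0"
      proof (cases "k = (0, 0)")
        case True then show ?thesis using fourier_0_per0_L2[OF w] by simp
      next
        case False
        have "((m k)\<^sup>2 + (n k)\<^sup>2) / E k = 1" unfolding E(1)[symmetric] using E(2)[OF False] by simp
        then show ?thesis by (simp only: of_real_1 diff_self mult_zero_left)
      qed
      finally show ?thesis .
    qed
    then have "AE p in cell. w p - (\<psi>xx p + \<psi>zz p) = 0"
      using L by (intro fourier_eq_0_imp_AE_eq_0 L2_cell_integrable L2_cell_diff L2_cell_add)
    then show ?thesis by eventually_elim simp
  qed
  ultimately show ?thesis using w unfolding has_laplacian_def by blast
qed

text \<open>Whichever solution of \<open>\<Delta> \<psi> = w\<close> the choice operator picks, weak differentiation fixes its coefficients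
  at the nonzero frequencies, and the mean is zero.\<close>

lemma inv_laplacian_per0_L2:
  assumes w: "w \<in> per0_L2"
  shows "inv_laplacian w \<in> per0_H1"
    and "fourier (inv_laplacian w) k = - fourier w k / of_real (eigval 1 k)"
proof -
  have "has_laplacian (inv_laplacian w) w"
    unfolding inv_laplacian_def using has_laplacian_exists[OF w] by (rule someI_ex)
  then obtain \<psi>x \<psi>z \<psi>xx \<psi>zz where d: "has_weak_dx (inv_laplacian w) \<psi>x" "has_weak_dz (inv_laplacian w) \<psi>z"
      "has_weak_dx \<psi>x \<psi>xx" "has_weak_dz \<psi>z \<psi>zz" and eq: "AE p in cell. w p = \<psi>xx p + \<psi>zz p"
    unfolding has_laplacian_def by blast
  show H1: "inv_laplacian w \<in> per0_H1"
    using d unfolding per0_H1_def has_weak_dx_def by blast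
  have L: "\<psi>xx \<in> per0_L2" "\<psi>zz \<in> per0_L2"
    using d unfolding has_weak_dx_def has_weak_dz_def by blast+
  note L = L[THEN L2_cell_per0_L2]
  have "fourier w k = fourier (\<lambda>p. \<psi>xx p + \<psi>zz p) k"
    using eq L2_cell_measurable[OF L2_cell_per0_L2[OF w]] L2_cell_measurable[OF L2_cell_add[OF L]]
    by (intro fourier_cong_AE) auto
  also have "\<dots> = fourier \<psi>xx k + fourier \<psi>zz k"
    using L by (simp add: fourier_add L2_cell_integrable)
  also have "\<dots> = - of_real (eigval 1 k) * fourier (inv_laplacian w) k"
    unfolding has_weak_dx_fourier[OF d(3)] has_weak_dz_fourier[OF d(4)] has_weak_dx_fourier[OF d(1)]
      has_weak_dz_fourier[OF d(2)] eigval_1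
    by (simp add: power2_eq_square algebra_simps)
  finally have *: "fourier w k = - of_real (eigval 1 k) * fourier (inv_laplacian w) k" .
  show "fourier (inv_laplacian w) k = - fourier w k / of_real (eigval 1 k)"
  proof (cases "k = (0, 0)")
    case True
    then show ?thesis using fourier_0_per0_L2[OF per0_L2_H1[OF H1]] by simp
  next
    case False
    then show ?thesis using eigval_1_ge_1[OF False] unfolding * by simp
  qed
qed

section \<open>Square-summable families and the Jacobian\<close>

text \<open>Bounding all finite partial sums states in one condition that the family is square summable and that its
  norm is at most \<open>b\<close>. The norm \<open>hat_nrm\<close> alone does not do this, being zero on families that are not
  square summable.\<close>

definition ell2_le :: "('i \<Rightarrow> complex) \<Rightarrow> real \<Rightarrow> bool" where
  "ell2_le c b \<longleftrightarrow> (\<forall>F. finite F \<longrightarrow> L2_set (\<lambda>k. cmod (c k)) F \<le> b)"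

lemma ell2_leD: "ell2_le c b \<Longrightarrow> finite F \<Longrightarrow> L2_set (\<lambda>k. cmod (c k)) F \<le> b"
  unfolding ell2_le_def by blast

lemma ell2_le_nonneg: "ell2_le c b \<Longrightarrow> 0 \<le> b"
  using ell2_leD[of c b "{}"] by simp

lemma ell2_le_iff: "ell2_le c b \<longleftrightarrow> 0 \<le> b \<and> (\<forall>F. finite F \<longrightarrow> (\<Sum>k\<in>F. (cmod (c k))\<^sup>2) \<le> b\<^sup>2)"
proof -
  have "L2_set (\<lambda>k. cmod (c k)) F \<le> b \<longleftrightarrow> (\<Sum>k\<in>F. (cmod (c k))\<^sup>2) \<le> b\<^sup>2" if "0 \<le> b" for F
    unfolding L2_set_def using that real_sqrt_le_iff[of "\<Sum>k\<in>F. (cmod (c k))\<^sup>2" "b\<^sup>2"] by simp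
  then show ?thesis using ell2_le_nonneg[of c b] unfolding ell2_le_def by blast
qed

lemma ell2_le_mono: "ell2_le c b \<Longrightarrow> b \<le> b' \<Longrightarrow> ell2_le c b'"
  unfolding ell2_le_def by (meson order_trans)

lemma ell2_le_dominated:
  assumes "ell2_le d b" "\<And>k. cmod (c k) \<le> cmod (d k)" shows "ell2_le c b"
  unfolding ell2_le_def using ell2_leD[OF assms(1)] assms(2)
  by (meson L2_set_mono norm_ge_zero order_trans)

lemma ell2_le_add:
  assumes "ell2_le c a" "ell2_le d b" shows "ell2_le (\<lambda>k. c k + d k) (a + b)"
  unfolding ell2_le_def
proof (intro allI impI)
  fix F :: "'a set" assume F: "finite F"
  have "L2_set (\<lambda>k. cmod (c k + d k)) F \<le> L2_set (\<lambda>k. cmod (c k) + cmod (d k)) F"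
    by (intro L2_set_mono norm_triangle_ineq) auto
  also have "\<dots> \<le> L2_set (\<lambda>k. cmod (c k)) F + L2_set (\<lambda>k. cmod (d k)) F"
    by (rule L2_set_triangle_ineq)
  finally show "L2_set (\<lambda>k. cmod (c k + d k)) F \<le> a + b"
    using ell2_leD[OF assms(1) F] ell2_leD[OF assms(2) F] by linarith
qed

lemma ell2_le_minus: "ell2_le c b \<Longrightarrow> ell2_le (\<lambda>k. - c k) b"
  unfolding ell2_le_def by simp

lemma ell2_le_diff: "ell2_le c a \<Longrightarrow> ell2_le d b \<Longrightarrow> ell2_le (\<lambda>k. c k - d k) (a + b)"
  using ell2_le_add[OF _ ell2_le_minus] by fastforce

lemma ell2_le_scale:
  assumes "ell2_le c b" shows "ell2_le (\<lambda>k. a * c k) (cmod a * b)"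
  unfolding ell2_le_def norm_mult
  using ell2_leD[OF assms] L2_set_right_distrib[of "cmod a" "\<lambda>k. cmod (c k)"]
  by (metis mult_left_mono norm_ge_zero)

lemma ell2_le_hat_nrm:
  assumes "ell2_le c b" shows "hat_nrm c \<le> b" "(\<lambda>k. (cmod (c k))\<^sup>2) summable_on UNIV"
proof -
  have b: "0 \<le> b" "\<And>F. finite F \<Longrightarrow> (\<Sum>k\<in>F. (cmod (c k))\<^sup>2) \<le> b\<^sup>2" using assms unfolding ell2_le_iff by auto
  show s: "(\<lambda>k. (cmod (c k))\<^sup>2) summable_on UNIV"
    by (rule nonneg_bdd_above_summable_on) (auto simp: bdd_above_def intro: b(2))
  have "(\<Sum>\<^sub>\<infinity>k. (cmod (c k))\<^sup>2) \<le> b\<^sup>2"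
    by (rule infsum_le_finite_sums[OF s]) (auto intro: b(2))
  then show "hat_nrm c \<le> b" unfolding hat_nrm_def using b(1) by (simp add: real_le_lsqrt)
qed

lemma hat_nrm_ell2_le:
  assumes "(\<lambda>k. (cmod (c k))\<^sup>2) summable_on UNIV" shows "ell2_le c (hat_nrm c)"
proof -
  have "(\<Sum>k\<in>F. (cmod (c k))\<^sup>2) \<le> (\<Sum>\<^sub>\<infinity>k. (cmod (c k))\<^sup>2)" if "finite F" for F
    using that by (intro finite_sum_le_infsum assms) auto
  then show ?thesis unfolding ell2_le_def L2_set_def hat_nrm_def by simp
qed

lemma frac_pow_half: "0 \<le> \<kappa> \<Longrightarrow> frac_pow \<kappa> (1/2) c k = of_real (sqrt \<kappa>) * (of_real (sqrt (eigval 1 k)) * c k)"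
  using eigval_nonneg[of k]
  by (simp add: frac_pow_def powr_half_sqrt eigval_scale[of \<kappa>] real_sqrt_mult)

lemma ell2_le_grad_per0_H1:
  assumes "u \<in> per0_H1" shows "\<exists>b. ell2_le (frac_pow 1 (1/2) (fourier u)) b"
proof -
  let ?B = "(\<integral>p. (dx u p)\<^sup>2 \<partial>cell) + (\<integral>p. (dz u p)\<^sup>2 \<partial>cell)"
  have eq: "(cmod (frac_pow 1 (1/2) (fourier u) k))\<^sup>2 = (cmod (fourier (dx u) k))\<^sup>2 + (cmod (fourier (dz u) k))\<^sup>2" for k
    unfolding frac_pow_half[OF zero_le_one] dx_per0_H1(2)[OF assms] dz_per0_H1(2)[OF assms]
    using eigval_nonneg[of k] by (simp add: norm_mult power_mult_distrib eigval_1 distrib_right)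
  have "(\<Sum>k\<in>F. (cmod (frac_pow 1 (1/2) (fourier u) k))\<^sup>2) \<le> (sqrt ?B)\<^sup>2" if "finite F" for F
    unfolding eq sum.distrib
    using Bessel[OF L2_cell_per0_L2[OF dx_per0_H1(1)[OF assms]] that]
      Bessel[OF L2_cell_per0_L2[OF dz_per0_H1(1)[OF assms]] that] by simp
  then have "ell2_le (frac_pow 1 (1/2) (fourier u)) (sqrt ?B)" unfolding ell2_le_iff by simp
  then show ?thesis by blast
qed

lemma half_nrm_ell2_le:
  assumes "u \<in> per0_H1" "0 \<le> \<kappa>"
  shows "ell2_le (frac_pow \<kappa> (1/2) (fourier u)) (half_nrm \<kappa> u)"
proof -
  obtain b where "ell2_le (frac_pow 1 (1/2) (fourier u)) b" using ell2_le_grad_per0_H1[OF assms(1)] by blast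
  moreover have "frac_pow \<kappa> (1/2) (fourier u) = (\<lambda>k. of_real (sqrt \<kappa>) * frac_pow 1 (1/2) (fourier u) k)"
    using assms(2) by (simp add: frac_pow_half fun_eq_iff)
  ultimately have "ell2_le (frac_pow \<kappa> (1/2) (fourier u)) (cmod (of_real (sqrt \<kappa>)) * b)"
    by (simp only: ell2_le_scale)
  then show ?thesis
    unfolding half_nrm_def frac_nrm_def by (intro hat_nrm_ell2_le ell2_le_hat_nrm(2))
qed

lemma half_nrm_le_iff:
  assumes "u \<in> per0_H1" "0 \<le> \<kappa>"
  shows "half_nrm \<kappa> u \<le> b \<longleftrightarrow> ell2_le (frac_pow \<kappa> (1/2) (fourier u)) b"
  using half_nrm_ell2_le[OF assms] ell2_le_mono ell2_le_hat_nrm(1)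
  unfolding half_nrm_def frac_nrm_def by blast

lemma half_nrm_nonneg: "0 \<le> half_nrm \<kappa> u"
  unfolding half_nrm_def frac_nrm_def hat_nrm_def by (intro real_sqrt_ge_zero infsum_nonneg) simp

lemma half_nrm_1_le:
  assumes "u \<in> per0_H1" "0 < \<kappa>"
  shows "half_nrm 1 u \<le> half_nrm \<kappa> u / sqrt \<kappa>"
proof -
  have "ell2_le (\<lambda>k. of_real (1 / sqrt \<kappa>) * frac_pow \<kappa> (1/2) (fourier u) k) (cmod (of_real (1 / sqrt \<kappa>)) * half_nrm \<kappa> u)"
    using assms by (intro ell2_le_scale half_nrm_ell2_le) auto
  moreover have "of_real (1 / sqrt \<kappa>) * frac_pow \<kappa> (1/2) (fourier u) k = frac_pow 1 (1/2) (fourier u) k" for k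
    using assms(2) by (simp add: frac_pow_half)
  ultimately show ?thesis
    using assms by (simp add: half_nrm_le_iff del: of_real_divide)
qed

lemma per0_H1_diff:
  assumes "u \<in> per0_H1" "v \<in> per0_H1"
  shows "(\<lambda>p. u p - v p) \<in> per0_H1"
proof -
  have d: "(\<lambda>p. u p - v p) \<in> per0_L2" using assms by (intro per0_L2_diff per0_L2_H1)
  have L: "integrable cell u" "integrable cell v"
    using assms by (auto intro: L2_cell_integrable L2_cell_per0_L2 per0_L2_H1)
  have "has_weak_dx (\<lambda>p. u p - v p) (\<lambda>p. dx u p - dx v p)"
  proof (rule has_weak_dxI[OF d per0_L2_diff])
    fix k
    have "integrable cell (dx u)" "integrable cell (dx v)"
      using assms by (auto intro: L2_cell_integrable L2_cell_per0_L2 dx_per0_H1)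
    then show "fourier (\<lambda>p. dx u p - dx v p) k = 2 * of_real pi * \<i> * of_real (of_int (fst k)) * fourier (\<lambda>p. u p - v p) k"
      using L by (simp add: fourier_diff dx_per0_H1(2)[OF assms(1)] dx_per0_H1(2)[OF assms(2)] right_diff_distrib)
  qed (use assms in \<open>auto intro: dx_per0_H1\<close>)
  moreover have "has_weak_dz (\<lambda>p. u p - v p) (\<lambda>p. dz u p - dz v p)"
  proof (rule has_weak_dzI[OF d per0_L2_diff])
    fix k
    have "integrable cell (dz u)" "integrable cell (dz v)"
      using assms by (auto intro: L2_cell_integrable L2_cell_per0_L2 dz_per0_H1)
    then show "fourier (\<lambda>p. dz u p - dz v p) k = 2 * of_real pi * \<i> * of_real (of_int (snd k)) * fourier (\<lambda>p. u p - v p) k"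
      using L by (simp add: fourier_diff dz_per0_H1(2)[OF assms(1)] dz_per0_H1(2)[OF assms(2)] right_diff_distrib)
  qed (use assms in \<open>auto intro: dz_per0_H1\<close>)
  ultimately show ?thesis using d unfolding per0_H1_def by blast
qed

lemma fourier_diff_per0_L2:
  "u \<in> per0_L2 \<Longrightarrow> v \<in> per0_L2 \<Longrightarrow> fourier (\<lambda>p. u p - v p) k = fourier u k - fourier v k"
  by (intro fourier_diff L2_cell_integrable L2_cell_per0_L2)

lemma half_nrm_triangle:
  assumes "u \<in> per0_H1" "v \<in> per0_H1" "0 \<le> \<kappa>"
  shows "half_nrm \<kappa> u \<le> half_nrm \<kappa> v + half_nrm \<kappa> (\<lambda>p. u p - v p)"
proof -
  have "ell2_le (\<lambda>k. frac_pow \<kappa> (1/2) (fourier v) k + frac_pow \<kappa> (1/2) (fourier (\<lambda>p. u p - v p)) k)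
      (half_nrm \<kappa> v + half_nrm \<kappa> (\<lambda>p. u p - v p))"
    using assms by (intro ell2_le_add half_nrm_ell2_le per0_H1_diff)
  moreover have "frac_pow \<kappa> (1/2) (fourier v) k + frac_pow \<kappa> (1/2) (fourier (\<lambda>p. u p - v p)) k
      = frac_pow \<kappa> (1/2) (fourier u) k" for k
    using assms by (simp add: frac_pow_def fourier_diff_per0_L2 per0_L2_H1 algebra_simps)
  ultimately show ?thesis using assms by (simp add: half_nrm_le_iff)
qed

lemma half_nrm_diff_commute: "half_nrm \<kappa> (\<lambda>p. u p - v p) = half_nrm \<kappa> (\<lambda>p. v p - u p)"
proof -
  have "fourier (\<lambda>p. u p - v p) = (\<lambda>k. - fourier (\<lambda>p. v p - u p) k)"
    using fourier_scale[of "-1" "\<lambda>p. v p - u p"] by (simp add: fun_eq_iff)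
  then show ?thesis by (simp add: half_nrm_def frac_nrm_def hat_nrm_def frac_pow_def)
qed

text \<open>A function with absolutely summable coefficients is bounded by the sum of their moduli, so it acts
  on \<open>L\<^sup>2\<close> by multiplication with at most that norm.\<close>

lemma ell2_le_fourier_mult:
  assumes a: "L2_cell a" "ell2_le (fourier a) \<alpha>"
    and b: "L2_cell b" "\<And>F. finite F \<Longrightarrow> (\<Sum>k\<in>F. cmod (fourier b k)) \<le> \<beta>"
  shows "L2_cell (\<lambda>p. a p * b p)" and "ell2_le (fourier (\<lambda>p. a p * b p)) (\<alpha> * \<beta>)"
proof -
  have \<alpha>\<beta>: "0 \<le> \<alpha>" "0 \<le> \<beta>" using ell2_le_nonneg[OF a(2)] b(2)[of "{}"] by auto
  have m [measurable]: "a \<in> borel_measurable cell" "b \<in> borel_measurable cell"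
    using a b by (auto intro: L2_cell_measurable)
  have bd: "AE p in cell. (a p * b p)\<^sup>2 \<le> \<beta>\<^sup>2 * (a p)\<^sup>2"
  proof -
    have "AE p in cell. \<bar>b p\<bar> \<le> \<beta>" by (rule AE_abs_le_sum_fourier[OF b])
    then show ?thesis
  proof eventually_elim
    case (elim p)
    then have "(b p)\<^sup>2 \<le> \<beta>\<^sup>2" using abs_le_square_iff[of "b p" \<beta>] \<alpha>\<beta> by simp
    then have "(b p)\<^sup>2 * (a p)\<^sup>2 \<le> \<beta>\<^sup>2 * (a p)\<^sup>2" by (rule mult_right_mono) simp
    then show ?case by (simp add: power_mult_distrib mult.commute)
  qed
  qed
  have i: "integrable cell (\<lambda>p. \<beta>\<^sup>2 * (a p)\<^sup>2)" using L2_cell_square[OF a(1)] by simp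
  have "integrable cell (\<lambda>p. (a p * b p)\<^sup>2)"
    by (rule Bochner_Integration.integrable_bound[OF i]) (measurable, use bd in \<open>auto elim: eventually_mono\<close>)
  then show L: "L2_cell (\<lambda>p. a p * b p)" unfolding L2_cell_def by auto
  have "(\<integral>p. (a p * b p)\<^sup>2 \<partial>cell) \<le> (\<integral>p. \<beta>\<^sup>2 * (a p)\<^sup>2 \<partial>cell)"
    by (rule integral_mono_AE[OF L2_cell_square[OF L] i bd])
  also have "\<dots> = \<beta>\<^sup>2 * (\<integral>p. (a p)\<^sup>2 \<partial>cell)" by simp
  also have "\<dots> \<le> \<beta>\<^sup>2 * \<alpha>\<^sup>2"
    using a(2) unfolding ell2_le_iff
    by (intro mult_left_mono has_sum_le_finite_sums[OF Parseval[OF a(1)]]) auto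
  finally have "(\<integral>p. (a p * b p)\<^sup>2 \<partial>cell) \<le> (\<alpha> * \<beta>)\<^sup>2" by (simp add: power_mult_distrib mult.commute)
  then show "ell2_le (fourier (\<lambda>p. a p * b p)) (\<alpha> * \<beta>)"
    unfolding ell2_le_iff using \<alpha>\<beta> Bessel[OF L] by (meson mult_nonneg_nonneg order_trans)
qed

text \<open>In two dimensions the sum of \<open>|k|\<^sup>-\<^sup>4\<close> over the nonzero frequencies is finite. This is what
  makes \<open>\<nabla> \<Delta>\<^sup>-\<^sup>1\<close> bounded from \<open>H\<^sup>1\<close> into the bounded functions.\<close>

lemma sum_inverse_eigval_square_bounded:
  "\<exists>K\<ge>0. \<forall>F. finite F \<longrightarrow> (\<Sum>k\<in>F. (1 / eigval 1 k)\<^sup>2) \<le> K\<^sup>2"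
proof -
  define h where "h m = 1 / (1 + (real_of_int m)\<^sup>2)" for m
  have h0: "0 \<le> h m" for m unfolding h_def by simp
  have sm: "summable (\<lambda>n. 1 / (1 + (real n)\<^sup>2))"
  proof (rule summable_comparison_test'[where N=1])
    show "summable (\<lambda>n. inverse ((real n)\<^sup>2))" by (rule inverse_power_summable) simp
    show "norm (1 / (1 + (real n)\<^sup>2)) \<le> inverse ((real n)\<^sup>2)" if "1 \<le> n" for n
      using that by (simp add: divide_simps not_less add_nonneg_nonneg)
  qed
  define s where "s = (\<Sum>n. 1 / (1 + (real n)\<^sup>2))"
  have hs: "(\<Sum>m\<in>{- int n..int n}. h m) \<le> 2 * s" for n
  proof -
    have "{- int n..int n} \<subseteq> int ` {..n} \<union> (\<lambda>i. - int i) ` {..n}"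
    proof
      fix m assume "m \<in> {- int n..int n}"
      then have "m = int (nat m) \<and> nat m \<le> n \<or> m = - int (nat (- m)) \<and> nat (- m) \<le> n" by auto
      then show "m \<in> int ` {..n} \<union> (\<lambda>i. - int i) ` {..n}" by blast
    qed
    then have "(\<Sum>m\<in>{- int n..int n}. h m) \<le> (\<Sum>m\<in>int ` {..n} \<union> (\<lambda>i. - int i) ` {..n}. h m)"
      by (intro sum_mono2) (auto simp: h0)
    also have "\<dots> \<le> (\<Sum>m\<in>int ` {..n}. h m) + (\<Sum>m\<in>(\<lambda>i. - int i) ` {..n}. h m)"
      by (rule order_trans[OF _ order.refl]) (simp add: sum_Un h0 sum_nonneg)
    also have "\<dots> = (\<Sum>i\<le>n. 1 / (1 + (real i)\<^sup>2)) + (\<Sum>i\<le>n. 1 / (1 + (real i)\<^sup>2))"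
      by (simp add: sum.reindex inj_on_def h_def)
    also have "(\<Sum>i\<le>n. 1 / (1 + (real i)\<^sup>2)) \<le> s"
      unfolding s_def by (rule sum_le_suminf[OF sm]) auto
    finally show ?thesis by simp
  qed
  have s0: "0 \<le> s" unfolding s_def by (rule suminf_nonneg[OF sm]) simp
  have le: "(1 / eigval 1 k)\<^sup>2 \<le> 3 * (h (fst k) * h (snd k))" for k
  proof (cases "k = (0, 0)")
    case True then show ?thesis by (simp add: h0)
  next
    case False
    define a b where "a = (real_of_int (fst k))\<^sup>2" and "b = (real_of_int (snd k))\<^sup>2"
    have ab: "0 \<le> a" "0 \<le> b" by (simp_all add: a_def b_def)
    have ev: "eigval 1 k = (2 * pi)\<^sup>2 * (a + b)" by (simp add: eigval_1 a_def b_def power_mult_distrib algebra_simps)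
    have s1: "1 \<le> a + b"
    proof -
      have "0 < (fst k)\<^sup>2 + (snd k)\<^sup>2"
        using False by (simp only: sum_power2_gt_zero_iff) (metis prod.collapse)
      then have "of_int 1 \<le> (of_int ((fst k)\<^sup>2 + (snd k)\<^sup>2) :: real)" by (simp only: of_int_le_iff)
      then show ?thesis by (simp add: a_def b_def)
    qed
    have "1 \<le> (2 * pi)\<^sup>2" using pi_gt3 by (intro one_le_power) simp
    then have "a + b \<le> eigval 1 k" unfolding ev using s1 mult_right_mono[of 1 "(2 * pi)\<^sup>2" "a + b"] by simp
    then have "(a + b)\<^sup>2 \<le> (eigval 1 k)\<^sup>2" using ab by (intro power_mono) auto
    moreover have "(1 + a) * (1 + b) \<le> 3 * (a + b)\<^sup>2"
    proof -
      have "1 \<le> (a + b)\<^sup>2" using s1 by simp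
      moreover have "(a + b) * 1 \<le> (a + b) * (a + b)" using s1 by (intro mult_left_mono) auto
      moreover have "a * b \<le> (a + b)\<^sup>2" using ab by (simp add: power2_eq_square algebra_simps)
      ultimately show ?thesis by (simp add: power2_eq_square algebra_simps)
    qed
    ultimately have "(1 + a) * (1 + b) \<le> 3 * (eigval 1 k)\<^sup>2" by linarith
    moreover have "0 < (1 + a) * (1 + b)" using ab by (intro mult_pos_pos) auto
    ultimately have "3 / (3 * (eigval 1 k)\<^sup>2) \<le> 3 / ((1 + a) * (1 + b))"
      using eigval_1_ge_1[OF False] by (intro divide_left_mono) auto
    then show ?thesis
      unfolding h_def a_def[symmetric] b_def[symmetric] by (simp add: power_divide)
  qed
  have "(\<Sum>k\<in>F. (1 / eigval 1 k)\<^sup>2) \<le> 3 * ((2 * s) * (2 * s))" if F: "finite F" for F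
  proof -
    obtain n where n: "F \<subseteq> freq_box n"
    proof
      define n where "n = (\<Sum>k\<in>F. nat (max \<bar>fst k\<bar> \<bar>snd k\<bar>))"
      show "F \<subseteq> freq_box n"
        unfolding n_def by (intro subsetI mem_freq_box member_le_sum F) auto
    qed
    have "(\<Sum>k\<in>F. (1 / eigval 1 k)\<^sup>2) \<le> (\<Sum>k\<in>freq_box n. (1 / eigval 1 k)\<^sup>2)"
      by (intro sum_mono2 n) auto
    also have "\<dots> \<le> (\<Sum>k\<in>freq_box n. 3 * (h (fst k) * h (snd k)))"
      by (intro sum_mono le)
    also have "\<dots> = 3 * ((\<Sum>m\<in>{- int n..int n}. h m) * (\<Sum>m\<in>{- int n..int n}. h m))"
      unfolding freq_box_def sum_product sum.cartesian_product
      by (simp add: sum_distrib_left case_prod_unfold)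
    also have "\<dots> \<le> 3 * ((2 * s) * (2 * s))"
      using s0 hs[of n] by (intro mult_left_mono mult_mono) (auto intro: sum_nonneg h0)
    finally show ?thesis .
  qed
  then show ?thesis
    by (intro exI[of _ "sqrt (3 * ((2 * s) * (2 * s)))"]) (simp add: s0)
qed

text \<open>Any bound for the \<open>\<ell>\<^sup>2\<close> norm of the inverse eigenvalues, that is, for the norm of the Sobolev embedding
  \<open>H\<^sup>2 \<subseteq> L\<^sup>\<infinity>\<close> on functions of mean zero. The frequency zero contributes \<open>1 / 0 = 0\<close>.\<close>

definition inv_eigval_bound :: real where
  "inv_eigval_bound = (SOME K. 0 \<le> K \<and> (\<forall>F. finite F \<longrightarrow> (\<Sum>k\<in>F. (1 / eigval 1 k)\<^sup>2) \<le> K\<^sup>2))"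

lemma inv_eigval_bound:
  "0 \<le> inv_eigval_bound" "finite F \<Longrightarrow> L2_set (\<lambda>k. 1 / eigval 1 k) F \<le> inv_eigval_bound"
proof -
  have *: "0 \<le> inv_eigval_bound \<and> (\<forall>F. finite F \<longrightarrow> (\<Sum>k\<in>F. (1 / eigval 1 k)\<^sup>2) \<le> inv_eigval_bound\<^sup>2)"
    unfolding inv_eigval_bound_def by (rule someI_ex) (use sum_inverse_eigval_square_bounded in blast)
  then show "0 \<le> inv_eigval_bound" by blast
  show "L2_set (\<lambda>k. 1 / eigval 1 k) F \<le> inv_eigval_bound" if "finite F"
    unfolding L2_set_def using * that by (intro real_le_lsqrt) (auto intro: sum_nonneg)
qed

text \<open>The Cauchy--Schwarz inequality, with the inverse eigenvalues as second factor: the coefficients of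
  \<open>\<nabla> \<Delta>\<^sup>-\<^sup>1 w\<close> are at most those of the gradient of \<open>w\<close> divided by the eigenvalue. In this way \<open>\<nabla> \<Delta>\<^sup>-\<^sup>1 w\<close> is
  bounded, although \<open>H\<^sup>1\<close> itself does not embed into the bounded functions in two dimensions.\<close>

lemma sum_grad_inv_laplacian:
  assumes w: "ell2_le (frac_pow 1 (1/2) c) g" and d: "\<And>k. cmod (d k) \<le> sqrt (eigval 1 k) * cmod (c k) / eigval 1 k"
    and F: "finite F"
  shows "(\<Sum>k\<in>F. cmod (d k)) \<le> g * inv_eigval_bound"
proof -
  have "(\<Sum>k\<in>F. cmod (d k)) \<le> (\<Sum>k\<in>F. \<bar>cmod (frac_pow 1 (1/2) c k)\<bar> * \<bar>1 / eigval 1 k\<bar>)"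
    using d eigval_nonneg by (intro sum_mono) (simp add: frac_pow_half norm_mult)
  also have "\<dots> \<le> L2_set (\<lambda>k. cmod (frac_pow 1 (1/2) c k)) F * L2_set (\<lambda>k. 1 / eigval 1 k) F"
    by (rule L2_set_mult_ineq)
  also have "\<dots> \<le> g * inv_eigval_bound"
    using ell2_leD[OF w F] inv_eigval_bound(2)[OF F] ell2_le_nonneg[OF w] by (intro mult_mono) auto
  finally show ?thesis .
qed

lemma freq_le_sqrt_eigval:
  "2 * pi * \<bar>real_of_int (fst k)\<bar> \<le> sqrt (eigval 1 k)" "2 * pi * \<bar>real_of_int (snd k)\<bar> \<le> sqrt (eigval 1 k)"
  unfolding eigval_1 by (rule real_le_rsqrt; simp add: power_mult_distrib)+

lemma fourier_grad_inv_laplacian: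
  assumes w: "w \<in> per0_L2"
  shows "fourier (dx (inv_laplacian w)) k = - (2 * of_real pi * \<i> * of_real (of_int (fst k)) * fourier w k) / of_real (eigval 1 k)"
    and "fourier (dz (inv_laplacian w)) k = - (2 * of_real pi * \<i> * of_real (of_int (snd k)) * fourier w k) / of_real (eigval 1 k)"
  using dx_per0_H1(2)[OF inv_laplacian_per0_L2(1)[OF w], of k] dz_per0_H1(2)[OF inv_laplacian_per0_L2(1)[OF w], of k]
    inv_laplacian_per0_L2(2)[OF w, of k] by simp_all

lemma ell2_le_fourier_dx_dz:
  assumes "ell2_le (frac_pow 1 (1/2) c) g"
  shows "ell2_le (\<lambda>k. 2 * of_real pi * \<i> * of_real (of_int (fst k)) * c k) g"
    and "ell2_le (\<lambda>k. 2 * of_real pi * \<i> * of_real (of_int (snd k)) * c k) g"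
  by (rule ell2_le_dominated[OF assms],
      simp add: frac_pow_half norm_mult eigval_nonneg mult_right_mono[OF freq_le_sqrt_eigval(1)] mult_right_mono[OF freq_le_sqrt_eigval(2)])+

text \<open>By bilinearity the difference of the Jacobians is the sum of four products. In each of them one factor is
  a derivative of a vorticity, bounded in \<open>L\<^sup>2\<close>, and the other is a derivative of a stream function, bounded
  pointwise.\<close>

lemma ell2_le_jacobian_diff:
  assumes H: "\<omega> \<in> per0_H1" "\<omega>' \<in> per0_H1" "w \<in> per0_H1" "w' \<in> per0_H1"
  shows "ell2_le (\<lambda>k. fourier (jacobian \<omega> (inv_laplacian w)) k - fourier (jacobian \<omega>' (inv_laplacian w')) k)
     (2 * inv_eigval_bound * (half_nrm 1 (\<lambda>p. \<omega> p - \<omega>' p) * half_nrm 1 w + half_nrm 1 \<omega>' * half_nrm 1 (\<lambda>p. w p - w' p)))"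
proof -
  define \<psi> \<psi>' where "\<psi> = inv_laplacian w" and "\<psi>' = inv_laplacian w'"
  note Hw = per0_L2_H1[OF H(3)] per0_L2_H1[OF H(4)]
  have H\<psi>: "\<psi> \<in> per0_H1" "\<psi>' \<in> per0_H1"
    using Hw by (auto simp: \<psi>_def \<psi>'_def intro: inv_laplacian_per0_L2)
  define g1 g2 g3 g4 where "g1 = half_nrm 1 (\<lambda>p. \<omega> p - \<omega>' p)" and "g2 = half_nrm 1 w"
    and "g3 = half_nrm 1 \<omega>'" and "g4 = half_nrm 1 (\<lambda>p. w p - w' p)"
  have \<omega>d: "ell2_le (frac_pow 1 (1/2) (fourier (\<lambda>p. \<omega> p - \<omega>' p))) g1"
    and wb: "ell2_le (frac_pow 1 (1/2) (fourier w)) g2"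
    and \<omega>'b: "ell2_le (frac_pow 1 (1/2) (fourier \<omega>')) g3"
    and wd: "ell2_le (frac_pow 1 (1/2) (fourier (\<lambda>p. w p - w' p))) g4"
    unfolding g1_def g2_def g3_def g4_def using H by (intro half_nrm_ell2_le per0_H1_diff; simp)+
  have fd: "fourier (\<lambda>p. \<omega> p - \<omega>' p) k = fourier \<omega> k - fourier \<omega>' k"
    "fourier (\<lambda>p. w p - w' p) k = fourier w k - fourier w' k" for k
    using H by (auto intro!: fourier_diff_per0_L2 per0_L2_H1)
  note D = dx_per0_H1(1)[OF H(1)] dx_per0_H1(1)[OF H(2)] dz_per0_H1(1)[OF H(1)] dz_per0_H1(1)[OF H(2)]
    dx_per0_H1(1)[OF H\<psi>(1)] dx_per0_H1(1)[OF H\<psi>(2)] dz_per0_H1(1)[OF H\<psi>(1)] dz_per0_H1(1)[OF H\<psi>(2)]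
  have L: "L2_cell (dx \<omega>')" "L2_cell (dz \<omega>')" "L2_cell (dx \<psi>)" "L2_cell (dz \<psi>)"
    "L2_cell (\<lambda>p. dx \<omega> p - dx \<omega>' p)" "L2_cell (\<lambda>p. dz \<omega> p - dz \<omega>' p)"
    "L2_cell (\<lambda>p. dx \<psi> p - dx \<psi>' p)" "L2_cell (\<lambda>p. dz \<psi> p - dz \<psi>' p)"
    using D by (auto intro: L2_cell_per0_L2 L2_cell_diff)
  have e: "ell2_le (fourier (\<lambda>p. dx \<omega> p - dx \<omega>' p)) g1" "ell2_le (fourier (\<lambda>p. dz \<omega> p - dz \<omega>' p)) g1"
    "ell2_le (fourier (dx \<omega>')) g3" "ell2_le (fourier (dz \<omega>')) g3"
    using ell2_le_fourier_dx_dz[OF \<omega>d] ell2_le_fourier_dx_dz[OF \<omega>'b]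
    unfolding fourier_diff_per0_L2[OF D(1,2), abs_def] fourier_diff_per0_L2[OF D(3,4), abs_def] fd
      dx_per0_H1(2)[OF H(1), abs_def] dx_per0_H1(2)[OF H(2), abs_def] dz_per0_H1(2)[OF H(1), abs_def] dz_per0_H1(2)[OF H(2), abs_def]
    by (simp_all add: right_diff_distrib)
  have fr: "cmod (- (2 * of_real pi * \<i> * of_real (of_int (fst k)) * c) / of_real (eigval 1 k)) \<le> sqrt (eigval 1 k) * cmod c / eigval 1 k"
    "cmod (- (2 * of_real pi * \<i> * of_real (of_int (snd k)) * c) / of_real (eigval 1 k)) \<le> sqrt (eigval 1 k) * cmod c / eigval 1 k" for k c
    using mult_right_mono[OF freq_le_sqrt_eigval(1), of "cmod c" k] mult_right_mono[OF freq_le_sqrt_eigval(2), of "cmod c" k] eigval_nonneg[of k]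
    by (simp_all add: norm_mult norm_divide divide_right_mono)
  have frd: "fourier (\<lambda>p. dx \<psi> p - dx \<psi>' p) k = - (2 * of_real pi * \<i> * of_real (of_int (fst k)) * fourier (\<lambda>p. w p - w' p) k) / of_real (eigval 1 k)"
    "fourier (\<lambda>p. dz \<psi> p - dz \<psi>' p) k = - (2 * of_real pi * \<i> * of_real (of_int (snd k)) * fourier (\<lambda>p. w p - w' p) k) / of_real (eigval 1 k)" for k
    unfolding fourier_diff_per0_L2[OF D(5,6)] fourier_diff_per0_L2[OF D(7,8)] fd
    unfolding \<psi>_def \<psi>'_def
      fourier_grad_inv_laplacian[OF Hw(1)] fourier_grad_inv_laplacian[OF Hw(2)]
    by (simp_all add: right_diff_distrib diff_divide_distrib)
  have s: "(\<Sum>k\<in>F. cmod (fourier (dx \<psi>) k)) \<le> g2 * inv_eigval_bound" "(\<Sum>k\<in>F. cmod (fourier (dz \<psi>) k)) \<le> g2 * inv_eigval_bound"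
    "(\<Sum>k\<in>F. cmod (fourier (\<lambda>p. dx \<psi> p - dx \<psi>' p) k)) \<le> g4 * inv_eigval_bound"
    "(\<Sum>k\<in>F. cmod (fourier (\<lambda>p. dz \<psi> p - dz \<psi>' p) k)) \<le> g4 * inv_eigval_bound" if "finite F" for F
    by (rule sum_grad_inv_laplacian[OF wb _ that], simp only: \<psi>_def fourier_grad_inv_laplacian[OF Hw(1)] fr)
       (rule sum_grad_inv_laplacian[OF wb _ that], simp only: \<psi>_def fourier_grad_inv_laplacian[OF Hw(1)] fr,
        rule sum_grad_inv_laplacian[OF wd _ that], simp only: frd fr,
        rule sum_grad_inv_laplacian[OF wd _ that], simp only: frd fr)
  have T1: "L2_cell (\<lambda>p. (dx \<omega> p - dx \<omega>' p) * dz \<psi> p)"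
    "ell2_le (fourier (\<lambda>p. (dx \<omega> p - dx \<omega>' p) * dz \<psi> p)) (g1 * (g2 * inv_eigval_bound))"
    by (rule ell2_le_fourier_mult[OF L(5) e(1) L(4)], erule s(2))+
  have T2: "L2_cell (\<lambda>p. dx \<omega>' p * (dz \<psi> p - dz \<psi>' p))"
    "ell2_le (fourier (\<lambda>p. dx \<omega>' p * (dz \<psi> p - dz \<psi>' p))) (g3 * (g4 * inv_eigval_bound))"
    by (rule ell2_le_fourier_mult[OF L(1) e(3) L(8)], erule s(4))+
  have T3: "L2_cell (\<lambda>p. (dz \<omega> p - dz \<omega>' p) * dx \<psi> p)"
    "ell2_le (fourier (\<lambda>p. (dz \<omega> p - dz \<omega>' p) * dx \<psi> p)) (g1 * (g2 * inv_eigval_bound))"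
    by (rule ell2_le_fourier_mult[OF L(6) e(2) L(3)], erule s(1))+
  have T4: "L2_cell (\<lambda>p. dz \<omega>' p * (dx \<psi> p - dx \<psi>' p))"
    "ell2_le (fourier (\<lambda>p. dz \<omega>' p * (dx \<psi> p - dx \<psi>' p))) (g3 * (g4 * inv_eigval_bound))"
    by (rule ell2_le_fourier_mult[OF L(2) e(4) L(7)], erule s(3))+
  have LJ: "integrable cell (jacobian \<omega> \<psi>)" "integrable cell (jacobian \<omega>' \<psi>')"
    unfolding jacobian_def using D
    by (auto intro!: Bochner_Integration.integrable_diff L2_cell_mult_integrable L2_cell_per0_L2)
  have J: "fourier (jacobian \<omega> \<psi>) k - fourier (jacobian \<omega>' \<psi>') k =
      (fourier (\<lambda>p. (dx \<omega> p - dx \<omega>' p) * dz \<psi> p) k + fourier (\<lambda>p. dx \<omega>' p * (dz \<psi> p - dz \<psi>' p)) k) -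
      (fourier (\<lambda>p. (dz \<omega> p - dz \<omega>' p) * dx \<psi> p) k + fourier (\<lambda>p. dz \<omega>' p * (dx \<psi> p - dx \<psi>' p)) k)" for k
  proof -
    have "fourier (jacobian \<omega> \<psi>) k - fourier (jacobian \<omega>' \<psi>') k = fourier (\<lambda>p. jacobian \<omega> \<psi> p - jacobian \<omega>' \<psi>' p) k"
      using LJ by (simp add: fourier_diff)
    also have "(\<lambda>p. jacobian \<omega> \<psi> p - jacobian \<omega>' \<psi>' p) =
        (\<lambda>p. ((dx \<omega> p - dx \<omega>' p) * dz \<psi> p + dx \<omega>' p * (dz \<psi> p - dz \<psi>' p)) -
          ((dz \<omega> p - dz \<omega>' p) * dx \<psi> p + dz \<omega>' p * (dx \<psi> p - dx \<psi>' p)))"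
      by (simp add: jacobian_def fun_eq_iff algebra_simps)
    also have "fourier \<dots> k = (fourier (\<lambda>p. (dx \<omega> p - dx \<omega>' p) * dz \<psi> p) k + fourier (\<lambda>p. dx \<omega>' p * (dz \<psi> p - dz \<psi>' p)) k) -
      (fourier (\<lambda>p. (dz \<omega> p - dz \<omega>' p) * dx \<psi> p) k + fourier (\<lambda>p. dz \<omega>' p * (dx \<psi> p - dx \<psi>' p)) k)"
      by (simp only: fourier_diff fourier_add Bochner_Integration.integrable_add
          T1(1)[THEN L2_cell_integrable] T2(1)[THEN L2_cell_integrable] T3(1)[THEN L2_cell_integrable] T4(1)[THEN L2_cell_integrable])
    finally show ?thesis .
  qed
  have "2 * inv_eigval_bound * (g1 * g2 + g3 * g4) =
      (g1 * (g2 * inv_eigval_bound) + g3 * (g4 * inv_eigval_bound)) + (g1 * (g2 * inv_eigval_bound) + g3 * (g4 * inv_eigval_bound))"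
    by (simp add: algebra_simps)
  then show ?thesis
    unfolding \<psi>_def[symmetric] \<psi>'_def[symmetric] g1_def[symmetric] g2_def[symmetric] g3_def[symmetric] g4_def[symmetric] J
    by (simp only: ell2_le_diff ell2_le_add T1(2) T2(2) T3(2) T4(2))
qed

section \<open>Singular integrals\<close>

text \<open>Minkowski's inequality, proved by pairing the integral with itself: its square norm is the integral of the
  inner products of \<open>c s\<close> with it, which the Cauchy--Schwarz inequality bounds by its norm times \<open>h s\<close>.
  A coefficient that fails to be integrable in \<open>s\<close> contributes nothing, its integral being zero by
  convention.\<close>

lemma ell2_le_hat_integral:
  assumes h: "set_integrable lebesgue {a..b} h"
    and bd: "AE s in lebesgue. s \<in> {a..b} \<longrightarrow> ell2_le (c s) (h s)"
  shows "ell2_le (hat_integral a b c) (LINT s:{a..b}|lebesgue. h s)"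
  unfolding ell2_le_def
proof (intro allI impI)
  fix F :: "(int \<times> int) set" assume F: "finite F"
  define I where "I = hat_integral a b c"
  define G where "G = {k \<in> F. set_integrable lebesgue {a..b} (\<lambda>s. c s k)}"
  have G: "finite G" "G \<subseteq> F" using F by (auto simp: G_def)
  define n where "n = L2_set (\<lambda>k. cmod (I k)) G"
  have n0: "0 \<le> n" by (simp add: n_def L2_set_nonneg)
  have I0: "I k = 0" if "k \<in> F - G" for k
    using that unfolding I_def hat_integral_def G_def set_integrable_def set_lebesgue_integral_def
    by (auto simp: not_integrable_integral_eq)
  have n_F: "n = L2_set (\<lambda>k. cmod (I k)) F"
    unfolding n_def L2_set_def using F G I0 by (intro arg_cong[where f=sqrt] sum.mono_neutral_left) auto
  have si: "set_integrable lebesgue {a..b} (\<lambda>s. cnj (I k) * c s k)" if "k \<in> G" for k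
    using that by (auto simp: G_def intro: set_integrable_mult_right)
  have i: "integrable lebesgue (\<lambda>s. indicator {a..b} s *\<^sub>R (\<Sum>k\<in>G. cnj (I k) * c s k))"
    using Bochner_Integration.integrable_sum[of G lebesgue "\<lambda>k s. indicator {a..b} s *\<^sub>R (cnj (I k) * c s k)"] si
    unfolding set_integrable_def by (simp add: scaleR_sum_right)
  have "of_real (n\<^sup>2) = (\<Sum>k\<in>G. cnj (I k) * I k)"
    unfolding n_def L2_set_def
    by (simp add: sum_nonneg) (simp only: of_real_power[symmetric] complex_norm_square mult.commute)
  also have "\<dots> = (\<Sum>k\<in>G. LINT s:{a..b}|lebesgue. cnj (I k) * c s k)"
    by (intro sum.cong refl) (simp add: I_def hat_integral_def)
  also have "\<dots> = (\<integral>s. indicator {a..b} s *\<^sub>R (\<Sum>k\<in>G. cnj (I k) * c s k) \<partial>lebesgue)"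
    unfolding set_lebesgue_integral_def scaleR_sum_right
    by (rule Bochner_Integration.integral_sum[symmetric]) (use si in \<open>auto simp: set_integrable_def\<close>)
  finally have "n\<^sup>2 = Re (\<integral>s. indicator {a..b} s *\<^sub>R (\<Sum>k\<in>G. cnj (I k) * c s k) \<partial>lebesgue)"
    by (metis Re_complex_of_real)
  also have "\<dots> = (\<integral>s. Re (indicator {a..b} s *\<^sub>R (\<Sum>k\<in>G. cnj (I k) * c s k)) \<partial>lebesgue)"
    by (rule integral_Re[OF i, symmetric])
  also have "\<dots> \<le> (\<integral>s. n * (indicator {a..b} s *\<^sub>R h s) \<partial>lebesgue)"
  proof (rule integral_mono_AE[OF integrable_Re[OF i]])
    show "integrable lebesgue (\<lambda>s. n * (indicator {a..b} s *\<^sub>R h s))"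
      using h unfolding set_integrable_def by (rule integrable_mult_right)
    show "AE s in lebesgue. Re (indicator {a..b} s *\<^sub>R (\<Sum>k\<in>G. cnj (I k) * c s k)) \<le> n * (indicator {a..b} s *\<^sub>R h s)"
      using bd
    proof eventually_elim
      case (elim s)
      show ?case
      proof (cases "s \<in> {a..b}")
        case True
        have "Re (\<Sum>k\<in>G. cnj (I k) * c s k) \<le> cmod (\<Sum>k\<in>G. cnj (I k) * c s k)" by (rule complex_Re_le_cmod)
        also have "\<dots> \<le> (\<Sum>k\<in>G. \<bar>cmod (I k)\<bar> * \<bar>cmod (c s k)\<bar>)"
          by (rule order_trans[OF norm_sum]) (simp add: norm_mult)
        also have "\<dots> \<le> n * L2_set (\<lambda>k. cmod (c s k)) G" unfolding n_def by (rule L2_set_mult_ineq)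
        also have "\<dots> \<le> n * h s" using ell2_leD[OF _ G(1)] elim True n0 by (intro mult_left_mono) auto
        finally show ?thesis using True by simp
      qed simp
    qed
  qed
  also have "\<dots> = n * (LINT s:{a..b}|lebesgue. h s)" by (simp add: set_lebesgue_integral_def)
  finally have le: "n * n \<le> n * (LINT s:{a..b}|lebesgue. h s)" by (simp add: power2_eq_square)
  have "0 \<le> (LINT s:{a..b}|lebesgue. h s)"
    unfolding set_lebesgue_integral_def
    by (rule integral_nonneg_AE) (use bd in \<open>auto elim!: eventually_mono simp: indicator_def dest: ell2_le_nonneg\<close>)
  then have "n \<le> (LINT s:{a..b}|lebesgue. h s)"
    using le n0 by (cases "n = 0") auto
  then show "L2_set (\<lambda>k. cmod (hat_integral a b c k)) F \<le> (LINT s:{a..b}|lebesgue. h s)"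
    unfolding n_F I_def .
qed

lemma powr_integral:
  fixes t p :: real
  assumes "0 \<le> t" "p < 1"
  shows "set_integrable lebesgue {0..t} (\<lambda>s. s powr - p)"
    and "(LINT s:{0..t}|lebesgue. s powr - p) = t powr (1 - p) / (1 - p)"
    and "set_integrable lebesgue {0..t} (\<lambda>s. (t - s) powr - p)"
    and "(LINT s:{0..t}|lebesgue. (t - s) powr - p) = t powr (1 - p) / (1 - p)"
proof -
  have hi: "((\<lambda>s. s powr - p) has_integral (t powr (- p + 1) / (- p + 1))) {0..t}"
    using assms by (intro has_integral_powr_from_0) auto
  have 1: "set_integrable lebesgue {0..t} (\<lambda>s. s powr - p)"
    using hi by (intro nonnegative_absolutely_integrable_1) (auto intro: has_integral_integrable)
  then show "set_integrable lebesgue {0..t} (\<lambda>s. s powr - p)" .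
  show 2: "(LINT s:{0..t}|lebesgue. s powr - p) = t powr (1 - p) / (1 - p)"
    using set_lebesgue_integral_eq_integral(2)[OF 1] integral_unique[OF hi] by (simp add: add.commute)
  have ind: "indicator {0..t} (t + (- 1) * s) *\<^sub>R (t + (- 1) * s) powr - p = indicator {0..t} s *\<^sub>R (t - s) powr - p" for s
    by (auto simp: indicator_def)
  show "set_integrable lebesgue {0..t} (\<lambda>s. (t - s) powr - p)"
    using lebesgue_integrable_real_affine[OF 1[unfolded set_integrable_def], of "-1" t]
    unfolding set_integrable_def ind by simp
  show "(LINT s:{0..t}|lebesgue. (t - s) powr - p) = t powr (1 - p) / (1 - p)"
    using lebesgue_integral_real_affine[of "-1" "\<lambda>s. indicator {0..t} s *\<^sub>R s powr - p" t] 2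
    unfolding set_lebesgue_integral_def ind by simp
qed

text \<open>The smoothing estimate for the heat semigroup on a single mode with eigenvalue \<open>x\<close>. In the variable
  \<open>y = r x\<close> it reduces to \<open>y\<^sup>a \<le> 1 + y\<^sup>2 \<le> 3 e\<^sup>y\<close>.\<close>

lemma powr_exp_le:
  fixes x r a :: real
  assumes "0 \<le> x" "0 < r" "0 \<le> a" "a \<le> 2"
  shows "x powr a * exp (- (r * x)) \<le> 3 * r powr - a"
proof -
  define y where "y = r * x"
  have y: "0 \<le> y" using assms by (simp add: y_def)
  have "y powr a \<le> 1 + y\<^sup>2"
  proof (cases "y \<le> 1")
    case True
    then have "y powr a \<le> 1" using y assms by (cases "y = 0") (auto intro: powr_le1)
    then show ?thesis by (simp add: add_increasing2)
  next
    case False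
    then have "y powr a \<le> y powr 2" using assms by (intro powr_mono) auto
    then show ?thesis using False by (simp add: powr_numeral)
  qed
  also have "\<dots> \<le> 3 * exp y"
    using exp_lower_Taylor_quadratic[OF y] y zero_le_power2[of y] by linarith
  finally have *: "y powr a \<le> 3 * exp y" .
  have "x powr a = r powr - a * y powr a"
    using assms by (simp add: y_def powr_mult powr_minus)
  then have "x powr a * exp (- (r * x)) = r powr - a * (y powr a * exp (- y))" by (simp add: y_def)
  also have "y powr a * exp (- y) \<le> 3"
    using mult_right_mono[OF *, of "exp (- y)"] by (simp add: mult.assoc exp_minus_inverse)
  then have "r powr - a * (y powr a * exp (- y)) \<le> r powr - a * 3" by (intro mult_left_mono) auto
  finally show ?thesis by simp
qed

lemma sqrt_exp_le:
  fixes x r :: real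
  assumes "0 \<le> x" "0 < r"
  shows "sqrt x * exp (- (r * x)) \<le> r powr - (1/2)"
proof -
  have "sqrt (r * x) \<le> exp (r * x)"
  proof (rule real_le_lsqrt)
    have "r * x \<le> exp (r * x)" using exp_ge_add_one_self[of "r * x"] by linarith
    also have "\<dots> = exp (r * x) * 1" by simp
    also have "\<dots> \<le> exp (r * x) * exp (r * x)" using assms by (intro mult_left_mono) auto
    finally show "r * x \<le> (exp (r * x))\<^sup>2" by (simp add: power2_eq_square)
  qed simp
  then have "sqrt r * (sqrt x * exp (- (r * x))) \<le> 1"
    using mult_right_mono[of "sqrt (r * x)" "exp (r * x)" "exp (- (r * x))"]
    by (simp add: real_sqrt_mult exp_minus mult.assoc)
  then show ?thesis
    using assms by (simp add: powr_minus powr_half_sqrt divide_simps mult.commute)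
qed

text \<open>The exponential weight of the Gronwall argument is traded for the small factor \<open>l\<^sup>-\<^sup>1\<^sup>/\<^sup>4\<close>. Any exponent below
  \<open>1/2\<close> would do: the kernel \<open>r\<^sup>-\<^sup>1\<^sup>/\<^sup>2\<close> is still integrable after multiplication with \<open>r\<^sup>-\<^sup>1\<^sup>/\<^sup>4\<close>.\<close>

lemma powr_quarter_exp_le:
  fixes l r :: real
  assumes "0 < r" "0 < l"
  shows "exp (- (l * r)) \<le> l powr - (1/4) * r powr - (1/4)"
proof -
  have "(l * r) powr (1/4) \<le> exp (l * r)"
  proof (cases "l * r \<le> 1")
    case True
    then have "(l * r) powr (1/4) \<le> 1" using assms by (intro powr_le1) auto
    also have "1 \<le> exp (l * r)" using assms by simp
    finally show ?thesis .
  next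
    case False
    then have "(l * r) powr (1/4) \<le> (l * r) powr 1" by (intro powr_mono) auto
    also have "\<dots> = l * r" using False by simp
    also have "\<dots> \<le> exp (l * r)" using exp_ge_add_one_self[of "l * r"] by linarith
    finally show ?thesis .
  qed
  moreover have "0 < (l * r) powr (1/4)" using assms by simp
  ultimately have "inverse (exp (l * r)) \<le> inverse ((l * r) powr (1/4))" by (intro le_imp_inverse_le)
  then show ?thesis using assms by (simp add: exp_minus powr_minus powr_mult)
qed

interpretation lebesgue_real: sigma_finite_measure "lebesgue :: real measure"
proof
  show "\<exists>A. countable A \<and> A \<subseteq> sets lebesgue \<and> \<Union> A = space (lebesgue :: real measure) \<and> (\<forall>a\<in>A. emeasure lebesgue a \<noteq> \<infinity>)"
  proof (intro exI[of _ "range (\<lambda>n::nat. {- real n..real n})"] conjI ballI)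
    show "\<Union> (range (\<lambda>n::nat. {- real n..real n})) = space (lebesgue :: real measure)"
    proof (auto, goal_cases)
      case (1 x)
      obtain n where "\<bar>x\<bar> \<le> real n" using real_arch_simple by blast
      then show ?case by (intro exI[of _ n]) (auto simp: abs_le_iff)
    qed
  qed auto
qed

interpretation lebesgue_real_pair: pair_sigma_finite "lebesgue :: real measure" "lebesgue :: real measure" ..

text \<open>Integration by parts in the variation-of-constants integral, for a merely integrable
  \<open>g\<close>. The exponential is written as \<open>exp (- t \<mu>)\<close> plus the integral of its derivative, and the
  order of integration is exchanged.\<close>

lemma duhamel_by_parts:
  fixes g :: "real \<Rightarrow> complex"
  assumes g: "set_integrable lebesgue {0..t} g" and \<mu>: "0 \<le> \<mu>"
  shows "(LINT s:{0..t}|lebesgue. of_real (exp (- ((t - s) * \<mu>))) * g s) =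
    of_real (exp (- (t * \<mu>))) * (LINT s:{0..t}|lebesgue. g s) +
    (LINT r:{0..t}|lebesgue. of_real (\<mu> * exp (- ((t - r) * \<mu>))) * (LINT s:{r..t}|lebesgue. g s))"
proof -
  define e where "e r = \<mu> * exp (- ((t - r) * \<mu>))" for r
  define G where "G s = indicator {0..t} s *\<^sub>R g s" for s
  define \<Phi> where "\<Phi> = (\<lambda>(s, r). indicator {0..t} r *\<^sub>R indicator {(s, r). r \<le> s} (s, r) *\<^sub>R (of_real (e r) * G s))"
  have iG: "integrable lebesgue G" using g by (simp add: G_def[abs_def] set_integrable_def)
  then have mG [measurable]: "G \<in> borel_measurable lebesgue" by simp
  have id [measurable]: "(\<lambda>x. x) \<in> borel_measurable (lebesgue :: real measure)"
    by (intro measurable_completion) simp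
  have ce: "continuous_on A e" for A unfolding e_def by (intro continuous_intros)
  have me [measurable]: "e \<in> borel_measurable lebesgue"
    by (intro measurable_completion) (simp add: borel_measurable_continuous_onI ce)
  have e0: "0 \<le> e r" for r using \<mu> by (simp add: e_def)
  have eb: "e r \<le> \<mu>" if "r \<in> {0..t}" for r
    using \<mu> that by (simp add: e_def mult_left_le)
  have [measurable]: "Measurable.pred (lebesgue \<Otimes>\<^sub>M lebesgue) (\<lambda>x :: real \<times> real. snd x \<le> fst x)"
    by measurable
  have m\<Phi>: "\<Phi> \<in> borel_measurable (lebesgue \<Otimes>\<^sub>M lebesgue)"
    unfolding \<Phi>_def case_prod_unfold indicator_def mem_Collect_eq by measurable
  have fin: "integrable lebesgue (\<lambda>r. indicator {0..t} r *\<^sub>R \<mu> :: real)"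
    using absolutely_integrable_continuous_real[of 0 t "\<lambda>_. \<mu>"] by (simp only: set_integrable_def continuous_on_const simp_thms)
  have inner: "(\<integral>r. \<Phi> (s, r) \<partial>lebesgue) = of_real (exp (- ((t - s) * \<mu>)) - exp (- (t * \<mu>))) * G s" for s
  proof (cases "s \<in> {0..t}")
    case True
    have "(\<integral>r. \<Phi> (s, r) \<partial>lebesgue) = (\<integral>r. of_real (indicator {0..s} r *\<^sub>R e r) * G s \<partial>lebesgue)"
      using True by (intro Bochner_Integration.integral_cong) (auto simp: \<Phi>_def indicator_def)
    also have "\<dots> = of_real (LINT r:{0..s}|lebesgue. e r) * G s"
      by (simp add: set_lebesgue_integral_def del: of_real_mult)
    also have "(LINT r:{0..s}|lebesgue. e r) = integral {0..s} e"
      by (intro set_lebesgue_integral_eq_integral absolutely_integrable_continuous_real ce)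
    also have "\<dots> = exp (- ((t - s) * \<mu>)) - exp (- ((t - 0) * \<mu>))"
      using True unfolding e_def
      by (intro integral_unique fundamental_theorem_of_calculus)
         (auto intro!: derivative_eq_intros simp flip: has_real_derivative_iff_has_vector_derivative)
    finally show ?thesis by simp
  next
    case False
    then show ?thesis by (simp add: \<Phi>_def G_def)
  qed
  have ibd: "integrable lebesgue (\<lambda>r. indicator {0..t} r *\<^sub>R (\<mu> * a) :: real)" for a
    using integrable_mult_left[OF fin, of a] by (simp add: mult.assoc)
  have n\<Phi>: "norm (\<Phi> (s, r)) \<le> indicator {0..t} r *\<^sub>R (\<mu> * norm (G s))" for s r
    using e0[of r] eb[of r] by (auto simp: \<Phi>_def indicator_def norm_mult mult_right_mono)
  have iP1: "integrable lebesgue (\<lambda>r. \<Phi> (s, r))" for s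
    by (rule Bochner_Integration.integrable_bound[OF ibd[of "norm (G s)"]])
       (use n\<Phi> \<mu> measurable_Pair2[OF m\<Phi>] in \<open>auto intro!: AE_I2\<close>)
  have i\<Phi>: "integrable (lebesgue \<Otimes>\<^sub>M lebesgue) \<Phi>"
  proof (rule lebesgue_real_pair.Fubini_integrable[OF m\<Phi>])
    show "AE s in lebesgue. integrable lebesgue (\<lambda>r. \<Phi> (s, r))" using iP1 by simp
    define c where "c = (\<integral>r. indicator {0..t} r *\<^sub>R \<mu> \<partial>(lebesgue :: real measure))"
    show "integrable lebesgue (\<lambda>s. \<integral>r. norm (\<Phi> (s, r)) \<partial>lebesgue)"
    proof (rule Bochner_Integration.integrable_bound[where f="\<lambda>s. c * norm (G s)"])
      show "integrable lebesgue (\<lambda>s. c * norm (G s))" using iG by simp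
      show "(\<lambda>s. \<integral>r. norm (\<Phi> (s, r)) \<partial>lebesgue) \<in> borel_measurable lebesgue"
        using m\<Phi> by (intro lebesgue_real.borel_measurable_lebesgue_integral) simp
      show "AE s in lebesgue. norm (\<integral>r. norm (\<Phi> (s, r)) \<partial>lebesgue) \<le> norm (c * norm (G s))"
      proof (rule AE_I2)
        fix s
        have "(\<integral>r. norm (\<Phi> (s, r)) \<partial>lebesgue) \<le> (\<integral>r. indicator {0..t} r *\<^sub>R (\<mu> * norm (G s)) \<partial>lebesgue)"
          by (intro integral_mono integrable_norm iP1 ibd n\<Phi>)
        also have "\<dots> = c * norm (G s)" by (simp add: c_def mult.assoc[symmetric] del: integral_scaleR_left scaleR_scaleR)
        finally show "norm (\<integral>r. norm (\<Phi> (s, r)) \<partial>lebesgue) \<le> norm (c * norm (G s))" by (simp add: order_trans[OF _ abs_ge_self])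
      qed
    qed
  qed
  have outer: "(\<integral>s. \<Phi> (s, r) \<partial>lebesgue) = indicator {0..t} r *\<^sub>R (of_real (e r) * (LINT s:{r..t}|lebesgue. g s))" for r
  proof -
    have "(\<integral>s. \<Phi> (s, r) \<partial>lebesgue) = (\<integral>s. of_real (indicator {0..t} r * e r) * (indicator {r..t} s *\<^sub>R g s) \<partial>lebesgue)"
      by (intro Bochner_Integration.integral_cong) (auto simp: \<Phi>_def G_def indicator_def)
    then show ?thesis by (simp add: set_lebesgue_integral_def scaleR_conv_of_real mult.assoc)
  qed
  have "(\<integral>s. (\<integral>r. \<Phi> (s, r) \<partial>lebesgue) \<partial>lebesgue) = (\<integral>r. (\<integral>s. \<Phi> (s, r) \<partial>lebesgue) \<partial>lebesgue)"
    using lebesgue_real_pair.Fubini_integral[of "\<lambda>s r. \<Phi> (s, r)"] i\<Phi> by simp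
  then have F: "(\<integral>s. of_real (exp (- ((t - s) * \<mu>)) - exp (- (t * \<mu>))) * G s \<partial>lebesgue) =
      (LINT r:{0..t}|lebesgue. of_real (e r) * (LINT s:{r..t}|lebesgue. g s))"
    unfolding inner outer set_lebesgue_integral_def by simp
  have i1: "integrable lebesgue (\<lambda>s. of_real (exp (- ((t - s) * \<mu>))) * G s)"
  proof (rule Bochner_Integration.integrable_bound[OF iG])
    have "(\<lambda>s. complex_of_real (exp (- ((t - s) * \<mu>)))) \<in> borel_measurable lebesgue"
      by (intro measurable_completion borel_measurable_continuous_onI[unfolded measurable_lborel1[symmetric]])
         (auto intro!: borel_measurable_continuous_onI continuous_intros)
    then show "(\<lambda>s. complex_of_real (exp (- ((t - s) * \<mu>))) * G s) \<in> borel_measurable lebesgue" by simp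
    show "AE s in lebesgue. norm (complex_of_real (exp (- ((t - s) * \<mu>))) * G s) \<le> norm (G s)"
      using \<mu> by (intro AE_I2) (auto simp: G_def indicator_def norm_mult mult_left_le_one_le)
  qed
  have "(LINT s:{0..t}|lebesgue. of_real (exp (- ((t - s) * \<mu>))) * g s) = (\<integral>s. of_real (exp (- ((t - s) * \<mu>))) * G s \<partial>lebesgue)"
    unfolding set_lebesgue_integral_def G_def by (intro Bochner_Integration.integral_cong) auto
  also have "\<dots> = (\<integral>s. of_real (exp (- ((t - s) * \<mu>)) - exp (- (t * \<mu>))) * G s + of_real (exp (- (t * \<mu>))) * G s \<partial>lebesgue)"
    by (intro Bochner_Integration.integral_cong) (auto simp: algebra_simps)
  also have "\<dots> = (\<integral>s. of_real (exp (- ((t - s) * \<mu>)) - exp (- (t * \<mu>))) * G s \<partial>lebesgue) + of_real (exp (- (t * \<mu>))) * (\<integral>s. G s \<partial>lebesgue)"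
    using i1 iG by (subst Bochner_Integration.integral_add) (auto simp: left_diff_distrib)
  finally show ?thesis
    unfolding F by (simp add: e_def G_def set_lebesgue_integral_def add.commute)
qed

text \<open>The bootstrap: the inequality is only known while \<open>z \<le> \<rho>\<close>, and its conclusion keeps \<open>z\<close>
  strictly below \<open>\<rho>\<close>. The exponential weight makes the integral term a contraction.\<close>

lemma singular_Gronwall:
  fixes z a :: "real \<Rightarrow> real"
  assumes T: "0 \<le> T" and K: "0 \<le> K" and l: "0 < l" "K * (4 * T powr (1/4) * l powr - (1/4)) \<le> 1/2"
    and z: "continuous_on {0..T} z" "\<And>t. t \<in> {0..T} \<Longrightarrow> 0 \<le> z t"
    and a: "\<And>t. t \<in> {0..T} \<Longrightarrow> 0 \<le> a t" "\<And>t. t \<in> {0..T} \<Longrightarrow> a t \<le> A0"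
      "\<And>t. t \<in> {0<..T} \<Longrightarrow> a t \<le> A1 * t powr - (1/2)" and A1: "0 \<le> A1"
    and z0: "z 0 \<le> A0"
    and step: "\<And>t A Y. t \<in> {0..T} \<Longrightarrow> (\<forall>s\<in>{0..t}. z s \<le> \<rho>) \<Longrightarrow> 0 \<le> A \<Longrightarrow> 0 \<le> Y \<Longrightarrow>
       (\<forall>s\<in>{0<..<t}. z s \<le> A * s powr - (1/2) + Y * exp (l * s)) \<Longrightarrow>
       z t \<le> a t + K * (6 * A + 4 * T powr (1/4) * l powr - (1/4) * exp (l * t) * Y)"
    and small: "A0 + 12 * K * exp (l * T) * A1 < \<rho>"
    and t: "t \<in> {0..T}"
  shows "z t \<le> a t + 12 * K * exp (l * T) * A1"
proof -
  let ?C = "12 * K * exp (l * T) * A1"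
  have C0: "0 \<le> ?C" using K A1 by simp
  have main: "z t \<le> a t + ?C" if \<tau>: "\<tau> \<in> {0..T}" "\<forall>s\<in>{0..\<tau>}. z s \<le> \<rho>" and t: "t \<in> {0..\<tau>}" for t \<tau>
  proof -
    define y where "y s = exp (- (l * s)) * (z s - a s)" for s
    \<comment> \<open>The weighted supremum of the excess of \<open>z\<close> over \<open>a\<close>. The estimate below bounds it by a constant plus half
       of itself.\<close>
    define Y where "Y = Sup (insert 0 (y ` {0..\<tau>}))"
    have yb: "y s \<le> max 0 \<rho>" if "s \<in> {0..\<tau>}" for s
    proof -
      have "z s \<le> \<rho>" using \<tau>(2) that by blast
      moreover have "0 \<le> a s" "0 \<le> l * s" using that \<tau> a(1)[of s] l by auto
      ultimately have "z s - a s \<le> \<rho>" "0 \<le> l * s" by linarith+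
      then have "y s \<le> exp (- (l * s)) * max 0 \<rho>" unfolding y_def by (intro mult_left_mono) auto
      also have "\<dots> \<le> 1 * max 0 \<rho>" using \<open>0 \<le> l * s\<close> by (intro mult_right_mono) auto
      finally show ?thesis by simp
    qed
    have bdd: "bdd_above (insert 0 (y ` {0..\<tau>}))"
      using yb by (intro bdd_aboveI[of _ "max 0 \<rho>"]) auto
    have Y0: "0 \<le> Y" unfolding Y_def by (rule cSup_upper[OF _ bdd]) simp
    have yY: "y s \<le> Y" if "s \<in> {0..\<tau>}" for s unfolding Y_def by (rule cSup_upper[OF _ bdd]) (use that in simp)
    have zY: "z s \<le> a s + Y * exp (l * s)" if "s \<in> {0..\<tau>}" for s
    proof -
      have "exp (l * s) * y s \<le> exp (l * s) * Y" using yY[OF that] by (intro mult_left_mono) auto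
      moreover have "exp (l * s) * y s = z s - a s" by (simp add: y_def exp_minus)
      ultimately show ?thesis using mult.commute[of Y "exp (l * s)"] by linarith
    qed
    have ys: "y s \<le> 6 * K * A1 + Y / 2" if s: "s \<in> {0..\<tau>}" for s
    proof -
      have "z s \<le> a s + K * (6 * A1 + 4 * T powr (1/4) * l powr - (1/4) * exp (l * s) * Y)"
      proof (rule step)
        show "\<forall>r\<in>{0<..<s}. z r \<le> A1 * r powr - (1/2) + Y * exp (l * r)"
        proof
          fix r assume r: "r \<in> {0<..<s}"
          then have "z r \<le> a r + Y * exp (l * r)" using s by (intro zY) auto
          moreover have "a r \<le> A1 * r powr - (1/2)" using r s \<tau> by (intro a) auto
          ultimately show "z r \<le> A1 * r powr - (1/2) + Y * exp (l * r)" by linarith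
        qed
      qed (use s \<tau> A1 Y0 in auto)
      then have "y s \<le> exp (- (l * s)) * (K * (6 * A1 + 4 * T powr (1/4) * l powr - (1/4) * exp (l * s) * Y))"
        unfolding y_def by (intro mult_left_mono) auto
      also have "\<dots> = exp (- (l * s)) * (6 * K * A1) + (K * (4 * T powr (1/4) * l powr - (1/4))) * Y"
        by (simp add: algebra_simps exp_minus)
      also have "\<dots> \<le> 1 * (6 * K * A1) + (1/2) * Y"
        using s l K A1 Y0 by (intro add_mono mult_right_mono) auto
      finally show ?thesis by simp
    qed
    have "Y \<le> 6 * K * A1 + Y / 2"
      unfolding Y_def by (rule cSup_least) (use ys Y0 K A1 in \<open>auto simp: Y_def[symmetric]\<close>)
    then have "Y \<le> 12 * K * A1" by simp
    then have "Y * exp (l * t) \<le> 12 * K * A1 * exp (l * T)"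
      using t \<tau> l Y0 K A1 by (intro mult_mono) auto
    then show ?thesis using zY[OF t] by (simp add: mult_ac)
  qed
  \<comment> \<open>At the first time at which \<open>z\<close> reaches \<open>\<rho>\<close> the inequality still applies, and it contradicts \<open>small\<close>.\<close>
  have below: "z s < \<rho>" if "s \<in> {0..T}" for s
  proof (rule ccontr)
    assume "\<not> z s < \<rho>"
    define B where "B = {s \<in> {0..T}. \<rho> \<le> z s}"
    have "closed B" unfolding B_def
      by (intro continuous_closed_preimage_constant continuous_on_closed_Collect_le z(1) continuous_on_const closed_atLeastAtMost)
    moreover have "bounded B"
      by (rule bounded_subset[OF bounded_closed_interval[of 0 T]]) (auto simp: B_def)
    ultimately have "compact B" by (simp add: compact_eq_bounded_closed)
    moreover have "B \<noteq> {}" using that \<open>\<not> z s < \<rho>\<close> by (auto simp: B_def)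
    ultimately obtain \<tau> where \<tau>: "\<tau> \<in> B" "\<forall>s\<in>B. \<tau> \<le> s" using compact_attains_inf by blast
    have \<tau>T: "\<tau> \<in> {0..T}" "\<rho> \<le> z \<tau>" using \<tau>(1) by (auto simp: B_def)
    have lt: "z s < \<rho>" if "s \<in> {0..<\<tau>}" for s
      using that \<tau>(2) \<tau>T unfolding B_def by force
    have "z 0 < \<rho>" using z0 small C0 by linarith
    then have "\<tau> \<noteq> 0" using \<tau>T(2) by auto
    have "z \<tau> \<le> \<rho>"
    proof (rule tendsto_upperbound)
      have "(z \<longlongrightarrow> z \<tau>) (at \<tau> within {0..T})" using z(1) \<tau>T(1) by (simp add: continuous_on_def)
      then show "(z \<longlongrightarrow> z \<tau>) (at \<tau> within {0..<\<tau>})" by (rule tendsto_within_subset) (use \<tau>T in auto)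
      show "\<forall>\<^sub>F s in at \<tau> within {0..<\<tau>}. z s \<le> \<rho>"
        using lt by (auto simp: eventually_at_filter less_imp_le intro!: always_eventually)
      show "at \<tau> within {0..<\<tau>} \<noteq> bot"
        using \<tau>T \<open>\<tau> \<noteq> 0\<close> by (simp add: at_within_eq_bot_iff trivial_limit_within)
    qed
    then have "\<forall>s\<in>{0..\<tau>}. z s \<le> \<rho>" using lt by (metis atLeastAtMost_iff atLeastLessThan_iff less_imp_le order_le_less)
    then have "z \<tau> \<le> a \<tau> + ?C" using \<tau>T by (intro main) auto
    also have "\<dots> < \<rho>" using a(2)[OF \<tau>T(1)] small by linarith
    finally show False using \<tau>T by simp
  qed
  show ?thesis using main[of T t] below t T by (auto simp: less_imp_le)
qed

section \<open>The nonlinearity and the smoothing of the heat semigroup\<close>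

text \<open>Coefficients of the right-hand sides of the vorticity and density equations, without the dissipation and
  the forcing.\<close>

definition vort_rhs :: "(real \<times> real \<Rightarrow> real) \<Rightarrow> (real \<times> real \<Rightarrow> real) \<Rightarrow> int \<times> int \<Rightarrow> complex" where
  "vort_rhs \<omega> \<rho> k = - fourier (jacobian \<omega> (inv_laplacian \<omega>)) k + fourier (dx \<rho>) k"

definition dens_rhs :: "real \<Rightarrow> (real \<times> real \<Rightarrow> real) \<Rightarrow> (real \<times> real \<Rightarrow> real) \<Rightarrow> int \<times> int \<Rightarrow> complex" where
  "dens_rhs N \<omega> \<rho> k = - fourier (jacobian \<rho> (inv_laplacian \<omega>)) k - of_real (N\<^sup>2) * fourier (inv_laplacian (dx \<omega>)) k"

text \<open>The Lipschitz constant of \<open>vort_rhs\<close> and \<open>dens_rhs\<close> on the ball of radius \<open>R\<close>. The factor \<open>c\<close> compares the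
  norm of the gradient with the norms weighted by the viscosities; the Jacobian, being quadratic,
  contributes the term with \<open>R\<close>, and the two linear terms contribute the others.\<close>

definition lip_const :: "real \<Rightarrow> real \<Rightarrow> real \<Rightarrow> real \<Rightarrow> real" where
  "lip_const \<nu> Pr N R = (let c = 1 / sqrt \<nu> + 1 / sqrt (\<nu> / Pr) in 4 * inv_eigval_bound * c\<^sup>2 * R + c + N\<^sup>2 * c)"

lemma V_spaceD: "(\<omega>, \<rho>) \<in> V_space \<Longrightarrow> \<omega> \<in> per0_H1 \<and> \<rho> \<in> per0_H1"
  by (simp add: V_space_def)

lemma V_nrm_nonneg: "0 \<le> V_nrm \<nu> Pr v"
  by (simp add: V_nrm_def half_nrm_nonneg)

lemma V_nrm_triangle:
  assumes "(\<omega>, \<rho>) \<in> V_space" "(\<omega>', \<rho>') \<in> V_space" "0 < \<nu>" "0 < Pr"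
  shows "V_nrm \<nu> Pr (\<omega>, \<rho>) \<le> V_nrm \<nu> Pr (\<omega>', \<rho>') + V_nrm \<nu> Pr (\<lambda>p. \<omega> p - \<omega>' p, \<lambda>p. \<rho> p - \<rho>' p)"
  using half_nrm_triangle[of \<omega> \<omega>' \<nu>] half_nrm_triangle[of \<rho> \<rho>' "\<nu> / Pr"] assms
  by (simp add: V_nrm_def V_space_def)

lemma half_nrm_1_le_V_nrm:
  assumes V: "(\<omega>, \<rho>) \<in> V_space" and \<nu>: "0 < \<nu>" "0 < Pr"
  shows "half_nrm 1 \<omega> \<le> (1 / sqrt \<nu> + 1 / sqrt (\<nu> / Pr)) * V_nrm \<nu> Pr (\<omega>, \<rho>)"
    and "half_nrm 1 \<rho> \<le> (1 / sqrt \<nu> + 1 / sqrt (\<nu> / Pr)) * V_nrm \<nu> Pr (\<omega>, \<rho>)"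
proof -
  have p: "0 \<le> 1 / sqrt \<nu>" "0 \<le> 1 / sqrt (\<nu> / Pr)" "0 < \<nu> / Pr" using \<nu> by auto
  note H = V_spaceD[OF V]
  have n: "0 \<le> half_nrm \<nu> \<omega>" "0 \<le> half_nrm (\<nu> / Pr) \<rho>" by (rule half_nrm_nonneg)+
  have "1 / sqrt \<nu> * half_nrm \<nu> \<omega> \<le> (1 / sqrt \<nu> + 1 / sqrt (\<nu> / Pr)) * (half_nrm \<nu> \<omega> + half_nrm (\<nu> / Pr) \<rho>)"
    using p n by (intro mult_mono) auto
  then show "half_nrm 1 \<omega> \<le> (1 / sqrt \<nu> + 1 / sqrt (\<nu> / Pr)) * V_nrm \<nu> Pr (\<omega>, \<rho>)"
    using half_nrm_1_le[of \<omega> \<nu>] H \<nu> by (simp add: V_nrm_def)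
  have "1 / sqrt (\<nu> / Pr) * half_nrm (\<nu> / Pr) \<rho> \<le> (1 / sqrt \<nu> + 1 / sqrt (\<nu> / Pr)) * (half_nrm \<nu> \<omega> + half_nrm (\<nu> / Pr) \<rho>)"
    using p n by (intro mult_mono) auto
  then show "half_nrm 1 \<rho> \<le> (1 / sqrt \<nu> + 1 / sqrt (\<nu> / Pr)) * V_nrm \<nu> Pr (\<omega>, \<rho>)"
    using half_nrm_1_le[of \<rho> "\<nu> / Pr"] H p(3) by (simp add: V_nrm_def)
qed

lemma ell2_le_dx_diff:
  assumes "\<rho> \<in> per0_H1" "\<rho>' \<in> per0_H1"
  shows "ell2_le (\<lambda>k. fourier (dx \<rho>) k - fourier (dx \<rho>') k) (half_nrm 1 (\<lambda>p. \<rho> p - \<rho>' p))"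
proof -
  have "fourier (dx \<rho>) k - fourier (dx \<rho>') k = 2 * of_real pi * \<i> * of_real (of_int (fst k)) * fourier (\<lambda>p. \<rho> p - \<rho>' p) k" for k
    using assms by (simp add: dx_per0_H1(2) fourier_diff_per0_L2 per0_L2_H1 right_diff_distrib)
  then show ?thesis
    using ell2_le_fourier_dx_dz(1)[OF half_nrm_ell2_le[OF per0_H1_diff[OF assms] zero_le_one]] by simp
qed

lemma ell2_le_inv_laplacian_dx_diff:
  assumes "\<omega> \<in> per0_H1" "\<omega>' \<in> per0_H1"
  shows "ell2_le (\<lambda>k. fourier (inv_laplacian (dx \<omega>)) k - fourier (inv_laplacian (dx \<omega>')) k) (half_nrm 1 (\<lambda>p. \<omega> p - \<omega>' p))"
proof (rule ell2_le_dominated[OF ell2_le_dx_diff[OF assms]])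
  fix k
  have eq: "fourier (inv_laplacian (dx \<omega>)) k - fourier (inv_laplacian (dx \<omega>')) k =
      - (fourier (dx \<omega>) k - fourier (dx \<omega>') k) / of_real (eigval 1 k)"
    using assms[THEN dx_per0_H1(1), THEN inv_laplacian_per0_L2(2), of k] by (simp add: diff_divide_distrib)
  show "cmod (fourier (inv_laplacian (dx \<omega>)) k - fourier (inv_laplacian (dx \<omega>')) k) \<le> cmod (fourier (dx \<omega>) k - fourier (dx \<omega>') k)"
  proof (cases "k = (0, 0)")
    case True
    then show ?thesis unfolding eq by simp
  next
    case False
    then have "1 \<le> eigval 1 k" by (rule eigval_1_ge_1)
    then have "cmod (fourier (dx \<omega>) k - fourier (dx \<omega>') k) * 1 \<le> cmod (fourier (dx \<omega>) k - fourier (dx \<omega>') k) * eigval 1 k"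
      by (intro mult_left_mono) auto
    then show ?thesis unfolding eq using \<open>1 \<le> eigval 1 k\<close>
      by (simp add: norm_divide norm_minus_commute divide_le_eq)
  qed
qed

lemma ell2_le_rhs_diff:
  assumes V: "(\<omega>, \<rho>) \<in> V_space" "(\<omega>', \<rho>') \<in> V_space" and \<nu>: "0 < \<nu>" "0 < Pr"
    and R: "V_nrm \<nu> Pr (\<omega>, \<rho>) \<le> R" "V_nrm \<nu> Pr (\<omega>', \<rho>') \<le> R"
    and d: "V_nrm \<nu> Pr (\<lambda>p. \<omega> p - \<omega>' p, \<lambda>p. \<rho> p - \<rho>' p) \<le> d"
  shows "ell2_le (\<lambda>k. vort_rhs \<omega> \<rho> k - vort_rhs \<omega>' \<rho>' k) (lip_const \<nu> Pr N R * d)"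
    and "ell2_le (\<lambda>k. dens_rhs N \<omega> \<rho> k - dens_rhs N \<omega>' \<rho>' k) (lip_const \<nu> Pr N R * d)"
proof -
  define c where "c = 1 / sqrt \<nu> + 1 / sqrt (\<nu> / Pr)"
  have c0: "0 \<le> c" using \<nu> by (simp add: c_def)
  note H = V_spaceD[OF V(1), THEN conjunct1] V_spaceD[OF V(1), THEN conjunct2]
    V_spaceD[OF V(2), THEN conjunct1] V_spaceD[OF V(2), THEN conjunct2]
  have Vd: "(\<lambda>p. \<omega> p - \<omega>' p, \<lambda>p. \<rho> p - \<rho>' p) \<in> V_space"
    using H by (simp add: V_space_def per0_H1_diff)
  have R0: "0 \<le> R" and d0: "0 \<le> d" using R(1) d V_nrm_nonneg order_trans by blast+
  have b: "half_nrm 1 \<omega> \<le> c * R" "half_nrm 1 \<omega>' \<le> c * R" "half_nrm 1 \<rho>' \<le> c * R"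
    using half_nrm_1_le_V_nrm[OF V(1) \<nu>] half_nrm_1_le_V_nrm[OF V(2) \<nu>]
      mult_left_mono[OF R(1) c0] mult_left_mono[OF R(2) c0] unfolding c_def[symmetric] by linarith+
  have e: "half_nrm 1 (\<lambda>p. \<omega> p - \<omega>' p) \<le> c * d" "half_nrm 1 (\<lambda>p. \<rho> p - \<rho>' p) \<le> c * d"
    using half_nrm_1_le_V_nrm[OF Vd \<nu>] mult_left_mono[OF d c0] unfolding c_def[symmetric] by linarith+
  note n = half_nrm_nonneg inv_eigval_bound(1) c0 R0 d0
  have bil: "2 * inv_eigval_bound * (x * y + z * w) \<le> 4 * inv_eigval_bound * c\<^sup>2 * R * d"
    if "x \<le> c * d" "y \<le> c * R" "z \<le> c * R" "w \<le> c * d" "0 \<le> x" "0 \<le> y" "0 \<le> z" "0 \<le> w" for x y z w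
  proof -
    have "x * y + z * w \<le> (c * d) * (c * R) + (c * R) * (c * d)"
      using that n by (intro add_mono mult_mono) auto
    then have "2 * inv_eigval_bound * (x * y + z * w) \<le> 2 * inv_eigval_bound * ((c * d) * (c * R) + (c * R) * (c * d))"
      using n by (intro mult_left_mono) auto
    then show ?thesis by (simp add: power2_eq_square algebra_simps)
  qed
  have J1: "ell2_le (\<lambda>k. fourier (jacobian \<omega> (inv_laplacian \<omega>)) k - fourier (jacobian \<omega>' (inv_laplacian \<omega>')) k)
      (4 * inv_eigval_bound * c\<^sup>2 * R * d)"
    by (rule ell2_le_mono[OF ell2_le_jacobian_diff[OF H(1,3,1,3)]]) (intro bil b e n(1))
  have J2: "ell2_le (\<lambda>k. fourier (jacobian \<rho> (inv_laplacian \<omega>)) k - fourier (jacobian \<rho>' (inv_laplacian \<omega>')) k)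
      (4 * inv_eigval_bound * c\<^sup>2 * R * d)"
    by (rule ell2_le_mono[OF ell2_le_jacobian_diff[OF H(2,4,1,3)]]) (intro bil b e n(1))
  have lip: "lip_const \<nu> Pr N R * d = 4 * inv_eigval_bound * c\<^sup>2 * R * d + c * d + N\<^sup>2 * (c * d)"
    by (simp add: lip_const_def c_def[symmetric] Let_def algebra_simps)
  have "ell2_le (\<lambda>k. - (fourier (jacobian \<omega> (inv_laplacian \<omega>)) k - fourier (jacobian \<omega>' (inv_laplacian \<omega>')) k) +
      (fourier (dx \<rho>) k - fourier (dx \<rho>') k)) (4 * inv_eigval_bound * c\<^sup>2 * R * d + c * d)"
    by (intro ell2_le_add ell2_le_minus J1 ell2_le_mono[OF ell2_le_dx_diff[OF H(2,4)] e(2)])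
  then have "ell2_le (\<lambda>k. vort_rhs \<omega> \<rho> k - vort_rhs \<omega>' \<rho>' k) (4 * inv_eigval_bound * c\<^sup>2 * R * d + c * d)"
    by (simp add: vort_rhs_def algebra_simps)
  then show "ell2_le (\<lambda>k. vort_rhs \<omega> \<rho> k - vort_rhs \<omega>' \<rho>' k) (lip_const \<nu> Pr N R * d)"
    by (rule ell2_le_mono) (use n in \<open>simp add: lip\<close>)
  have "ell2_le (\<lambda>k. - (fourier (jacobian \<rho> (inv_laplacian \<omega>)) k - fourier (jacobian \<rho>' (inv_laplacian \<omega>')) k) -
      of_real (N\<^sup>2) * (fourier (inv_laplacian (dx \<omega>)) k - fourier (inv_laplacian (dx \<omega>')) k))
      (4 * inv_eigval_bound * c\<^sup>2 * R * d + cmod (of_real (N\<^sup>2)) * (c * d))"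
    by (intro ell2_le_diff ell2_le_minus J2 ell2_le_scale ell2_le_mono[OF ell2_le_inv_laplacian_dx_diff[OF H(1,3)] e(1)])
  then have "ell2_le (\<lambda>k. dens_rhs N \<omega> \<rho> k - dens_rhs N \<omega>' \<rho>' k) (4 * inv_eigval_bound * c\<^sup>2 * R * d + cmod (of_real (N\<^sup>2)) * (c * d))"
    by (simp add: dens_rhs_def algebra_simps)
  then show "ell2_le (\<lambda>k. dens_rhs N \<omega> \<rho> k - dens_rhs N \<omega>' \<rho>' k) (lip_const \<nu> Pr N R * d)"
    by (rule ell2_le_mono) (use n in \<open>simp add: lip norm_power\<close>)
qed

lemma lip_const_nonneg: "0 \<le> R \<Longrightarrow> 0 < \<nu> \<Longrightarrow> 0 < Pr \<Longrightarrow> 0 \<le> lip_const \<nu> Pr N R"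
  unfolding lip_const_def Let_def using inv_eigval_bound(1) by simp

lemma ell2_le_component: "ell2_le c b \<Longrightarrow> cmod (c k) \<le> b"
  using ell2_leD[of c b "{k}"] by simp

lemma mild_solution_V_space:
  "mild_solution \<nu> Pr N \<epsilon> F I v \<omega> \<rho> \<Longrightarrow> t \<in> I \<Longrightarrow> (\<omega> t, \<rho> t) \<in> V_space"
  unfolding mild_solution_def by blast

lemma mild_solution_tendsto:
  "mild_solution \<nu> Pr N \<epsilon> F I v \<omega> \<rho> \<Longrightarrow> t \<in> I \<Longrightarrow>
    ((\<lambda>s. V_nrm \<nu> Pr (\<lambda>p. \<omega> s p - \<omega> t p, \<lambda>p. \<rho> s p - \<rho> t p)) \<longlongrightarrow> 0) (at t within I)"
  unfolding mild_solution_def by blast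

lemma mild_solution_vort:
  "mild_solution \<nu> Pr N 1 F I v \<omega> \<rho> \<Longrightarrow> t \<in> I \<Longrightarrow>
    fourier (\<omega> t) k = heat \<nu> t (fourier (fst v)) k +
      hat_integral 0 t (\<lambda>s. heat \<nu> (t - s) (\<lambda>j. vort_rhs (\<omega> s) (\<rho> s) j + F s j)) k"
  unfolding mild_solution_def vort_rhs_def of_real_1 mult_1_left by blast

lemma mild_solution_dens:
  "mild_solution \<nu> Pr N 1 F I v \<omega> \<rho> \<Longrightarrow> t \<in> I \<Longrightarrow>
    fourier (\<rho> t) k = heat (\<nu> / Pr) t (fourier (snd v)) k +
      hat_integral 0 t (\<lambda>s. heat (\<nu> / Pr) (t - s) (dens_rhs N (\<omega> s) (\<rho> s))) k"
  unfolding mild_solution_def dens_rhs_def[abs_def] of_real_1 mult_1_left by blast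

text \<open>A mild solution is a continuous curve in \<open>V\<close>, on whose bounded sets the right-hand side is Lipschitz
  continuous. Continuity makes its coefficients integrable in time, so the variation-of-constants integrals
  of two solutions may be subtracted under the integral sign.\<close>

lemma mild_solution_continuous_rhs:
  assumes m: "mild_solution \<nu> Pr N \<epsilon> F I v \<omega> \<rho>" and \<nu>: "0 < \<nu>" "0 < Pr"
  shows "continuous_on I (\<lambda>s. vort_rhs (\<omega> s) (\<rho> s) k)" and "continuous_on I (\<lambda>s. dens_rhs N (\<omega> s) (\<rho> s) k)"
proof -
  have "((\<lambda>s. vort_rhs (\<omega> s) (\<rho> s) k) \<longlongrightarrow> vort_rhs (\<omega> t) (\<rho> t) k) (at t within I) \<and>
      ((\<lambda>s. dens_rhs N (\<omega> s) (\<rho> s) k) \<longlongrightarrow> dens_rhs N (\<omega> t) (\<rho> t) k) (at t within I)" if t: "t \<in> I" for t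
  proof -
    define d where "d s = V_nrm \<nu> Pr (\<lambda>p. \<omega> s p - \<omega> t p, \<lambda>p. \<rho> s p - \<rho> t p)" for s
    define r where "r = V_nrm \<nu> Pr (\<omega> t, \<rho> t)"
    have d0: "0 \<le> d s" for s by (simp add: d_def V_nrm_nonneg)
    have d: "(d \<longlongrightarrow> 0) (at t within I)" unfolding d_def by (rule mild_solution_tendsto[OF m t])
    have "((\<lambda>s. lip_const \<nu> Pr N (r + d s) * d s) \<longlongrightarrow> lip_const \<nu> Pr N (r + 0) * 0) (at t within I)"
      unfolding lip_const_def Let_def by (intro tendsto_intros d)
    then have lim: "((\<lambda>s. lip_const \<nu> Pr N (r + d s) * d s) \<longlongrightarrow> 0) (at t within I)" by simp
    have bd: "cmod (vort_rhs (\<omega> s) (\<rho> s) k - vort_rhs (\<omega> t) (\<rho> t) k) \<le> lip_const \<nu> Pr N (r + d s) * d s \<and>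
        cmod (dens_rhs N (\<omega> s) (\<rho> s) k - dens_rhs N (\<omega> t) (\<rho> t) k) \<le> lip_const \<nu> Pr N (r + d s) * d s" if s: "s \<in> I" for s
    proof -
      note V = mild_solution_V_space[OF m s] mild_solution_V_space[OF m t]
      have R: "V_nrm \<nu> Pr (\<omega> s, \<rho> s) \<le> r + d s" "V_nrm \<nu> Pr (\<omega> t, \<rho> t) \<le> r + d s"
        using V_nrm_triangle[OF V \<nu>] d0[of s] by (auto simp: r_def d_def)
      note e = ell2_le_rhs_diff[OF V \<nu> R order.refl, where N=N, folded d_def]
      show ?thesis using ell2_le_component[OF e(1), of k] ell2_le_component[OF e(2), of k] by blast
    qed
    have ev: "\<forall>\<^sub>F s in at t within I. s \<in> I" by (simp add: eventually_at_filter)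
    show ?thesis
      using Lim_null_comparison[OF _ lim, of "\<lambda>s. vort_rhs (\<omega> s) (\<rho> s) k - vort_rhs (\<omega> t) (\<rho> t) k"]
        Lim_null_comparison[OF _ lim, of "\<lambda>s. dens_rhs N (\<omega> s) (\<rho> s) k - dens_rhs N (\<omega> t) (\<rho> t) k"]
        eventually_mono[OF ev bd]
      by (auto simp: LIM_zero_iff eventually_conj_iff)
  qed
  then show "continuous_on I (\<lambda>s. vort_rhs (\<omega> s) (\<rho> s) k)" "continuous_on I (\<lambda>s. dens_rhs N (\<omega> s) (\<rho> s) k)"
    by (simp_all add: continuous_on_def)
qed

lemma frac_pow_hat_integral:
  "frac_pow \<kappa> \<alpha> (hat_integral a b c) = hat_integral a b (\<lambda>s. frac_pow \<kappa> \<alpha> (c s))"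
  by (simp add: frac_pow_def hat_integral_def fun_eq_iff)

lemma frac_pow_heat_half_le:
  assumes "0 \<le> \<kappa>" "0 < r" "ell2_le c b"
  shows "ell2_le (frac_pow \<kappa> (1/2) (heat \<kappa> r c)) (r powr - (1/2) * b)"
proof -
  have "ell2_le (\<lambda>k. of_real (r powr - (1/2)) * c k) (cmod (of_real (r powr - (1/2))) * b)"
    by (rule ell2_le_scale[OF assms(3)])
  then have "ell2_le (\<lambda>k. of_real (r powr - (1/2)) * c k) (r powr - (1/2) * b)" by simp
  then show ?thesis
  proof (rule ell2_le_dominated)
    fix k
    have e: "0 \<le> eigval \<kappa> k" using assms(1) eigval_nonneg[of k] by (simp add: eigval_scale[of \<kappa>])
    have "cmod (frac_pow \<kappa> (1/2) (heat \<kappa> r c) k) = (sqrt (eigval \<kappa> k) * exp (- (r * eigval \<kappa> k))) * cmod (c k)"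
      using e by (simp add: frac_pow_def heat_def norm_mult powr_half_sqrt)
    also have "\<dots> \<le> r powr - (1/2) * cmod (c k)"
      using sqrt_exp_le[OF e assms(2)] by (intro mult_right_mono) auto
    finally show "cmod (frac_pow \<kappa> (1/2) (heat \<kappa> r c) k) \<le> cmod (of_real (r powr - (1/2)) * c k)"
      by (simp add: norm_mult)
  qed
qed

text \<open>Of \<open>s\<close> and \<open>t - s\<close> at least one is \<open>\<ge> t / 2\<close>. In this way the beta integral is bounded through
  integrals of pure powers.\<close>

lemma beta_kernel_le:
  fixes s t :: real
  assumes "0 < s" "s < t"
  shows "(t - s) powr - (1/2) * s powr - (1/2) \<le> (t / 2) powr - (1/2) * (s powr - (1/2) + (t - s) powr - (1/2))"
proof (cases "s \<le> t / 2")
  case True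
  then have "(t - s) powr - (1/2) \<le> (t / 2) powr - (1/2)" using assms by (intro powr_mono2') auto
  then have "(t - s) powr - (1/2) * s powr - (1/2) \<le> (t / 2) powr - (1/2) * s powr - (1/2)"
    by (intro mult_right_mono) auto
  then show ?thesis by (simp add: distrib_left add_increasing2)
next
  case False
  then have "s powr - (1/2) \<le> (t / 2) powr - (1/2)" using assms by (intro powr_mono2') auto
  then have "(t - s) powr - (1/2) * s powr - (1/2) \<le> (t - s) powr - (1/2) * (t / 2) powr - (1/2)"
    by (intro mult_left_mono) auto
  then show ?thesis by (simp add: distrib_left add_increasing mult.commute)
qed

lemma AE_interior: "AE s in lebesgue. s \<in> {0..t} \<longrightarrow> s \<in> {0<..<t :: real}"
proof (rule AE_I'[of "{0, t}"])
  show "{0, t} \<in> null_sets lebesgue" by (simp add: negligible_iff_null_sets[symmetric])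
qed auto

text \<open>The heat semigroup gains the half power of \<open>A\<close> at the price of the kernel \<open>(t - s)\<^sup>-\<^sup>1\<^sup>/\<^sup>2\<close>. Against \<open>s\<^sup>-\<^sup>1\<^sup>/\<^sup>2\<close> the
  kernel has a beta integral, bounded independently of \<open>t\<close>; against the exponential it yields the factor
  \<open>l\<^sup>-\<^sup>1\<^sup>/\<^sup>4\<close>, which is small for large \<open>l\<close>.\<close>

lemma ell2_le_smoothed_integral:
  assumes \<kappa>: "0 \<le> \<kappa>" and t: "0 \<le> t" "t \<le> T" and B: "0 \<le> B" "0 \<le> A" "0 \<le> Y" "0 < l"
    and c: "\<And>s. s \<in> {0<..<t} \<Longrightarrow> ell2_le (c s) (B * (A * s powr - (1/2) + Y * exp (l * s)))"
  shows "ell2_le (frac_pow \<kappa> (1/2) (hat_integral 0 t (\<lambda>s. heat \<kappa> (t - s) (c s))))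
     (B * (6 * A + 4 * T powr (1/4) * l powr - (1/4) * exp (l * t) * Y))"
proof -
  define a1 a2 where "a1 = B * (A * (t / 2) powr - (1/2))" and "a2 = B * (Y * (exp (l * t) * l powr - (1/4)))"
  have a0: "0 \<le> a1" "0 \<le> a2" using B by (simp_all add: a1_def a2_def)
  define h where "h s = a1 * s powr - (1/2) + a1 * (t - s) powr - (1/2) + a2 * (t - s) powr - (3/4)" for s
  note I1 = powr_integral[OF t(1), of "1/2"] and I2 = powr_integral[OF t(1), of "3/4"]
  have i: "set_integrable lebesgue {0..t} (\<lambda>s. a1 * s powr - (1/2))" "set_integrable lebesgue {0..t} (\<lambda>s. a1 * (t - s) powr - (1/2))"
    "set_integrable lebesgue {0..t} (\<lambda>s. a2 * (t - s) powr - (3/4))"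
    using I1 I2 by (auto intro!: set_integrable_mult_right)
  have hi: "set_integrable lebesgue {0..t} h" unfolding h_def by (intro set_integral_add i)
  have "AE s in lebesgue. s \<in> {0..t} \<longrightarrow> ell2_le (frac_pow \<kappa> (1/2) (heat \<kappa> (t - s) (c s))) (h s)"
    using AE_interior[of t]
  proof eventually_elim
    case (elim s)
    show ?case
    proof
      assume "s \<in> {0..t}"
      then have s: "0 < s" "s < t" using elim by auto
      have "ell2_le (frac_pow \<kappa> (1/2) (heat \<kappa> (t - s) (c s))) ((t - s) powr - (1/2) * (B * (A * s powr - (1/2) + Y * exp (l * s))))"
        using s by (intro frac_pow_heat_half_le \<kappa> c) auto
      moreover have "(t - s) powr - (1/2) * (B * (A * s powr - (1/2) + Y * exp (l * s))) \<le> h s"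
      proof -
        have 1: "B * (A * ((t - s) powr - (1/2) * s powr - (1/2))) \<le> B * (A * ((t / 2) powr - (1/2) * (s powr - (1/2) + (t - s) powr - (1/2))))"
          using B s by (intro mult_left_mono beta_kernel_le) auto
        have "(t - s) powr - (1/2) * exp (l * s) = exp (l * t) * ((t - s) powr - (1/2) * exp (- (l * (t - s))))"
          by (simp add: exp_minus exp_diff right_diff_distrib field_simps)
        also have "\<dots> \<le> exp (l * t) * ((t - s) powr - (1/2) * (l powr - (1/4) * (t - s) powr - (1/4)))"
          using s B by (intro mult_left_mono powr_quarter_exp_le) auto
        also have "\<dots> = exp (l * t) * l powr - (1/4) * (t - s) powr - (3/4)"
          by (simp add: powr_add[symmetric])
        finally have "B * (Y * ((t - s) powr - (1/2) * exp (l * s))) \<le> B * (Y * (exp (l * t) * l powr - (1/4) * (t - s) powr - (3/4)))"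
          using B by (intro mult_left_mono) auto
        with 1 show ?thesis by (simp add: h_def a1_def a2_def algebra_simps)
      qed
      ultimately show "ell2_le (frac_pow \<kappa> (1/2) (heat \<kappa> (t - s) (c s))) (h s)" by (rule ell2_le_mono)
    qed
  qed
  then have "ell2_le (frac_pow \<kappa> (1/2) (hat_integral 0 t (\<lambda>s. heat \<kappa> (t - s) (c s)))) (LINT s:{0..t}|lebesgue. h s)"
    unfolding frac_pow_hat_integral by (rule ell2_le_hat_integral[OF hi])
  moreover have "(LINT s:{0..t}|lebesgue. h s) \<le> B * (6 * A + 4 * T powr (1/4) * l powr - (1/4) * exp (l * t) * Y)"
  proof -
    have "(LINT s:{0..t}|lebesgue. h s) = a1 * (2 * t powr (1/2)) + a1 * (2 * t powr (1/2)) + a2 * (4 * t powr (1/4))"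
      unfolding h_def using I1 I2 i by (simp add: set_integral_add)
    also have "a2 * (4 * t powr (1/4)) \<le> a2 * (4 * T powr (1/4))"
      using a0 t by (intro mult_left_mono powr_mono2) auto
    also have "a1 * (2 * t powr (1/2)) + a1 * (2 * t powr (1/2)) \<le> B * (6 * A)"
    proof (cases "t = 0")
      case False
      then have "(t / 2) powr - (1/2) * t powr (1/2) = 2 powr (1/2)"
        using t by (simp add: powr_divide powr_minus field_simps)
      then have "a1 * (2 * t powr (1/2)) + a1 * (2 * t powr (1/2)) = (B * A) * (4 * sqrt 2)"
        unfolding a1_def by (simp add: powr_half_sqrt algebra_simps)
      moreover have s2: "4 * sqrt 2 \<le> (6 :: real)"
      proof -
        have "sqrt 2 \<le> (3/2 :: real)" by (rule real_le_lsqrt) (simp_all add: power2_eq_square)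
        then show ?thesis by simp
      qed
      moreover have "(B * A) * (4 * sqrt 2) \<le> (B * A) * 6" using B s2 by (intro mult_left_mono) auto
      moreover have "(B * A) * 6 = B * (6 * A)" by simp
      ultimately show ?thesis by linarith
    qed (use B in simp)
    finally show ?thesis by (simp add: a2_def algebra_simps)
  qed
  ultimately show ?thesis by (rule ell2_le_mono)
qed

section \<open>Stability of mild solutions\<close>

lemma hat_integral_add:
  assumes "\<And>k. set_integrable lebesgue {a..b} (\<lambda>s. c s k)" "\<And>k. set_integrable lebesgue {a..b} (\<lambda>s. d s k)"
  shows "hat_integral a b (\<lambda>s k. c s k + d s k) k = hat_integral a b c k + hat_integral a b d k"
  unfolding hat_integral_def by (rule set_integral_add(2)[OF assms])

lemma hat_integral_diff:
  assumes "\<And>k. set_integrable lebesgue {a..b} (\<lambda>s. c s k)" "\<And>k. set_integrable lebesgue {a..b} (\<lambda>s. d s k)"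
  shows "hat_integral a b (\<lambda>s k. c s k - d s k) k = hat_integral a b c k - hat_integral a b d k"
  unfolding hat_integral_def by (rule set_integral_diff(2)[OF assms])

lemma set_integrable_heat:
  assumes c: "set_integrable lebesgue {0..t} (\<lambda>s. c s k)" and \<kappa>: "0 \<le> \<kappa>"
  shows "set_integrable lebesgue {0..t} (\<lambda>s. heat \<kappa> (t - s) (c s) k)"
  unfolding set_integrable_def
proof (rule Bochner_Integration.integrable_bound)
  let ?f = "\<lambda>s. indicator {0..t} s *\<^sub>R c s k"
  show i: "integrable lebesgue ?f" using c by (simp add: set_integrable_def)
  have e: "0 \<le> eigval \<kappa> k" using \<kappa> eigval_nonneg[of k] by (simp add: eigval_scale[of \<kappa>])
  have eq: "indicator {0..t} s *\<^sub>R heat \<kappa> (t - s) (c s) k = of_real (exp (- ((t - s) * eigval \<kappa> k))) * ?f s" for s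
    by (simp add: heat_def)
  have "(\<lambda>s. complex_of_real (exp (- ((t - s) * eigval \<kappa> k)))) \<in> borel_measurable lebesgue"
    by (intro measurable_completion borel_measurable_continuous_onI[unfolded measurable_lborel1[symmetric]])
       (auto intro!: borel_measurable_continuous_onI continuous_intros)
  then show "(\<lambda>s. indicator {0..t} s *\<^sub>R heat \<kappa> (t - s) (c s) k) \<in> borel_measurable lebesgue"
    unfolding eq using borel_measurable_integrable[OF i] by (rule borel_measurable_times)
  show "AE s in lebesgue. norm (indicator {0..t} s *\<^sub>R heat \<kappa> (t - s) (c s) k) \<le> norm (?f s)"
    unfolding eq using e by (intro AE_I2) (auto simp: indicator_def norm_mult mult_left_le_one_le)
qed

lemma set_integrable_subinterval:
  fixes f :: "real \<Rightarrow> complex"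
  shows "set_integrable lebesgue {0..T} f \<Longrightarrow> t \<in> {0..T} \<Longrightarrow> set_integrable lebesgue {0..t :: real} f"
  by (rule set_integrable_subset) auto

lemma heat_diff: "heat \<kappa> r (\<lambda>j. c j - d j) k = heat \<kappa> r c k - heat \<kappa> r d k"
  by (simp add: heat_def right_diff_distrib)

lemma heat_add: "heat \<kappa> r (\<lambda>j. c j + d j) k = heat \<kappa> r c k + heat \<kappa> r d k"
  by (simp add: heat_def distrib_left)

lemma frac_pow_add: "frac_pow \<kappa> \<alpha> (\<lambda>k. c k + d k) = (\<lambda>k. frac_pow \<kappa> \<alpha> c k + frac_pow \<kappa> \<alpha> d k)"
  by (simp add: frac_pow_def fun_eq_iff distrib_left)

lemma half_nrm_diff_le:
  assumes "f \<in> per0_H1" "g \<in> per0_H1" "0 \<le> \<kappa>"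
  shows "half_nrm \<kappa> (\<lambda>p. f p - g p) \<le> half_nrm \<kappa> f + half_nrm \<kappa> g"
proof -
  have "ell2_le (\<lambda>k. frac_pow \<kappa> (1/2) (fourier f) k - frac_pow \<kappa> (1/2) (fourier g) k) (half_nrm \<kappa> f + half_nrm \<kappa> g)"
    using assms by (intro ell2_le_diff half_nrm_ell2_le)
  moreover have "(\<lambda>k. frac_pow \<kappa> (1/2) (fourier f) k - frac_pow \<kappa> (1/2) (fourier g) k) = frac_pow \<kappa> (1/2) (fourier (\<lambda>p. f p - g p))"
    using assms by (simp add: frac_pow_def fourier_diff_per0_L2 per0_L2_H1 right_diff_distrib fun_eq_iff)
  ultimately show ?thesis using assms by (simp add: half_nrm_le_iff per0_H1_diff)
qed

lemma V_nrm_continuous_on: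
  assumes V: "\<And>t. t \<in> I \<Longrightarrow> (\<omega> t, \<rho> t) \<in> V_space" and \<nu>: "0 < \<nu>" "0 < Pr"
    and lim: "\<And>t. t \<in> I \<Longrightarrow>
      ((\<lambda>s. V_nrm \<nu> Pr (\<lambda>p. \<omega> s p - \<omega> t p, \<lambda>p. \<rho> s p - \<rho> t p)) \<longlongrightarrow> 0) (at t within I)"
  shows "continuous_on I (\<lambda>t. V_nrm \<nu> Pr (\<omega> t, \<rho> t))"
  unfolding continuous_on_def
proof
  fix t assume t: "t \<in> I"
  have ev: "\<forall>\<^sub>F s in at t within I. s \<in> I" by (simp add: eventually_at_filter)
  have bd: "norm (V_nrm \<nu> Pr (\<omega> s, \<rho> s) - V_nrm \<nu> Pr (\<omega> t, \<rho> t)) \<le> V_nrm \<nu> Pr (\<lambda>p. \<omega> s p - \<omega> t p, \<lambda>p. \<rho> s p - \<rho> t p)"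
    if s: "s \<in> I" for s
  proof -
    have "V_nrm \<nu> Pr (\<lambda>p. \<omega> t p - \<omega> s p, \<lambda>p. \<rho> t p - \<rho> s p) = V_nrm \<nu> Pr (\<lambda>p. \<omega> s p - \<omega> t p, \<lambda>p. \<rho> s p - \<rho> t p)"
      by (simp add: V_nrm_def half_nrm_diff_commute[of _ "\<omega> t"] half_nrm_diff_commute[of _ "\<rho> t"])
    then show ?thesis
      using V_nrm_triangle[OF V[OF s] V[OF t] \<nu>] V_nrm_triangle[OF V[OF t] V[OF s] \<nu>] unfolding real_norm_def by linarith
  qed
  have "((\<lambda>s. V_nrm \<nu> Pr (\<omega> s, \<rho> s) - V_nrm \<nu> Pr (\<omega> t, \<rho> t)) \<longlongrightarrow> 0) (at t within I)"
    by (rule Lim_null_comparison[OF eventually_mono[OF ev bd] lim[OF t]])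
  then show "((\<lambda>t. V_nrm \<nu> Pr (\<omega> t, \<rho> t)) \<longlongrightarrow> V_nrm \<nu> Pr (\<omega> t, \<rho> t)) (at t within I)" by (rule LIM_zero_cancel)
qed

text \<open>A stability estimate that does not ask the inhomogeneous part \<open>a + b\<close> of the difference of two solutions
  to be small near \<open>t = 0\<close>: it only has to stay below the level \<open>\<rho>0\<close> and to be dominated by a small multiple
  \<open>A1\<close> of \<open>t\<close> to the power \<open>-1/2\<close>. This is what the heat semigroup makes of data whose difference is small in \<open>L\<^sup>2\<close>
  but only bounded in \<open>V\<close>. The level \<open>\<rho>0\<close> keeps the first solution, about which no bound is assumed, within
  the distance \<open>\<rho>0\<close> of the second one, and thereby in the ball on which the Lipschitz constant is taken.\<close>

definition stability_const :: "real \<Rightarrow> real \<Rightarrow> real \<Rightarrow> real \<Rightarrow> real \<Rightarrow> real \<Rightarrow> real \<Rightarrow> bool" where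
  "stability_const \<nu> Pr N T R \<rho>0 C \<longleftrightarrow> (\<forall>F F' v v' \<omega> \<rho> \<omega>' \<rho>' a b A0 A1.
    mild_solution \<nu> Pr N 1 F {0..T} v \<omega> \<rho> \<longrightarrow> mild_solution \<nu> Pr N 1 F' {0..T} v' \<omega>' \<rho>' \<longrightarrow>
    (\<forall>k. set_integrable lebesgue {0..T} (\<lambda>s. F s k)) \<longrightarrow> (\<forall>k. set_integrable lebesgue {0..T} (\<lambda>s. F' s k)) \<longrightarrow>
    (\<forall>t\<in>{0..T}. V_nrm \<nu> Pr (\<omega>' t, \<rho>' t) \<le> R) \<longrightarrow>
    (\<forall>t\<in>{0..T}. ell2_le (frac_pow \<nu> (1/2) (\<lambda>k. heat \<nu> t (\<lambda>j. fourier (fst v) j - fourier (fst v') j) k +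
       hat_integral 0 t (\<lambda>s. heat \<nu> (t - s) (\<lambda>j. F s j - F' s j)) k)) (a t)) \<longrightarrow>
    (\<forall>t\<in>{0..T}. ell2_le (frac_pow (\<nu> / Pr) (1/2) (heat (\<nu> / Pr) t (\<lambda>j. fourier (snd v) j - fourier (snd v') j))) (b t)) \<longrightarrow>
    (\<forall>t\<in>{0..T}. a t + b t \<le> A0) \<longrightarrow> (\<forall>t\<in>{0<..T}. a t + b t \<le> A1 * t powr - (1/2)) \<longrightarrow> 0 \<le> A1 \<longrightarrow>
    A0 + C * A1 < \<rho>0 \<longrightarrow>
    (\<forall>t\<in>{0..T}. V_nrm \<nu> Pr (\<lambda>p. \<omega> t p - \<omega>' t p, \<lambda>p. \<rho> t p - \<rho>' t p) \<le> a t + b t + C * A1))"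

text \<open>The two variation-of-constants formulas are subtracted, and the difference of the nonlinear terms is
  estimated by the Lipschitz constant on the ball of radius \<open>R + \<rho>0\<close>. This is what the
  singular Gronwall inequality starts from.\<close>

lemma mild_solution_stability:
  assumes \<nu>: "0 < \<nu>" "0 < Pr" and T: "0 \<le> T" and R: "0 \<le> R" "0 \<le> \<rho>0"
  shows "\<exists>C\<ge>0. stability_const \<nu> Pr N T R \<rho>0 C"
proof -
  define L where "L = lip_const \<nu> Pr N (R + \<rho>0)"
  have L0: "0 \<le> L" unfolding L_def using R \<nu> by (intro lip_const_nonneg) auto
  define K where "K = 2 * L"
  have K0: "0 \<le> K" using L0 by (simp add: K_def)
  \<comment> \<open>The weight is chosen so that the contraction factor in the Gronwall argument is at most one half.\<close>
  have "((\<lambda>l. K * (4 * T powr (1/4) * l powr - (1/4))) \<longlongrightarrow> K * (4 * T powr (1/4) * 0)) at_top"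
    by (intro tendsto_intros tendsto_neg_powr filterlim_ident) simp
  then have "\<forall>\<^sub>F l in at_top. K * (4 * T powr (1/4) * l powr - (1/4)) < 1/2 \<and> 0 < l"
    by (intro eventually_conj order_tendstoD eventually_gt_at_top) auto
  then obtain l where l: "0 < l" "K * (4 * T powr (1/4) * l powr - (1/4)) \<le> 1/2"
    by (auto simp: eventually_at_top_linorder dest: less_imp_le)
  define C where "C = 12 * K * exp (l * T)"
  show ?thesis
    unfolding stability_const_def
  proof (intro exI[of _ C] conjI allI impI)
    show "0 \<le> C" using K0 by (simp add: C_def)
    fix F F' v v' \<omega> \<rho> \<omega>' \<rho>' a b A0 A1
    assume m: "mild_solution \<nu> Pr N 1 F {0..T} v \<omega> \<rho>" and m': "mild_solution \<nu> Pr N 1 F' {0..T} v' \<omega>' \<rho>'"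
      and F: "\<forall>k. set_integrable lebesgue {0..T} (\<lambda>s. F s k)" and F': "\<forall>k. set_integrable lebesgue {0..T} (\<lambda>s. F' s k)"
      and bR: "\<forall>t\<in>{0..T}. V_nrm \<nu> Pr (\<omega>' t, \<rho>' t) \<le> R"
      and a: "\<forall>t\<in>{0..T}. ell2_le (frac_pow \<nu> (1/2) (\<lambda>k. heat \<nu> t (\<lambda>j. fourier (fst v) j - fourier (fst v') j) k +
       hat_integral 0 t (\<lambda>s. heat \<nu> (t - s) (\<lambda>j. F s j - F' s j)) k)) (a t)"
      and b: "\<forall>t\<in>{0..T}. ell2_le (frac_pow (\<nu> / Pr) (1/2) (heat (\<nu> / Pr) t (\<lambda>j. fourier (snd v) j - fourier (snd v') j))) (b t)"
      and A0: "\<forall>t\<in>{0..T}. a t + b t \<le> A0" and A1: "\<forall>t\<in>{0<..T}. a t + b t \<le> A1 * t powr - (1/2)" "0 \<le> A1"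
      and small: "A0 + C * A1 < \<rho>0"
    define z where "z t = V_nrm \<nu> Pr (\<lambda>p. \<omega> t p - \<omega>' t p, \<lambda>p. \<rho> t p - \<rho>' t p)" for t
    note V = mild_solution_V_space[OF m] and V' = mild_solution_V_space[OF m']
    have z0: "0 \<le> z t" for t by (simp add: z_def V_nrm_nonneg)
    have kp: "0 \<le> \<nu>" "0 \<le> \<nu> / Pr" using \<nu> by auto
    have Hd: "(\<lambda>p. \<omega> t p - \<omega>' t p) \<in> per0_H1" "(\<lambda>p. \<rho> t p - \<rho>' t p) \<in> per0_H1" if "t \<in> {0..T}" for t
      using V_spaceD[OF V[OF that]] V_spaceD[OF V'[OF that]] by (auto intro: per0_H1_diff)
    have Vd: "(\<lambda>p. \<omega> t p - \<omega>' t p, \<lambda>p. \<rho> t p - \<rho>' t p) \<in> V_space" if "t \<in> {0..T}" for t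
      using Hd[OF that] by (simp add: V_space_def)
    have Nint: "set_integrable lebesgue {0..t} (\<lambda>s. vort_rhs (\<omega> s) (\<rho> s) k)" "set_integrable lebesgue {0..t} (\<lambda>s. dens_rhs N (\<omega> s) (\<rho> s) k)"
      "set_integrable lebesgue {0..t} (\<lambda>s. vort_rhs (\<omega>' s) (\<rho>' s) k)" "set_integrable lebesgue {0..t} (\<lambda>s. dens_rhs N (\<omega>' s) (\<rho>' s) k)"
      if "t \<in> {0..T}" for t k
    proof -
      have "{0..t} \<subseteq> {0..T}" using that by auto
      note c = mild_solution_continuous_rhs[OF m \<nu>, THEN continuous_on_subset, OF this]
        mild_solution_continuous_rhs[OF m' \<nu>, THEN continuous_on_subset, OF this]
      show "set_integrable lebesgue {0..t} (\<lambda>s. vort_rhs (\<omega> s) (\<rho> s) k)" "set_integrable lebesgue {0..t} (\<lambda>s. dens_rhs N (\<omega> s) (\<rho> s) k)"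
        "set_integrable lebesgue {0..t} (\<lambda>s. vort_rhs (\<omega>' s) (\<rho>' s) k)" "set_integrable lebesgue {0..t} (\<lambda>s. dens_rhs N (\<omega>' s) (\<rho>' s) k)"
        by (intro absolutely_integrable_continuous_real c)+
    qed
    have Fint: "set_integrable lebesgue {0..t} (\<lambda>s. F s k)" "set_integrable lebesgue {0..t} (\<lambda>s. F' s k)" if "t \<in> {0..T}" for t k
      by (rule set_integrable_subinterval[OF F[rule_format] that] set_integrable_subinterval[OF F'[rule_format] that])+
    have dec1: "fourier (\<lambda>p. \<omega> t p - \<omega>' t p) = (\<lambda>k. (heat \<nu> t (\<lambda>j. fourier (fst v) j - fourier (fst v') j) k +
        hat_integral 0 t (\<lambda>s. heat \<nu> (t - s) (\<lambda>j. F s j - F' s j)) k) +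
        hat_integral 0 t (\<lambda>s. heat \<nu> (t - s) (\<lambda>j. vort_rhs (\<omega> s) (\<rho> s) j - vort_rhs (\<omega>' s) (\<rho>' s) j)) k)"
      if t: "t \<in> {0..T}" for t
    proof
      fix k
      note hi = set_integrable_heat[OF _ kp(1)]
      have "fourier (\<lambda>p. \<omega> t p - \<omega>' t p) k = fourier (\<omega> t) k - fourier (\<omega>' t) k"
        using V_spaceD[OF V[OF t]] V_spaceD[OF V'[OF t]] by (intro fourier_diff_per0_L2 per0_L2_H1) auto
      also have "\<dots> = heat \<nu> t (\<lambda>j. fourier (fst v) j - fourier (fst v') j) k +
        ((hat_integral 0 t (\<lambda>s. heat \<nu> (t - s) (vort_rhs (\<omega> s) (\<rho> s))) k + hat_integral 0 t (\<lambda>s. heat \<nu> (t - s) (F s)) k) -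
         (hat_integral 0 t (\<lambda>s. heat \<nu> (t - s) (vort_rhs (\<omega>' s) (\<rho>' s))) k + hat_integral 0 t (\<lambda>s. heat \<nu> (t - s) (F' s)) k))"
        unfolding mild_solution_vort[OF m t] mild_solution_vort[OF m' t] heat_diff heat_add[abs_def]
        by (simp add: hat_integral_add hi Nint[OF t] Fint[OF t])
      also have "\<dots> = (heat \<nu> t (\<lambda>j. fourier (fst v) j - fourier (fst v') j) k +
        hat_integral 0 t (\<lambda>s. heat \<nu> (t - s) (\<lambda>j. F s j - F' s j)) k) +
        hat_integral 0 t (\<lambda>s. heat \<nu> (t - s) (\<lambda>j. vort_rhs (\<omega> s) (\<rho> s) j - vort_rhs (\<omega>' s) (\<rho>' s) j)) k"
        unfolding heat_diff[abs_def] by (simp add: hat_integral_diff hi Nint[OF t] Fint[OF t])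
      finally show "fourier (\<lambda>p. \<omega> t p - \<omega>' t p) k = (heat \<nu> t (\<lambda>j. fourier (fst v) j - fourier (fst v') j) k +
        hat_integral 0 t (\<lambda>s. heat \<nu> (t - s) (\<lambda>j. F s j - F' s j)) k) +
        hat_integral 0 t (\<lambda>s. heat \<nu> (t - s) (\<lambda>j. vort_rhs (\<omega> s) (\<rho> s) j - vort_rhs (\<omega>' s) (\<rho>' s) j)) k" .
    qed
    have dec2: "fourier (\<lambda>p. \<rho> t p - \<rho>' t p) = (\<lambda>k. heat (\<nu> / Pr) t (\<lambda>j. fourier (snd v) j - fourier (snd v') j) k +
        hat_integral 0 t (\<lambda>s. heat (\<nu> / Pr) (t - s) (\<lambda>j. dens_rhs N (\<omega> s) (\<rho> s) j - dens_rhs N (\<omega>' s) (\<rho>' s) j)) k)"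
      if t: "t \<in> {0..T}" for t
    proof
      fix k
      note hi = set_integrable_heat[OF _ kp(2)]
      have "fourier (\<lambda>p. \<rho> t p - \<rho>' t p) k = fourier (\<rho> t) k - fourier (\<rho>' t) k"
        using V_spaceD[OF V[OF t]] V_spaceD[OF V'[OF t]] by (intro fourier_diff_per0_L2 per0_L2_H1) auto
      also have "\<dots> = heat (\<nu> / Pr) t (\<lambda>j. fourier (snd v) j - fourier (snd v') j) k +
        (hat_integral 0 t (\<lambda>s. heat (\<nu> / Pr) (t - s) (dens_rhs N (\<omega> s) (\<rho> s))) k -
         hat_integral 0 t (\<lambda>s. heat (\<nu> / Pr) (t - s) (dens_rhs N (\<omega>' s) (\<rho>' s))) k)"
        unfolding mild_solution_dens[OF m t] mild_solution_dens[OF m' t] heat_diff by simp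
      also have "\<dots> = heat (\<nu> / Pr) t (\<lambda>j. fourier (snd v) j - fourier (snd v') j) k +
        hat_integral 0 t (\<lambda>s. heat (\<nu> / Pr) (t - s) (\<lambda>j. dens_rhs N (\<omega> s) (\<rho> s) j - dens_rhs N (\<omega>' s) (\<rho>' s) j)) k"
        unfolding heat_diff[abs_def] by (simp add: hat_integral_diff hi Nint[OF t])
      finally show "fourier (\<lambda>p. \<rho> t p - \<rho>' t p) k = heat (\<nu> / Pr) t (\<lambda>j. fourier (snd v) j - fourier (snd v') j) k +
        hat_integral 0 t (\<lambda>s. heat (\<nu> / Pr) (t - s) (\<lambda>j. dens_rhs N (\<omega> s) (\<rho> s) j - dens_rhs N (\<omega>' s) (\<rho>' s) j)) k" .
    qed
    have step: "z t \<le> a t + b t + K * (6 * A + 4 * T powr (1/4) * l powr - (1/4) * exp (l * t) * Y)"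
      if t: "t \<in> {0..T}" and zr: "\<forall>s\<in>{0<..<t}. z s \<le> \<rho>0" and AY: "0 \<le> A" "0 \<le> Y"
        and zb: "\<forall>s\<in>{0<..<t}. z s \<le> A * s powr - (1/2) + Y * exp (l * s)" for t A Y
    proof -
      let ?M = "L * (6 * A + 4 * T powr (1/4) * l powr - (1/4) * exp (l * t) * Y)"
      have rhs: "ell2_le (\<lambda>k. vort_rhs (\<omega> s) (\<rho> s) k - vort_rhs (\<omega>' s) (\<rho>' s) k) (L * (A * s powr - (1/2) + Y * exp (l * s))) \<and>
          ell2_le (\<lambda>k. dens_rhs N (\<omega> s) (\<rho> s) k - dens_rhs N (\<omega>' s) (\<rho>' s) k) (L * (A * s powr - (1/2) + Y * exp (l * s)))"
        if s: "s \<in> {0<..<t}" for s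
      proof -
        have sT: "s \<in> {0..T}" using s t by auto
        have "V_nrm \<nu> Pr (\<omega>' s, \<rho>' s) \<le> R" "z s \<le> \<rho>0" using bR sT zr s by auto
        then have "V_nrm \<nu> Pr (\<omega> s, \<rho> s) \<le> R + \<rho>0" "V_nrm \<nu> Pr (\<omega>' s, \<rho>' s) \<le> R + \<rho>0"
          using V_nrm_triangle[OF V[OF sT] V'[OF sT] \<nu>] R unfolding z_def by linarith+
        moreover have "V_nrm \<nu> Pr (\<lambda>p. \<omega> s p - \<omega>' s p, \<lambda>p. \<rho> s p - \<rho>' s p) \<le> A * s powr - (1/2) + Y * exp (l * s)"
          using zb s unfolding z_def by blast
        ultimately show ?thesis
          unfolding L_def by (intro conjI ell2_le_rhs_diff[OF V[OF sT] V'[OF sT] \<nu>])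
      qed
      have i1: "ell2_le (frac_pow \<nu> (1/2) (hat_integral 0 t (\<lambda>s. heat \<nu> (t - s) (\<lambda>j. vort_rhs (\<omega> s) (\<rho> s) j - vort_rhs (\<omega>' s) (\<rho>' s) j)))) ?M"
        using t rhs by (intro ell2_le_smoothed_integral kp L0 AY l) auto
      have i2: "ell2_le (frac_pow (\<nu> / Pr) (1/2) (hat_integral 0 t (\<lambda>s. heat (\<nu> / Pr) (t - s) (\<lambda>j. dens_rhs N (\<omega> s) (\<rho> s) j - dens_rhs N (\<omega>' s) (\<rho>' s) j)))) ?M"
        using t rhs by (intro ell2_le_smoothed_integral kp L0 AY l) auto
      have "half_nrm \<nu> (\<lambda>p. \<omega> t p - \<omega>' t p) \<le> a t + ?M"
        unfolding half_nrm_le_iff[OF Hd(1)[OF t] kp(1)] dec1[OF t] frac_pow_add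
        using ell2_le_add[OF bspec[OF a t] i1] unfolding frac_pow_add .
      moreover have "half_nrm (\<nu> / Pr) (\<lambda>p. \<rho> t p - \<rho>' t p) \<le> b t + ?M"
        unfolding half_nrm_le_iff[OF Hd(2)[OF t] kp(2)] dec2[OF t] frac_pow_add
        using ell2_le_add[OF bspec[OF b t] i2] .
      ultimately have "z t \<le> a t + b t + 2 * ?M" unfolding z_def V_nrm_def by simp
      then show ?thesis unfolding K_def by (simp only: mult.assoc)
    qed
    have ab0: "0 \<le> a t + b t" if "t \<in> {0..T}" for t
      using a b that by (auto intro!: add_nonneg_nonneg dest!: bspec ell2_le_nonneg)
    have zc: "continuous_on {0..T} z"
      unfolding z_def
    proof (rule V_nrm_continuous_on[OF Vd \<nu>])
      fix t assume t: "t \<in> {0..T}"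
      have d: "((\<lambda>s. V_nrm \<nu> Pr (\<lambda>p. \<omega> s p - \<omega> t p, \<lambda>p. \<rho> s p - \<rho> t p) + V_nrm \<nu> Pr (\<lambda>p. \<omega>' s p - \<omega>' t p, \<lambda>p. \<rho>' s p - \<rho>' t p)) \<longlongrightarrow> 0) (at t within {0..T})"
        using tendsto_add[OF mild_solution_tendsto[OF m t] mild_solution_tendsto[OF m' t]] by simp
      have ev: "\<forall>\<^sub>F s in at t within {0..T}. s \<in> {0..T}" by (simp add: eventually_at_filter)
      have bd: "norm (V_nrm \<nu> Pr (\<lambda>p. (\<omega> s p - \<omega>' s p) - (\<omega> t p - \<omega>' t p), \<lambda>p. (\<rho> s p - \<rho>' s p) - (\<rho> t p - \<rho>' t p)))
          \<le> V_nrm \<nu> Pr (\<lambda>p. \<omega> s p - \<omega> t p, \<lambda>p. \<rho> s p - \<rho> t p) + V_nrm \<nu> Pr (\<lambda>p. \<omega>' s p - \<omega>' t p, \<lambda>p. \<rho>' s p - \<rho>' t p)"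
        if s: "s \<in> {0..T}" for s
      proof -
        have ex: "(\<lambda>p. (\<omega> s p - \<omega>' s p) - (\<omega> t p - \<omega>' t p)) = (\<lambda>p. (\<omega> s p - \<omega> t p) - (\<omega>' s p - \<omega>' t p))"
          "(\<lambda>p. (\<rho> s p - \<rho>' s p) - (\<rho> t p - \<rho>' t p)) = (\<lambda>p. (\<rho> s p - \<rho> t p) - (\<rho>' s p - \<rho>' t p))"
          by (simp_all add: fun_eq_iff)
        note HH = V_spaceD[OF V[OF s]] V_spaceD[OF V[OF t]] V_spaceD[OF V'[OF s]] V_spaceD[OF V'[OF t]]
        have "half_nrm \<nu> (\<lambda>p. (\<omega> s p - \<omega> t p) - (\<omega>' s p - \<omega>' t p)) \<le> half_nrm \<nu> (\<lambda>p. \<omega> s p - \<omega> t p) + half_nrm \<nu> (\<lambda>p. \<omega>' s p - \<omega>' t p)"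
          "half_nrm (\<nu> / Pr) (\<lambda>p. (\<rho> s p - \<rho> t p) - (\<rho>' s p - \<rho>' t p)) \<le> half_nrm (\<nu> / Pr) (\<lambda>p. \<rho> s p - \<rho> t p) + half_nrm (\<nu> / Pr) (\<lambda>p. \<rho>' s p - \<rho>' t p)"
          by (intro half_nrm_diff_le per0_H1_diff kp; use HH in blast)+
        then show ?thesis
          unfolding real_norm_def abs_of_nonneg[OF V_nrm_nonneg] unfolding V_nrm_def fst_conv snd_conv ex by linarith
      qed
      show "((\<lambda>s. V_nrm \<nu> Pr (\<lambda>p. (\<omega> s p - \<omega>' s p) - (\<omega> t p - \<omega>' t p), \<lambda>p. (\<rho> s p - \<rho>' s p) - (\<rho> t p - \<rho>' t p))) \<longlongrightarrow> 0) (at t within {0..T})"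
        by (rule Lim_null_comparison[OF eventually_mono[OF ev bd] d])
    qed
    have z00: "z 0 \<le> A0"
      using step[of 0 0 0] bspec[OF A0, of 0] T by simp
    have "\<forall>t\<in>{0..T}. z t \<le> a t + b t + 12 * K * exp (l * T) * A1"
    proof
      fix t assume t: "t \<in> {0..T}"
      show "z t \<le> a t + b t + 12 * K * exp (l * T) * A1"
      proof (rule singular_Gronwall[OF T K0 l zc z0 ab0 _ _ A1(2) z00 _ _ t])
        show "a t + b t \<le> A0" if "t \<in> {0..T}" for t using A0 that by blast
        show "a t + b t \<le> A1 * t powr - (1/2)" if "t \<in> {0<..T}" for t using A1(1) that by blast
        show "z t \<le> a t + b t + K * (6 * A + 4 * T powr (1/4) * l powr - (1/4) * exp (l * t) * Y)"
          if "t \<in> {0..T}" "\<forall>s\<in>{0..t}. z s \<le> \<rho>0" "0 \<le> A" "0 \<le> Y"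
            "\<forall>s\<in>{0<..<t}. z s \<le> A * s powr - (1/2) + Y * exp (l * s)" for t A Y
          using that by (intro step) auto
        show "A0 + 12 * K * exp (l * T) * A1 < \<rho>0" using small by (simp add: C_def)
      qed
    qed
    then show "\<forall>t\<in>{0..T}. V_nrm \<nu> Pr (\<lambda>p. \<omega> t p - \<omega>' t p, \<lambda>p. \<rho> t p - \<rho>' t p) \<le> a t + b t + C * A1"
      by (simp add: z_def C_def)
  qed
qed

lemma stability_constD:
  assumes "stability_const \<nu> Pr N T R \<rho>0 C"
    and "mild_solution \<nu> Pr N 1 F {0..T} v \<omega> \<rho>" "mild_solution \<nu> Pr N 1 F' {0..T} v' \<omega>' \<rho>'"
    and "\<And>k. set_integrable lebesgue {0..T} (\<lambda>s. F s k)" "\<And>k. set_integrable lebesgue {0..T} (\<lambda>s. F' s k)"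
    and "\<And>t. t \<in> {0..T} \<Longrightarrow> V_nrm \<nu> Pr (\<omega>' t, \<rho>' t) \<le> R"
    and "\<And>t. t \<in> {0..T} \<Longrightarrow> ell2_le (frac_pow \<nu> (1/2) (\<lambda>k. heat \<nu> t (\<lambda>j. fourier (fst v) j - fourier (fst v') j) k +
       hat_integral 0 t (\<lambda>s. heat \<nu> (t - s) (\<lambda>j. F s j - F' s j)) k)) (a t)"
    and "\<And>t. t \<in> {0..T} \<Longrightarrow> ell2_le (frac_pow (\<nu> / Pr) (1/2) (heat (\<nu> / Pr) t (\<lambda>j. fourier (snd v) j - fourier (snd v') j))) (b t)"
    and "\<And>t. t \<in> {0..T} \<Longrightarrow> a t + b t \<le> A0" "\<And>t. t \<in> {0<..T} \<Longrightarrow> a t + b t \<le> A1 * t powr - (1/2)"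
    and "0 \<le> A1" "A0 + C * A1 < \<rho>0" and "t \<in> {0..T}"
  shows "V_nrm \<nu> Pr (\<lambda>p. \<omega> t p - \<omega>' t p, \<lambda>p. \<rho> t p - \<rho>' t p) \<le> a t + b t + C * A1"
  using assms(1)[unfolded stability_const_def, THEN spec[of _ F], THEN spec[of _ "F'"], THEN spec[of _ v], THEN spec[of _ "v'"],
      THEN spec[of _ "\<omega>"], THEN spec[of _ "\<rho>"], THEN spec[of _ "\<omega>'"], THEN spec[of _ "\<rho>'"],
      THEN spec[of _ a], THEN spec[of _ b], THEN spec[of _ A0], THEN spec[of _ A1]] assms(2-)
  by blast

section \<open>Rescaled time and the forcing\<close>

lemma set_integral_rescale:
  fixes h :: "real \<Rightarrow> complex"
  assumes "0 < e"
  shows "(LINT r:{a..b}|lebesgue. h (r / e)) = of_real e * (LINT s:{a / e..b / e}|lebesgue. h s)"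
proof -
  have ind: "indicator {a / e..b / e} (0 + 1 / e * r) *\<^sub>R h (0 + 1 / e * r) = indicator {a..b} r *\<^sub>R h (r / e)" for r
    using assms by (auto simp: indicator_def divide_le_cancel)
  have "(LINT s:{a / e..b / e}|lebesgue. h s) = \<bar>1 / e\<bar> *\<^sub>R (LINT r:{a..b}|lebesgue. h (r / e))"
    using lebesgue_integral_real_affine[of "1 / e" "\<lambda>s. indicator {a / e..b / e} s *\<^sub>R h s" 0] assms
    unfolding set_lebesgue_integral_def ind by simp
  then show ?thesis using assms by (simp add: scaleR_conv_of_real)
qed

lemma mild_solution_rescale:
  assumes m: "mild_solution \<nu> Pr N \<epsilon> F {0..T / \<epsilon>} v \<omega> \<rho>" and e: "0 < \<epsilon>"
  shows "mild_solution \<nu> Pr N 1 (\<lambda>t. F (t / \<epsilon>)) {0..T} v (\<lambda>t. \<omega> (t / \<epsilon>)) (\<lambda>t. \<rho> (t / \<epsilon>))"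
proof -
  have mem: "t / \<epsilon> \<in> {0..T / \<epsilon>}" if "t \<in> {0..T}" for t
    using that e by (auto simp: divide_right_mono)
  have resc: "of_real \<epsilon> * hat_integral 0 (t / \<epsilon>) (\<lambda>s. heat \<kappa> (\<epsilon> * (t / \<epsilon> - s)) (c s)) k =
      hat_integral 0 t (\<lambda>s. heat \<kappa> (t - s) (c (s / \<epsilon>))) k" for \<kappa> t c k
    using set_integral_rescale[OF e, of 0 t "\<lambda>s. heat \<kappa> (\<epsilon> * (t / \<epsilon> - s)) (c s) k"] e
    by (simp add: hat_integral_def right_diff_distrib)
  have tt: "\<epsilon> * (t / \<epsilon>) = t" for t using e by simp
  have fl: "filterlim (\<lambda>s. s / \<epsilon>) (at (t / \<epsilon>) within {0..T / \<epsilon>}) (at t within {0..T})" if "t \<in> {0..T}" for t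
    unfolding filterlim_at
  proof (intro conjI)
    show "\<forall>\<^sub>F s in at t within {0..T}. s / \<epsilon> \<in> {0..T / \<epsilon>} \<and> s / \<epsilon> \<noteq> t / \<epsilon>"
      unfolding eventually_at_filter using mem e by (intro always_eventually allI impI conjI) auto
    show "((\<lambda>s. s / \<epsilon>) \<longlongrightarrow> t / \<epsilon>) (at t within {0..T})" using e by (intro tendsto_intros) auto
  qed
  note d = m[unfolded mild_solution_def]
  show ?thesis
    unfolding mild_solution_def
  proof (intro conjI ballI allI)
    fix t assume t: "t \<in> {0..T}"
    show "(\<omega> (t / \<epsilon>), \<rho> (t / \<epsilon>)) \<in> V_space" using d mem[OF t] by blast
    show "((\<lambda>s. V_nrm \<nu> Pr (\<lambda>p. \<omega> (s / \<epsilon>) p - \<omega> (t / \<epsilon>) p, \<lambda>p. \<rho> (s / \<epsilon>) p - \<rho> (t / \<epsilon>) p)) \<longlongrightarrow> 0) (at t within {0..T})"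
      by (rule filterlim_compose[OF mild_solution_tendsto[OF m mem[OF t]] fl[OF t]])
    fix k
    show "fourier (\<omega> (t / \<epsilon>)) k = heat \<nu> (1 * t) (fourier (fst v)) k +
        of_real 1 * hat_integral 0 t (\<lambda>s. heat \<nu> (1 * (t - s))
          (\<lambda>j. - fourier (jacobian (\<omega> (s / \<epsilon>)) (inv_laplacian (\<omega> (s / \<epsilon>)))) j + fourier (dx (\<rho> (s / \<epsilon>))) j + F (s / \<epsilon>) j)) k"
      using d[THEN conjunct2, THEN conjunct2, THEN conjunct1, rule_format, OF mem[OF t], of k]
      unfolding resc[of t \<nu> "\<lambda>s j. - fourier (jacobian (\<omega> s) (inv_laplacian (\<omega> s))) j + fourier (dx (\<rho> s)) j + F s j"]
        tt of_real_1 mult_1_left .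
    show "fourier (\<rho> (t / \<epsilon>)) k = heat (\<nu> / Pr) (1 * t) (fourier (snd v)) k +
        of_real 1 * hat_integral 0 t (\<lambda>s. heat (\<nu> / Pr) (1 * (t - s))
          (\<lambda>j. - fourier (jacobian (\<rho> (s / \<epsilon>)) (inv_laplacian (\<omega> (s / \<epsilon>)))) j
             - of_real (N\<^sup>2) * fourier (inv_laplacian (dx (\<omega> (s / \<epsilon>)))) j)) k"
      using d[THEN conjunct2, THEN conjunct2, THEN conjunct2, rule_format, OF mem[OF t], of k]
      unfolding resc[of t "\<nu> / Pr" "\<lambda>s j. - fourier (jacobian (\<rho> s) (inv_laplacian (\<omega> s))) j - of_real (N\<^sup>2) * fourier (inv_laplacian (dx (\<omega> s))) j"]
        tt of_real_1 mult_1_left .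
  qed
qed

lemma mild_solution_subset:
  assumes "mild_solution \<nu> Pr N \<epsilon> F I v \<omega> \<rho>" "J \<subseteq> I"
  shows "mild_solution \<nu> Pr N \<epsilon> F J v \<omega> \<rho>"
  using assms unfolding mild_solution_def by (blast intro: tendsto_within_subset)

text \<open>The coefficients are almost everywhere limits of those of the simple functions, and for the complete
  Lebesgue measure such limits are measurable.\<close>

lemma fourier_forcing_measurable:
  assumes f: "Linfty_loc_H f"
  shows "(\<lambda>s. indicator {0..} s *\<^sub>R fourier (f s) k) \<in> borel_measurable lebesgue"
proof -
  obtain \<phi> :: "nat \<Rightarrow> real \<Rightarrow> real \<times> real \<Rightarrow> real" where
    \<phi>: "\<And>n. finite (\<phi> n ` {0..})" "\<And>n. \<phi> n ` {0..} \<subseteq> per0_L2" "\<And>n h. {s \<in> {0..}. \<phi> n s = h} \<in> sets lebesgue"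
    and lim: "AE s in lebesgue. 0 \<le> s \<longrightarrow> (\<lambda>n. L2_nrm (\<lambda>p. \<phi> n s p - f s p)) \<longlonglongrightarrow> 0"
    and fL: "AE s in lebesgue. 0 \<le> s \<longrightarrow> f s \<in> per0_L2"
    using f unfolding Linfty_loc_H_def strongly_measurable_H_def by blast
  define g where "g n s = (\<Sum>h\<in>\<phi> n ` {0..}. indicator {s \<in> {0..}. \<phi> n s = h} s *\<^sub>R fourier h k)" for n s
  have g: "g n s = indicator {0..} s *\<^sub>R fourier (\<phi> n s) k" for n s
  proof (cases "s \<in> {0..}")
    case True
    then have "g n s = (\<Sum>h\<in>\<phi> n ` {0..}. if \<phi> n s = h then fourier h k else 0)"
      unfolding g_def by (intro sum.cong refl) (auto simp: indicator_def)
    then show ?thesis using True \<phi>(1)[of n] by simp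
  qed (simp add: g_def)
  have mg: "g n \<in> borel_measurable lebesgue" for n
    unfolding g_def by (intro borel_measurable_sum borel_measurable_scaleR borel_measurable_indicator \<phi>(3)) simp
  have "AE s in lebesgue. (\<lambda>n. g n s) \<longlonglongrightarrow> indicator {0..} s *\<^sub>R fourier (f s) k"
    using lim fL
  proof eventually_elim
    case (elim s)
    show ?case
    proof (cases "0 \<le> s")
      case True
      have fs: "f s \<in> per0_L2" and \<phi>s: "\<phi> n s \<in> per0_L2" for n using elim True \<phi>(2)[of n] by auto
      have "norm (fourier (\<phi> n s) k - fourier (f s) k) \<le> L2_nrm (\<lambda>p. \<phi> n s p - f s p)" for n
        using norm_fourier_le[OF L2_cell_per0_L2[OF per0_L2_diff[OF \<phi>s fs]], of n k]
        by (simp add: fourier_diff_per0_L2[OF \<phi>s fs] L2_nrm_def)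
      from Lim_null_comparison[OF always_eventually[OF allI, OF this] mp[OF elim(1) True]]
      have "(\<lambda>n. fourier (\<phi> n s) k) \<longlonglongrightarrow> fourier (f s) k" by (rule LIM_zero_cancel)
      then show ?thesis using True by (simp add: g)
    qed (simp add: g)
  qed
  then have "AE s in lebesgue. lim (\<lambda>n. g n s) = indicator {0..} s *\<^sub>R fourier (f s) k"
    by eventually_elim (rule limI)
  moreover have "(\<lambda>s. lim (\<lambda>n. g n s)) \<in> borel_measurable lebesgue"
    by (intro borel_measurable_lim_metric mg)
  ultimately show ?thesis by (rule borel_measurable_AE[rotated])
qed

lemma fourier_forcing_integrable:
  assumes f: "Linfty_loc_H f"
  shows "set_integrable lebesgue {0..S} (\<lambda>s. fourier (f s) k)"
proof (cases "0 < S")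
  case True
  then obtain C where C: "AE s in lebesgue. 0 \<le> s \<and> s \<le> S \<longrightarrow> L2_nrm (f s) \<le> C"
    and fL: "AE s in lebesgue. 0 \<le> s \<longrightarrow> f s \<in> per0_L2"
    using f unfolding Linfty_loc_H_def by blast
  have i: "integrable lebesgue (\<lambda>s. indicator {0..S} s *\<^sub>R C)"
    using absolutely_integrable_continuous_real[of 0 S "\<lambda>_. C"] by (simp only: set_integrable_def continuous_on_const simp_thms)
  show ?thesis
    unfolding set_integrable_def
  proof (rule Bochner_Integration.integrable_bound[OF i])
    have "(\<lambda>s. indicator {0..S} s *\<^sub>R (indicator {0..} s *\<^sub>R fourier (f s) k)) \<in> borel_measurable lebesgue"
      by (intro borel_measurable_scaleR fourier_forcing_measurable[OF f] borel_measurable_indicator) auto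
    moreover have "(\<lambda>s. indicator {0..S} s *\<^sub>R (indicator {0..} s *\<^sub>R fourier (f s) k)) = (\<lambda>s. indicator {0..S} s *\<^sub>R fourier (f s) k)"
      by (auto simp: fun_eq_iff indicator_def)
    ultimately show "(\<lambda>s. indicator {0..S} s *\<^sub>R fourier (f s) k) \<in> borel_measurable lebesgue" by simp
    show "AE s in lebesgue. norm (indicator {0..S} s *\<^sub>R fourier (f s) k) \<le> norm (indicator {0..S} s *\<^sub>R C)"
      using C fL
    proof eventually_elim
      case (elim s)
      show ?case
      proof (cases "s \<in> {0..S}")
        case True
        then have "norm (fourier (f s) k) \<le> L2_nrm (f s)"
          using elim unfolding L2_nrm_def by (intro norm_fourier_le L2_cell_per0_L2) auto
        then show ?thesis using True elim by auto
      qed simp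
    qed
  qed
next
  case False
  have 0: "AE s in lebesgue. 0 = indicator {0..S} s *\<^sub>R fourier (f s) k"
    using AE_interior[of S] by (rule eventually_mono) (use False in \<open>auto simp: indicator_def\<close>)
  have m: "(\<lambda>s. indicator {0..S} s *\<^sub>R fourier (f s) k) \<in> borel_measurable lebesgue"
    by (rule borel_measurable_AE[OF _ 0]) simp
  have "integrable lebesgue (\<lambda>s :: real. 0 :: complex)" by simp
  then show ?thesis unfolding set_integrable_def
    using integrable_cong_AE[OF _ m 0] by simp
qed

lemma set_integrable_rescale:
  fixes h :: "real \<Rightarrow> complex"
  assumes "0 < e" "set_integrable lebesgue {0..b / e} h"
  shows "set_integrable lebesgue {0..b} (\<lambda>r. h (r / e))"
proof -
  have ind: "indicator {0..b / e} (0 + 1 / e * r) *\<^sub>R h (0 + 1 / e * r) = indicator {0..b} r *\<^sub>R h (r / e)" for r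
    using assms by (auto simp: indicator_def divide_le_cancel zero_le_divide_iff)
  show ?thesis
    using lebesgue_integrable_real_affine[OF assms(2)[unfolded set_integrable_def], of "1 / e" 0] assms(1)
    unfolding set_integrable_def ind by simp
qed

text \<open>The semigroup supplies the power \<open>a\<close> of \<open>A\<close>. If this exceeds the \<open>\<theta> - \<gamma>\<close> missing powers, the surplus costs
  a constant only, because the nonzero eigenvalues are at least \<open>\<nu>\<close>.\<close>

lemma frac_pow_change_exponent:
  assumes \<nu>: "0 < \<nu>" and r: "0 < r" and \<theta>: "\<theta> - \<gamma> \<le> a" "0 \<le> a" "a \<le> 2"
    and c: "ell2_le (frac_pow \<nu> \<gamma> c) B"
  shows "ell2_le (frac_pow \<nu> \<theta> (heat \<nu> r c)) (3 * \<nu> powr (\<theta> - \<gamma> - a) * r powr - a * B)"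
proof -
  let ?C = "3 * \<nu> powr (\<theta> - \<gamma> - a) * r powr - a"
  have "ell2_le (\<lambda>k. of_real ?C * frac_pow \<nu> \<gamma> c k) (cmod (of_real ?C) * B)"
    by (rule ell2_le_scale[OF c])
  then have "ell2_le (\<lambda>k. of_real ?C * frac_pow \<nu> \<gamma> c k) (?C * B)" by (simp add: norm_mult)
  then show ?thesis
  proof (rule ell2_le_dominated)
    fix k
    show "cmod (frac_pow \<nu> \<theta> (heat \<nu> r c) k) \<le> cmod (of_real ?C * frac_pow \<nu> \<gamma> c k)"
    proof (cases "k = (0, 0)")
      case True
      then show ?thesis by (simp add: frac_pow_def)
    next
      case False
      define x where "x = eigval \<nu> k"
      have x: "\<nu> \<le> x" "0 < x"
        using eigval_1_ge_1[OF False] \<nu> mult_left_mono[of 1 "eigval 1 k" \<nu>] by (auto simp: x_def eigval_scale[of \<nu>])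
      have "x powr \<theta> = x powr (\<theta> - \<gamma> - a) * x powr a * x powr \<gamma>"
        by (simp add: powr_add[symmetric])
      then have "x powr \<theta> * exp (- (r * x)) = x powr (\<theta> - \<gamma> - a) * (x powr a * exp (- (r * x))) * x powr \<gamma>"
        by simp
      also have "\<dots> \<le> \<nu> powr (\<theta> - \<gamma> - a) * (3 * r powr - a) * x powr \<gamma>"
        using x \<nu> \<theta> r by (intro mult_right_mono mult_mono powr_mono2' powr_exp_le) auto
      finally have "x powr \<theta> * exp (- (r * x)) * cmod (c k) \<le> ?C * x powr \<gamma> * cmod (c k)"
        by (intro mult_right_mono) (auto simp: mult_ac)
      then show ?thesis by (simp add: frac_pow_def heat_def norm_mult x_def[symmetric] mult_ac)
    qed
  qed
qed

section \<open>Averaging of the forcing\<close>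

text \<open>The oscillating part of the forcing, filtered by the heat semigroup, tends to zero in the
  phase space. After integration by parts only the primitive of \<open>f - f\<^sub>0\<close> occurs, which the averaging
  hypothesis controls in \<open>D(A\<^sup>\<gamma>)\<close>; the heat semigroup gains the \<open>1/2 - \<gamma> < 1\<close> missing powers, and one
  more, at the price of an integrable singularity.\<close>

lemma averaged_forcing_small:
  fixes \<nu> \<gamma> M T :: real and \<sigma> :: "real \<Rightarrow> real"
  assumes \<nu>: "0 < \<nu>" and \<gamma>: "- 1/2 < \<gamma>" and f: "Linfty_loc_H f" and M: "0 < M" and \<sigma>: "(\<sigma> \<longlongrightarrow> 0) at_top"
    and av: "\<And>t l. 0 \<le> t \<Longrightarrow> 0 < l \<Longrightarrow>
           (\<lambda>k. of_real (1 / l) * hat_integral t (t + l) (\<lambda>s. fourier (f s)) k - f0 k) \<in> frac_dom \<nu> \<gamma> \<and>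
           frac_nrm \<nu> \<gamma> (\<lambda>k. of_real (1 / l) * hat_integral t (t + l) (\<lambda>s. fourier (f s)) k - f0 k) \<le> min M (\<sigma> l)"
    and T: "0 < T" and \<delta>: "0 < \<delta>"
  shows "\<exists>\<epsilon>0>0. \<forall>\<epsilon>\<in>{0<..\<epsilon>0}. \<forall>t\<in>{0..T}.
    ell2_le (frac_pow \<nu> (1/2) (hat_integral 0 t (\<lambda>s. heat \<nu> (t - s) (\<lambda>j. fourier (f (s / \<epsilon>)) j - f0 j)))) \<delta>"
proof -
  \<comment> \<open>The smoothing exponent \<open>1/2 - \<gamma>\<close>, replaced by \<open>1/2\<close> when \<open>\<gamma>\<close> is positive; \<open>b\<close> is half of what is left
     until the singularity stops being integrable.\<close>
  define a where "a = max (1/2 - \<gamma>) (1/2)"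
  define b where "b = (1 - a) / 2"
  have a: "1/2 - \<gamma> \<le> a" "1/2 \<le> a" "a < 1" using \<gamma> by (auto simp: a_def)
  have "2 * b = 1 - a" by (simp add: b_def)
  then have b: "0 < b" "a + b < 1" using a by linarith+
  define c where "c = 3 * \<nu> powr (1/2 - \<gamma> - a)"
  have c0: "0 < c" using \<nu> by (simp add: c_def)
  \<comment> \<open>The boundary term and the integral left by the integration by parts add up to at most \<open>s0 * D\<close>; the choice
     of \<open>s0\<close> makes this at most \<open>\<delta> / 2\<close>.\<close>
  define D where "D = c * (T powr (1 - a) + M * T powr (1 - (a + b)) + T powr (1 - a) / (1 - a) + M * (T powr (1 - (a + b)) / (1 - (a + b))))"
  have D0: "0 < D" unfolding D_def using c0 T M a b by (intro mult_pos_pos add_pos_pos divide_pos_pos; simp)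
  define s0 where "s0 = \<delta> / (2 * D)"
  have s0: "0 < s0" using D0 \<delta> by (simp add: s0_def)
  have "\<forall>\<^sub>F l in at_top. \<sigma> l < s0 \<and> 0 < l"
    using \<sigma> s0 by (intro eventually_conj order_tendstoD eventually_gt_at_top) auto
  then obtain L where L: "0 < L" "\<And>l. L \<le> l \<Longrightarrow> \<sigma> l \<le> s0"
    by (metis (mono_tags, lifting) eventually_at_top_linorder less_imp_le order.refl)
  \<comment> \<open>Averages over rescaled lengths below \<open>L\<close> are only bounded by \<open>M\<close>. In the time \<open>t\<close> these are the lengths
     below \<open>\<epsilon> * L\<close>, and for \<open>\<epsilon> \<le> \<epsilon>0\<close> the number \<open>(\<epsilon> * L) powr b\<close> is at most \<open>s0\<close>.\<close>
  define \<epsilon>0 where "\<epsilon>0 = s0 powr (1 / b) / L"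
  have \<epsilon>0: "0 < \<epsilon>0" using s0 L by (simp add: \<epsilon>0_def)
  have "ell2_le (frac_pow \<nu> (1/2) (hat_integral 0 t (\<lambda>s. heat \<nu> (t - s) (\<lambda>j. fourier (f (s / \<epsilon>)) j - f0 j)))) \<delta>"
    if \<epsilon>: "\<epsilon> \<in> {0<..\<epsilon>0}" and t: "t \<in> {0..T}" for \<epsilon> t
  proof (cases "t = 0")
    case True
    have "hat_integral 0 0 F k = 0" for F k
    proof -
      have "AE s in lebesgue. indicator {0..0::real} s *\<^sub>R F s k = 0"
        using AE_interior[of 0] by (rule eventually_mono) (auto simp: indicator_def)
      then show ?thesis unfolding hat_integral_def set_lebesgue_integral_def by (rule integral_eq_zero_AE)
    qed
    then show ?thesis unfolding True using \<delta> by (simp add: frac_pow_def ell2_le_def L2_set_def)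
  next
    case False
    then have t: "0 < t" "t \<le> T" and e: "0 < \<epsilon>" "\<epsilon> \<le> \<epsilon>0" using t \<epsilon> by auto
    define g where "g s k = fourier (f (s / \<epsilon>)) k - f0 k" for s k
    define G where "G r k = hat_integral r t g k" for r k
    define E where "E = \<epsilon> * L"
    have E: "0 < E" "E powr b \<le> s0"
    proof -
      show "0 < E" using e L by (simp add: E_def)
      have "E \<le> \<epsilon>0 * L" using e L by (simp add: E_def)
      then have "E \<le> s0 powr (1 / b)" using L by (simp add: \<epsilon>0_def)
      then have "E powr b \<le> (s0 powr (1 / b)) powr b" using \<open>0 < E\<close> b by (intro powr_mono2) auto
      then show "E powr b \<le> s0" using b s0 by (simp add: powr_powr)
    qed
    \<comment> \<open>A bound for the averages at all lengths \<open>r\<close>: for \<open>r \<ge> E\<close> the first summand suffices, and for \<open>r \<le> E\<close> the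
       second one is at least \<open>M\<close>. It is small except for a factor \<open>r powr - b\<close>, which the kernel can absorb.\<close>
    define m where "m r = s0 + M * (E powr b * r powr - b)" for r
    have gi: "set_integrable lebesgue {0..t} (\<lambda>s. fourier (f (s / \<epsilon>)) k)" "set_integrable lebesgue {0..t} (\<lambda>_. f0 k)"
      "set_integrable lebesgue {0..t} (\<lambda>s. g s k)" for k
    proof -
      show 1: "set_integrable lebesgue {0..t} (\<lambda>s. fourier (f (s / \<epsilon>)) k)"
        by (rule set_integrable_rescale[OF e(1) fourier_forcing_integrable[OF f]])
      show 2: "set_integrable lebesgue {0..t} (\<lambda>_. f0 k)"
        by (intro absolutely_integrable_continuous_real continuous_on_const)
      show "set_integrable lebesgue {0..t} (\<lambda>s. g s k)" unfolding g_def by (rule set_integral_diff(1)[OF 1 2])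
    qed
    have Gb: "ell2_le (frac_pow \<nu> \<gamma> (G r)) ((t - r) * m (t - r))" if r: "0 \<le> r" "r < t" for r
    proof -
      let ?l = "(t - r) / \<epsilon>"
      define A where "A = (\<lambda>k. of_real (1 / ?l) * hat_integral (r / \<epsilon>) (r / \<epsilon> + ?l) (\<lambda>s. fourier (f s)) k - f0 k)"
      have l: "0 < ?l" using r e by simp
      have re: "r / \<epsilon> + ?l = t / \<epsilon>" by (simp add: add_divide_distrib[symmetric])
      have GA: "G r k = of_real (t - r) * A k" for k
      proof -
        have sub: "set_integrable lebesgue {r..t} (\<lambda>s. fourier (f (s / \<epsilon>)) k)" "set_integrable lebesgue {r..t} (\<lambda>_. f0 k)"
          using gi[of k] r by (auto intro: set_integrable_subset)
        have "G r k = (LINT s:{r..t}|lebesgue. fourier (f (s / \<epsilon>)) k) - (LINT s:{r..t}|lebesgue. f0 k)"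
          unfolding G_def hat_integral_def g_def by (rule set_integral_diff(2)[OF sub])
        also have "(LINT s:{r..t}|lebesgue. fourier (f (s / \<epsilon>)) k) = of_real \<epsilon> * hat_integral (r / \<epsilon>) (t / \<epsilon>) (\<lambda>s. fourier (f s)) k"
          unfolding hat_integral_def by (rule set_integral_rescale[OF e(1)])
        also have "(LINT s:{r..t}|lebesgue. f0 k) = of_real (t - r) * f0 k"
          using r by (simp add: set_integral_const scaleR_conv_of_real)
        finally show ?thesis unfolding A_def re using r e by (simp add: right_diff_distrib)
      qed
      have "A \<in> frac_dom \<nu> \<gamma> \<and> frac_nrm \<nu> \<gamma> A \<le> min M (\<sigma> ?l)"
        unfolding A_def using r e l by (intro av) auto
      then have "ell2_le (frac_pow \<nu> \<gamma> A) (min M (\<sigma> ?l))"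
        unfolding frac_dom_def frac_nrm_def hat_L2_def by (auto intro: ell2_le_mono hat_nrm_ell2_le)
      moreover have "min M (\<sigma> ?l) \<le> m (t - r)"
      proof (cases "L \<le> ?l")
        case True
        then have "min M (\<sigma> ?l) \<le> s0" using L(2) by (simp add: min_le_iff_disj)
        also have "\<dots> \<le> m (t - r)" using M by (simp add: m_def)
        finally show ?thesis .
      next
        case False
        then have "t - r \<le> E" using e by (simp add: E_def field_simps not_le)
        then have "1 \<le> (E / (t - r)) powr b" using r b by (intro ge_one_powr_ge_zero) auto
        also have "\<dots> = E powr b * (t - r) powr - b" using r E by (simp add: powr_divide powr_minus field_simps)
        finally have "M * 1 \<le> M * (E powr b * (t - r) powr - b)" using M by (intro mult_left_mono) auto
        then have "M \<le> m (t - r)" using s0 by (simp add: m_def)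
        then show ?thesis by (simp add: min_le_iff_disj)
      qed
      ultimately have "ell2_le (frac_pow \<nu> \<gamma> A) (m (t - r))" by (rule ell2_le_mono)
      from ell2_le_scale[OF this, of "of_real (t - r)"]
      have "ell2_le (\<lambda>k. of_real (t - r) * frac_pow \<nu> \<gamma> A k) ((t - r) * m (t - r))" using r by (simp del: of_real_diff)
      moreover have "frac_pow \<nu> \<gamma> (G r) = (\<lambda>k. of_real (t - r) * frac_pow \<nu> \<gamma> A k)"
        by (simp add: frac_pow_def GA fun_eq_iff)
      ultimately show ?thesis by simp
    qed
    have m_powr: "r powr - a * (r * m r) = s0 * r powr (1 - a) + M * (E powr b * r powr (1 - (a + b)))"
      "r powr - (1 + a) * (r * m r) = s0 * r powr - a + M * (E powr b * r powr - (a + b))" if "0 < r" for r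
    proof -
      have k: "r powr x * (r * m r) = s0 * r powr (1 + x) + M * (E powr b * r powr (1 + (x + - b)))" for x
      proof -
        have "r powr x * (r * m r) = s0 * (r * r powr x) + M * (E powr b * (r * (r powr x * r powr - b)))"
          by (simp add: m_def algebra_simps)
        then show ?thesis using that by (simp only: powr_add[symmetric] powr_mult_base less_imp_le)
      qed
      have "1 + - a = 1 - a" "1 + (- a + - b) = 1 - (a + b)" "1 + - (1 + a) = - a" "1 + (- (1 + a) + - b) = - (a + b)"
        by simp_all
      then show "r powr - a * (r * m r) = s0 * r powr (1 - a) + M * (E powr b * r powr (1 - (a + b)))"
        "r powr - (1 + a) * (r * m r) = s0 * r powr - a + M * (E powr b * r powr - (a + b))"
        using k[of "- a"] k[of "- (1 + a)"] by (simp_all only:)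
    qed
    define e1 where "e1 = (\<lambda>k. heat \<nu> t (G 0) k)"
    define e2 where "e2 = (\<lambda>r k. of_real (eigval \<nu> k) * heat \<nu> (t - r) (G r) k)"
    have parts: "hat_integral 0 t (\<lambda>s. heat \<nu> (t - s) (g s)) k = e1 k + hat_integral 0 t e2 k" for k
    proof -
      have ev: "0 \<le> eigval \<nu> k" using \<nu> eigval_nonneg[of k] by (simp add: eigval_scale[of \<nu>])
      show ?thesis
        using duhamel_by_parts[OF gi(3)[of k] ev]
        by (simp add: hat_integral_def heat_def e1_def e2_def G_def mult.assoc)
    qed
    have b1: "ell2_le (frac_pow \<nu> (1/2) e1) (c * (s0 * T powr (1 - a) + M * (E powr b * T powr (1 - (a + b)))))"
    proof -
      have "ell2_le (frac_pow \<nu> (1/2) e1) (c * t powr - a * ((t - 0) * m (t - 0)))"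
        unfolding e1_def c_def using frac_pow_change_exponent[OF \<nu> t(1) a(1) _ _ Gb[of 0]] t a by simp
      moreover have "c * t powr - a * ((t - 0) * m (t - 0)) \<le> c * (s0 * T powr (1 - a) + M * (E powr b * T powr (1 - (a + b))))"
        unfolding mult.assoc diff_zero m_powr(1)[OF t(1)]
        using c0 s0 M t a b by (intro mult_left_mono add_mono powr_mono2) auto
      ultimately show ?thesis by (rule ell2_le_mono)
    qed
    define h where "h r = c * (s0 * (t - r) powr - a + M * (E powr b * (t - r) powr - (a + b)))" for r
    note I1 = powr_integral(3,4)[OF less_imp_le[OF t(1)] a(3)] and I2 = powr_integral(3,4)[OF less_imp_le[OF t(1)] b(2)]
    have hi: "set_integrable lebesgue {0..t} h"
      unfolding h_def by (intro set_integrable_mult_right set_integral_add(1) I1(1) I2(1))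
    have b2: "ell2_le (frac_pow \<nu> (1/2) (hat_integral 0 t e2)) (LINT r:{0..t}|lebesgue. h r)"
      unfolding frac_pow_hat_integral
    proof (rule ell2_le_hat_integral[OF hi], rule eventually_mono[OF AE_interior[of t]], rule impI)
      fix r assume "r \<in> {0..t} \<longrightarrow> r \<in> {0<..<t}" "r \<in> {0..t}"
      then have r: "0 < r" "r < t" by auto
      have eq: "frac_pow \<nu> (1/2) (e2 r) = frac_pow \<nu> (3/2) (heat \<nu> (t - r) (G r))"
      proof
        fix k
        have ev: "0 \<le> eigval \<nu> k" using \<nu> eigval_nonneg[of k] by (simp add: eigval_scale[of \<nu>])
        have "eigval \<nu> k powr (3/2) = eigval \<nu> k powr (1/2) * eigval \<nu> k"
        proof (cases "eigval \<nu> k = 0")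
          case False
          then have "eigval \<nu> k powr (1/2) * eigval \<nu> k powr 1 = eigval \<nu> k powr (3/2)"
            by (simp only: powr_add[symmetric]) simp
          then show ?thesis using ev by simp
        qed simp
        then show "frac_pow \<nu> (1/2) (e2 r) k = frac_pow \<nu> (3/2) (heat \<nu> (t - r) (G r)) k"
          by (simp add: frac_pow_def e2_def)
      qed
      have "ell2_le (frac_pow \<nu> (3/2) (heat \<nu> (t - r) (G r))) (3 * \<nu> powr (3/2 - \<gamma> - (1 + a)) * (t - r) powr - (1 + a) * ((t - r) * m (t - r)))"
        using r a by (intro frac_pow_change_exponent[OF \<nu>] Gb) auto
      also have "3/2 - \<gamma> - (1 + a) = 1/2 - \<gamma> - a" by simp
      also have "3 * \<nu> powr (1/2 - \<gamma> - a) * (t - r) powr - (1 + a) * ((t - r) * m (t - r)) = h r"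
        unfolding mult.assoc[of _ _ "(t - r) * m (t - r)"] using m_powr(2)[of "t - r"] r by (simp add: h_def c_def)
      finally show "ell2_le (frac_pow \<nu> (1/2) (e2 r)) (h r)" unfolding eq .
    qed
    have "(LINT r:{0..t}|lebesgue. h r) = c * (s0 * (t powr (1 - a) / (1 - a)) + M * (E powr b * (t powr (1 - (a + b)) / (1 - (a + b)))))"
      unfolding h_def using I1 I2 by (simp add: set_integral_add(2) set_integrable_mult_right)
    also have "\<dots> \<le> c * (s0 * (T powr (1 - a) / (1 - a)) + M * (E powr b * (T powr (1 - (a + b)) / (1 - (a + b)))))"
      using c0 s0 M t a b by (intro mult_left_mono add_mono divide_right_mono powr_mono2) auto
    finally have hb: "(LINT r:{0..t}|lebesgue. h r) \<le> c * (s0 * (T powr (1 - a) / (1 - a)) + M * (E powr b * (T powr (1 - (a + b)) / (1 - (a + b)))))" .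
    have "ell2_le (frac_pow \<nu> (1/2) (\<lambda>k. e1 k + hat_integral 0 t e2 k))
        (c * (s0 * T powr (1 - a) + M * (E powr b * T powr (1 - (a + b)))) +
         c * (s0 * (T powr (1 - a) / (1 - a)) + M * (E powr b * (T powr (1 - (a + b)) / (1 - (a + b))))))"
      unfolding frac_pow_add by (intro ell2_le_add b1 ell2_le_mono[OF b2 hb])
    moreover have "c * (s0 * T powr (1 - a) + M * (E powr b * T powr (1 - (a + b)))) +
         c * (s0 * (T powr (1 - a) / (1 - a)) + M * (E powr b * (T powr (1 - (a + b)) / (1 - (a + b))))) \<le> \<delta>"
    proof -
      have gen: "c * (s0 * x + M * (E powr b * y)) + c * (s0 * u + M * (E powr b * w)) \<le> s0 * (c * (x + M * y + u + M * w))"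
        if "0 \<le> y" "0 \<le> w" for x y u w
      proof -
        have "c * (M * (E powr b * y)) \<le> c * (M * (s0 * y))" "c * (M * (E powr b * w)) \<le> c * (M * (s0 * w))"
          using c0 M E that by (auto intro!: mult_left_mono mult_right_mono)
        then show ?thesis by (simp add: algebra_simps)
      qed
      have "c * (s0 * T powr (1 - a) + M * (E powr b * T powr (1 - (a + b)))) +
         c * (s0 * (T powr (1 - a) / (1 - a)) + M * (E powr b * (T powr (1 - (a + b)) / (1 - (a + b))))) \<le> s0 * D"
        unfolding D_def by (rule gen) (use b in auto)
      also have "s0 * D \<le> \<delta>" using D0 \<delta> by (simp add: s0_def)
      finally show ?thesis .
    qed
    ultimately have "ell2_le (frac_pow \<nu> (1/2) (\<lambda>k. e1 k + hat_integral 0 t e2 k)) \<delta>" by (rule ell2_le_mono)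
    then show ?thesis unfolding parts[symmetric] g_def .
  qed
  then show ?thesis using \<epsilon>0 by blast
qed

section \<open>Uniform bounds for the averaged system\<close>

lemma mild_solution_bounded:
  assumes m: "mild_solution \<nu> Pr N \<epsilon> F {0..T} v \<omega> \<rho>" and \<nu>: "0 < \<nu>" "0 < Pr"
  shows "\<exists>K. \<forall>t\<in>{0..T}. V_nrm \<nu> Pr (\<omega> t, \<rho> t) \<le> K"
proof -
  have "continuous_on {0..T} (\<lambda>t. V_nrm \<nu> Pr (\<omega> t, \<rho> t))"
    by (rule V_nrm_continuous_on[OF mild_solution_V_space[OF m] \<nu> mild_solution_tendsto[OF m]])
  then have "compact ((\<lambda>t. V_nrm \<nu> Pr (\<omega> t, \<rho> t)) ` {0..T})" by (rule compact_continuous_image) simp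
  then have "bounded ((\<lambda>t. V_nrm \<nu> Pr (\<omega> t, \<rho> t)) ` {0..T})" by (rule compact_imp_bounded)
  then obtain K where "\<forall>x\<in>(\<lambda>t. V_nrm \<nu> Pr (\<omega> t, \<rho> t)) ` {0..T}. norm x \<le> K" unfolding bounded_iff by blast
  then have "\<forall>t\<in>{0..T}. V_nrm \<nu> Pr (\<omega> t, \<rho> t) \<le> K" by (auto simp: abs_le_iff)
  then show ?thesis by blast
qed

text \<open>By Tychonoff's theorem a product of discs is compact, and over a countable index set it is metrizable, so
  that compactness is sequential.\<close>

lemma coefficientwise_convergent_subsequence:
  fixes c :: "nat \<Rightarrow> 'i::countable \<Rightarrow> complex"
  assumes "\<And>n k. cmod (c n k) \<le> r"
  obtains c' s where "strict_mono (s :: nat \<Rightarrow> nat)" "\<And>k. (\<lambda>n. c (s n) k) \<longlonglongrightarrow> c' k"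
proof -
  let ?P = "PiE UNIV (\<lambda>_ :: 'i. cball (0 :: complex) r)"
  have "compactin (product_topology (\<lambda>_ :: 'i. euclidean :: complex topology) UNIV) ?P"
    by (simp add: compactin_PiE)
  then have "compact ?P" by (simp add: euclidean_product_topology)
  then have "seq_compact ?P" by (rule compact_imp_seq_compact)
  moreover have "\<forall>n. c n \<in> ?P" using assms by (auto simp: PiE_def)
  ultimately obtain c' s where s: "strict_mono (s :: nat \<Rightarrow> nat)" "(c \<circ> s) \<longlonglongrightarrow> c'"
    unfolding seq_compact_def by metis
  have "(\<lambda>n. c (s n) k) \<longlonglongrightarrow> c' k" for k
  proof -
    have "continuous_on UNIV (\<lambda>x :: 'i \<Rightarrow> complex. x k)" by (rule continuous_on_product_coordinates)
    from continuous_on_tendsto_compose[OF this s(2)] show ?thesis by (simp add: o_def)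
  qed
  then show thesis using that s(1) by blast
qed

text \<open>The Rellich argument: high frequencies are small by the bound on the gradient, low
  frequencies are finitely many.\<close>

lemma ell2_small_of_grad_bounded:
  assumes \<kappa>: "0 < \<kappa>" and B: "\<And>n :: nat. ell2_le (frac_pow \<kappa> (1/2) (e n)) B"
    and lim: "\<And>k. (\<lambda>n. e n k) \<longlonglongrightarrow> 0" and \<delta>: "0 < \<delta>"
  shows "\<forall>\<^sub>F n in sequentially. ell2_le (e n) \<delta>"
proof -
  define \<Lambda> where "\<Lambda> = 2 * B\<^sup>2 / \<delta>\<^sup>2 + 1"
  have \<Lambda>: "0 < \<Lambda>" "B\<^sup>2 / \<Lambda> \<le> \<delta>\<^sup>2 / 2"
  proof -
    have "0 \<le> 2 * B\<^sup>2 / \<delta>\<^sup>2" by simp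
    then show "0 < \<Lambda>" unfolding \<Lambda>_def by linarith
    have "B\<^sup>2 = (\<delta>\<^sup>2 / 2) * (2 * B\<^sup>2 / \<delta>\<^sup>2)" using \<delta> by simp
    also have "\<dots> \<le> (\<delta>\<^sup>2 / 2) * \<Lambda>" unfolding \<Lambda>_def using \<delta> by (intro mult_left_mono) auto
    finally show "B\<^sup>2 / \<Lambda> \<le> \<delta>\<^sup>2 / 2" using \<open>0 < \<Lambda>\<close> by (simp add: divide_le_eq)
  qed
  define Q where "Q = {k. eigval \<kappa> k < \<Lambda>}"
  obtain m where m: "\<Lambda> / \<kappa> \<le> real m" using real_arch_simple by blast
  have "Q \<subseteq> freq_box m"
  proof
    fix k assume "k \<in> Q"
    then have "eigval 1 k < \<Lambda> / \<kappa>" using \<kappa> by (simp add: Q_def eigval_scale[of \<kappa>] pos_less_divide_eq mult.commute)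
    then have ev: "eigval 1 k < real m" using m by linarith
    have sq: "\<bar>i\<bar> \<le> int m" if "(2 * pi * real_of_int i)\<^sup>2 \<le> eigval 1 k" for i
    proof -
      have "1 * 1 \<le> (2 * pi) * (2 * pi)" using pi_gt3 by (intro mult_mono) auto
      then have "1 * (real_of_int i)\<^sup>2 \<le> ((2 * pi) * (2 * pi)) * (real_of_int i)\<^sup>2" by (intro mult_right_mono) auto
      then have "(real_of_int i)\<^sup>2 \<le> (2 * pi * real_of_int i)\<^sup>2" by (simp add: power2_eq_square mult_ac)
      moreover have "real_of_int \<bar>i\<bar> \<le> (real_of_int i)\<^sup>2"
      proof (cases "i = 0")
        case False
        then have "1 \<le> \<bar>real_of_int i\<bar>" by linarith
        then have "\<bar>real_of_int i\<bar> * 1 \<le> \<bar>real_of_int i\<bar> * \<bar>real_of_int i\<bar>" by (intro mult_left_mono) auto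
        then show ?thesis by (simp add: power2_eq_square)
      qed simp
      ultimately have "real_of_int \<bar>i\<bar> < real m" using that ev by linarith
      then show ?thesis by linarith
    qed
    have "\<bar>fst k\<bar> \<le> int m" "\<bar>snd k\<bar> \<le> int m" by (rule sq, simp add: eigval_1)+
    then show "k \<in> freq_box m" by (intro mem_freq_box) simp
  qed
  then have Q: "finite Q" by (rule finite_subset) simp
  have "(\<lambda>n. \<Sum>k\<in>Q. (cmod (e n k))\<^sup>2) \<longlonglongrightarrow> (\<Sum>k\<in>Q. (cmod 0)\<^sup>2)"
    by (intro tendsto_intros lim)
  then have "\<forall>\<^sub>F n in sequentially. (\<Sum>k\<in>Q. (cmod (e n k))\<^sup>2) < \<delta>\<^sup>2 / 2"
    using \<delta> by (intro order_tendstoD) auto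
  then show ?thesis
  proof eventually_elim
    case (elim n)
    have "(\<Sum>k\<in>F. (cmod (e n k))\<^sup>2) \<le> \<delta>\<^sup>2" if F: "finite F" for F
    proof -
      have "(\<Sum>k\<in>F - Q. (cmod (e n k))\<^sup>2) \<le> (\<Sum>k\<in>F - Q. (cmod (frac_pow \<kappa> (1/2) (e n) k))\<^sup>2 / \<Lambda>)"
      proof (rule sum_mono)
        fix k assume "k \<in> F - Q"
        then have ev: "\<Lambda> \<le> eigval \<kappa> k" by (simp add: Q_def)
        have "(cmod (frac_pow \<kappa> (1/2) (e n) k))\<^sup>2 = eigval \<kappa> k * (cmod (e n k))\<^sup>2"
          using ev \<Lambda> by (simp add: frac_pow_def norm_mult power_mult_distrib powr_half_sqrt)
        moreover have "\<Lambda> * (cmod (e n k))\<^sup>2 \<le> eigval \<kappa> k * (cmod (e n k))\<^sup>2" using ev by (intro mult_right_mono) auto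
        ultimately show "(cmod (e n k))\<^sup>2 \<le> (cmod (frac_pow \<kappa> (1/2) (e n) k))\<^sup>2 / \<Lambda>"
          using \<Lambda> by (simp add: pos_le_divide_eq mult.commute)
      qed
      also have "\<dots> = (\<Sum>k\<in>F - Q. (cmod (frac_pow \<kappa> (1/2) (e n) k))\<^sup>2) / \<Lambda>" by (simp add: sum_divide_distrib)
      also have "\<dots> \<le> B\<^sup>2 / \<Lambda>"
        using B[of n] F \<Lambda> unfolding ell2_le_iff by (intro divide_right_mono) auto
      also have "\<dots> \<le> \<delta>\<^sup>2 / 2" by (rule \<Lambda>)
      finally have 1: "(\<Sum>k\<in>F - Q. (cmod (e n k))\<^sup>2) \<le> \<delta>\<^sup>2 / 2" .
      have "(\<Sum>k\<in>F \<inter> Q. (cmod (e n k))\<^sup>2) \<le> (\<Sum>k\<in>Q. (cmod (e n k))\<^sup>2)" using Q by (intro sum_mono2) auto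
      moreover have "(\<Sum>k\<in>F. (cmod (e n k))\<^sup>2) = (\<Sum>k\<in>F \<inter> Q. (cmod (e n k))\<^sup>2) + (\<Sum>k\<in>F - Q. (cmod (e n k))\<^sup>2)"
        by (rule sum.Int_Diff[OF F])
      ultimately show ?thesis using 1 elim by linarith
    qed
    then show ?case unfolding ell2_le_iff using \<delta> by simp
  qed
qed

text \<open>Bounded sets of \<open>H\<^sup>1\<close> are weakly sequentially compact, the limits being functions by
  the Riesz--Fischer theorem.\<close>

lemma per0_H1_weak_limit:
  assumes \<kappa>: "0 < \<kappa>" and u: "\<And>n :: nat. u n \<in> per0_H1" "\<And>n. half_nrm \<kappa> (u n) \<le> r"
  obtains v s where "strict_mono (s :: nat \<Rightarrow> nat)" "v \<in> per0_H1" "half_nrm \<kappa> v \<le> r"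
    "\<And>k. (\<lambda>n. fourier (u (s n)) k) \<longlonglongrightarrow> fourier v k"
proof -
  have b: "ell2_le (frac_pow \<kappa> (1/2) (fourier (u n))) r" for n
    using u \<kappa> by (simp add: half_nrm_le_iff[symmetric])
  have "cmod (fourier (u n) k) \<le> r / sqrt \<kappa>" for n k
  proof (cases "k = (0, 0)")
    case True
    then show ?thesis using ell2_le_nonneg[OF b[of n]] \<kappa> fourier_0_per0_L2[OF per0_L2_H1[OF u(1)]] by simp
  next
    case False
    have "sqrt (eigval \<kappa> k) * cmod (fourier (u n) k) \<le> r"
      using ell2_le_component[OF b[of n], of k] eigval_nonneg[of k] \<kappa>
      by (simp add: frac_pow_def norm_mult powr_half_sqrt eigval_scale[of \<kappa>])
    moreover have "sqrt \<kappa> \<le> sqrt (eigval \<kappa> k)"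
      using eigval_1_ge_1[OF False] \<kappa> by (simp add: eigval_scale[of \<kappa>])
    ultimately have "sqrt \<kappa> * cmod (fourier (u n) k) \<le> r"
      by (meson mult_right_mono norm_ge_zero order_trans)
    then show ?thesis using \<kappa> by (simp add: pos_le_divide_eq mult.commute)
  qed
  then obtain c s where s: "strict_mono (s :: nat \<Rightarrow> nat)" and c: "\<And>k. (\<lambda>n. fourier (u (s n)) k) \<longlonglongrightarrow> c k"
    using coefficientwise_convergent_subsequence[of "\<lambda>n. fourier (u n)"] by metis
  have c0: "c (0, 0) = 0"
    using c[of "(0, 0)"] fourier_0_per0_L2[OF per0_L2_H1[OF u(1)]] by (simp add: LIMSEQ_const_iff)
  have sym: "c (- k) = cnj (c k)" for k
  proof -
    have "(\<lambda>n. fourier (u (s n)) (- k)) \<longlonglongrightarrow> cnj (c k)" unfolding fourier_uminus by (intro tendsto_intros c)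
    then show ?thesis using c[of "- k"] LIMSEQ_unique by blast
  qed
  have sum: "(\<Sum>k\<in>F. (cmod (frac_pow \<kappa> (1/2) c k))\<^sup>2) \<le> r\<^sup>2" if F: "finite F" for F
  proof (rule LIMSEQ_le_const2)
    show "(\<lambda>n. \<Sum>k\<in>F. (cmod (frac_pow \<kappa> (1/2) (fourier (u (s n))) k))\<^sup>2) \<longlonglongrightarrow> (\<Sum>k\<in>F. (cmod (frac_pow \<kappa> (1/2) c k))\<^sup>2)"
      unfolding frac_pow_def by (intro tendsto_intros c)
    show "\<exists>N. \<forall>n\<ge>N. (\<Sum>k\<in>F. (cmod (frac_pow \<kappa> (1/2) (fourier (u (s n))) k))\<^sup>2) \<le> r\<^sup>2"
      using b F unfolding ell2_le_iff by blast
  qed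
  have sq: "(cmod (frac_pow \<kappa> (1/2) c k))\<^sup>2 = \<kappa> * (eigval 1 k * (cmod (c k))\<^sup>2)" for k
    using eigval_nonneg[of k] \<kappa>
    by (simp add: frac_pow_def norm_mult power_mult_distrib powr_half_sqrt eigval_scale[of \<kappa>])
  have "(\<Sum>k\<in>F. eigval 1 k * (cmod (c k))\<^sup>2) \<le> r\<^sup>2 / \<kappa>" if "finite F" for F
    using sum[OF that] \<kappa> unfolding sq sum_distrib_left[symmetric] by (simp add: pos_le_divide_eq mult.commute)
  then obtain v where v: "v \<in> per0_H1" "\<And>k. fourier v k = c k"
    using per0_H1_of_coeffs[of c "r\<^sup>2 / \<kappa>"] c0 sym by metis
  have "fourier v = c" using v(2) by (simp add: fun_eq_iff)
  then have "half_nrm \<kappa> v \<le> r"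
    using half_nrm_le_iff[OF v(1), of \<kappa> r] \<kappa> sum ell2_le_nonneg[OF b[of 0]] by (simp add: ell2_le_iff)
  then show thesis using that[of s v] s v c by simp
qed

lemma ell2_le_heat_half:
  assumes "0 \<le> \<kappa>" "0 \<le> r" "ell2_le (frac_pow \<kappa> (1/2) c) b"
  shows "ell2_le (frac_pow \<kappa> (1/2) (heat \<kappa> r c)) b"
proof (rule ell2_le_dominated[OF assms(3)])
  fix k
  have "0 \<le> eigval \<kappa> k" using assms(1) eigval_nonneg[of k] by (simp add: eigval_scale[of \<kappa>])
  then have "exp (- (r * eigval \<kappa> k)) \<le> 1" using assms(2) by simp
  then have "exp (- (r * eigval \<kappa> k)) * cmod (frac_pow \<kappa> (1/2) c k) \<le> 1 * cmod (frac_pow \<kappa> (1/2) c k)"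
    by (intro mult_right_mono) auto
  then show "cmod (frac_pow \<kappa> (1/2) (heat \<kappa> r c) k) \<le> cmod (frac_pow \<kappa> (1/2) c k)"
    by (simp add: frac_pow_def heat_def norm_mult mult_ac)
qed

text \<open>Otherwise some solutions with data \<open>v\<^sub>n\<close> in the ball would exceed the bound \<open>n\<close>. Along a
  subsequence the data converge weakly to some \<open>v\<close>, hence strongly in \<open>L\<^sup>2\<close>, and the stability
  estimate keeps the solutions within a fixed distance of the solution starting at \<open>v\<close>, which
  exists on the whole half line.\<close>

lemma averaged_solutions_uniformly_bounded:
  assumes \<nu>: "0 < \<nu>" "0 < Pr" and T: "0 < T" and R0: "0 < R0" and S: "averaged_semigroup \<nu> Pr N f0 S"
  shows "\<exists>R\<ge>0. \<forall>v\<in>V_ball \<nu> Pr R0. \<forall>\<omega> \<rho>. mild_solution \<nu> Pr N 1 (\<lambda>_. f0) {0..T} v \<omega> \<rho> \<longrightarrow>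
    (\<forall>t\<in>{0..T}. V_nrm \<nu> Pr (\<omega> t, \<rho> t) \<le> R)"
proof (rule ccontr)
  assume "\<not> ?thesis"
  then have "\<exists>v\<in>V_ball \<nu> Pr R0. \<exists>\<omega> \<rho> t. mild_solution \<nu> Pr N 1 (\<lambda>_. f0) {0..T} v \<omega> \<rho> \<and> t \<in> {0..T} \<and>
      real n < V_nrm \<nu> Pr (\<omega> t, \<rho> t)" for n
    by (meson not_le of_nat_0_le_iff)
  then obtain v \<omega> \<rho> t where v: "\<And>n. v n \<in> V_ball \<nu> Pr R0" and m: "\<And>n. mild_solution \<nu> Pr N 1 (\<lambda>_. f0) {0..T} (v n) (\<omega> n) (\<rho> n)"
    and t: "\<And>n. t n \<in> {0..T}" and big: "\<And>n :: nat. real n < V_nrm \<nu> Pr (\<omega> n (t n), \<rho> n (t n))"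
    by metis
  have kp: "0 < \<nu>" "0 < \<nu> / Pr" "0 \<le> \<nu>" "0 \<le> \<nu> / Pr" using \<nu> by auto
  have H: "fst (v n) \<in> per0_H1" "snd (v n) \<in> per0_H1" "half_nrm \<nu> (fst (v n)) \<le> R0" "half_nrm (\<nu> / Pr) (snd (v n)) \<le> R0" for n
    using v[of n] half_nrm_nonneg[of \<nu> "fst (v n)"] half_nrm_nonneg[of "\<nu> / Pr" "snd (v n)"]
    by (auto simp: V_ball_def V_space_def V_nrm_def mem_Times_iff)
  obtain u1 s1 where s1: "strict_mono (s1 :: nat \<Rightarrow> nat)" and u1: "u1 \<in> per0_H1" "half_nrm \<nu> u1 \<le> R0"
    and l1: "\<And>k. (\<lambda>n. fourier (fst (v (s1 n))) k) \<longlonglongrightarrow> fourier u1 k"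
    using per0_H1_weak_limit[of \<nu> "\<lambda>n. fst (v n)" R0] kp H by metis
  obtain u2 s2 where s2: "strict_mono (s2 :: nat \<Rightarrow> nat)" and u2: "u2 \<in> per0_H1" "half_nrm (\<nu> / Pr) u2 \<le> R0"
    and l2: "\<And>k. (\<lambda>n. fourier (snd (v (s1 (s2 n)))) k) \<longlonglongrightarrow> fourier u2 k"
    using per0_H1_weak_limit[of "\<nu> / Pr" "\<lambda>n. snd (v (s1 n))" R0] kp H by metis
  define s where "s n = s1 (s2 n)" for n
  have s: "n \<le> s n" for n
    unfolding s_def using seq_suble[OF s1] seq_suble[OF s2] order_trans by blast
  have l1': "(\<lambda>n. fourier (fst (v (s n))) k) \<longlonglongrightarrow> fourier u1 k" for k
    using LIMSEQ_subseq_LIMSEQ[OF l1[of k] s2] by (simp add: o_def s_def)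
  have "(u1, u2) \<in> V_space" using u1 u2 by (simp add: V_space_def)
  then have "mild_solution \<nu> Pr N 1 (\<lambda>_. f0) {0..} (u1, u2) (\<lambda>t. fst (S t (u1, u2))) (\<lambda>t. snd (S t (u1, u2)))"
    using S unfolding averaged_semigroup_def by blast
  then have mS: "mild_solution \<nu> Pr N 1 (\<lambda>_. f0) {0..T} (u1, u2) (\<lambda>t. fst (S t (u1, u2))) (\<lambda>t. snd (S t (u1, u2)))"
    by (rule mild_solution_subset) auto
  obtain K where K: "\<forall>t\<in>{0..T}. V_nrm \<nu> Pr (fst (S t (u1, u2)), snd (S t (u1, u2))) \<le> K"
    using mild_solution_bounded[OF mS \<nu>] by auto
  define A0 where "A0 = 4 * R0"
  have A0: "0 \<le> A0" using R0 by (simp add: A0_def)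
  have K0: "0 \<le> K" using order_trans[OF V_nrm_nonneg bspec[OF K, of 0]] T by auto
  obtain C where C: "0 \<le> C" and stab: "stability_const \<nu> Pr N T K (A0 + 1) C"
    using mild_solution_stability[OF \<nu>, of T K "A0 + 1" N] T K0 A0 by auto
  define \<delta> where "\<delta> = 1 / (4 * (C + 1))"
  have \<delta>: "0 < \<delta>" "C * (2 * \<delta>) < 1" using C by (simp_all add: \<delta>_def divide_less_eq)
  have d1: "ell2_le (frac_pow \<nu> (1/2) (\<lambda>k. fourier (fst (v n)) k - fourier u1 k)) (2 * R0)" for n
  proof -
    have "frac_pow \<nu> (1/2) (\<lambda>k. fourier (fst (v n)) k - fourier u1 k) =
        (\<lambda>k. frac_pow \<nu> (1/2) (fourier (fst (v n))) k - frac_pow \<nu> (1/2) (fourier u1) k)"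
      by (simp add: frac_pow_def right_diff_distrib fun_eq_iff)
    moreover have "ell2_le (\<lambda>k. frac_pow \<nu> (1/2) (fourier (fst (v n))) k - frac_pow \<nu> (1/2) (fourier u1) k) (R0 + R0)"
      using H u1 kp by (intro ell2_le_diff) (simp_all add: half_nrm_le_iff[symmetric])
    ultimately show ?thesis by simp
  qed
  have d2: "ell2_le (frac_pow (\<nu> / Pr) (1/2) (\<lambda>k. fourier (snd (v n)) k - fourier u2 k)) (2 * R0)" for n
  proof -
    have "frac_pow (\<nu> / Pr) (1/2) (\<lambda>k. fourier (snd (v n)) k - fourier u2 k) =
        (\<lambda>k. frac_pow (\<nu> / Pr) (1/2) (fourier (snd (v n))) k - frac_pow (\<nu> / Pr) (1/2) (fourier u2) k)"
      by (simp add: frac_pow_def right_diff_distrib fun_eq_iff)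
    moreover have "ell2_le (\<lambda>k. frac_pow (\<nu> / Pr) (1/2) (fourier (snd (v n))) k - frac_pow (\<nu> / Pr) (1/2) (fourier u2) k) (R0 + R0)"
      using H u2 kp by (intro ell2_le_diff) (simp_all add: half_nrm_le_iff[symmetric])
    ultimately show ?thesis by simp
  qed
  have e1: "\<forall>\<^sub>F n in sequentially. ell2_le (\<lambda>k. fourier (fst (v (s n))) k - fourier u1 k) \<delta>"
    by (rule ell2_small_of_grad_bounded[OF kp(1) d1 _ \<delta>(1)]) (intro LIM_zero l1')
  have e2: "\<forall>\<^sub>F n in sequentially. ell2_le (\<lambda>k. fourier (snd (v (s n))) k - fourier u2 k) \<delta>"
    by (rule ell2_small_of_grad_bounded[OF kp(2) d2 _ \<delta>(1)]) (intro LIM_zero l2[folded s_def])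
  have e3: "\<forall>\<^sub>F n in sequentially. K + A0 + 1 \<le> real n"
    using eventually_ge_at_top[of "nat \<lceil>K + A0 + 1\<rceil>"] by eventually_elim linarith
  obtain n where n: "ell2_le (\<lambda>k. fourier (fst (v (s n))) k - fourier u1 k) \<delta>"
    "ell2_le (\<lambda>k. fourier (snd (v (s n))) k - fourier u2 k) \<delta>" "K + A0 + 1 \<le> real n"
    using eventually_happens'[OF _ eventually_conj[OF e1 eventually_conj[OF e2 e3]]] by auto
  \<comment> \<open>The data differ by at most \<open>2 * R0\<close> in each component of \<open>V\<close> and by at most \<open>\<delta>\<close> in \<open>L\<^sup>2\<close>; the latter the heat
     semigroup turns into \<open>\<delta>\<close> times \<open>t\<close> to the power \<open>-1/2\<close>.\<close>
  define a where "a t = (if t = 0 then 2 * R0 else min (2 * R0) (t powr - (1/2) * \<delta>))" for t :: real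
  have fi: "\<forall>k. set_integrable lebesgue {0..T} (\<lambda>s. f0 k)"
    by (intro allI absolutely_integrable_continuous_real continuous_on_const)
  have z: "hat_integral 0 t (\<lambda>s. heat \<nu> (t - s) (\<lambda>j. f0 j - f0 j)) k = 0" for t k
    by (simp add: hat_integral_def heat_def)
  have a1: "\<forall>t\<in>{0..T}. ell2_le (frac_pow \<nu> (1/2) (\<lambda>k. heat \<nu> t (\<lambda>j. fourier (fst (v (s n))) j - fourier (fst (u1, u2)) j) k +
       hat_integral 0 t (\<lambda>s. heat \<nu> (t - s) (\<lambda>j. f0 j - f0 j)) k)) (a t)"
  proof
    fix t assume "t \<in> {0..T}"
    then show "ell2_le (frac_pow \<nu> (1/2) (\<lambda>k. heat \<nu> t (\<lambda>j. fourier (fst (v (s n))) j - fourier (fst (u1, u2)) j) k +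
       hat_integral 0 t (\<lambda>s. heat \<nu> (t - s) (\<lambda>j. f0 j - f0 j)) k)) (a t)"
      unfolding z using ell2_le_heat_half[OF kp(3) _ d1, of t "s n"] frac_pow_heat_half_le[OF kp(3) _ n(1), of t]
      by (auto simp: a_def min_def)
  qed
  have a2: "\<forall>t\<in>{0..T}. ell2_le (frac_pow (\<nu> / Pr) (1/2) (heat (\<nu> / Pr) t (\<lambda>j. fourier (snd (v (s n))) j - fourier (snd (u1, u2)) j))) (a t)"
  proof
    fix t assume "t \<in> {0..T}"
    then show "ell2_le (frac_pow (\<nu> / Pr) (1/2) (heat (\<nu> / Pr) t (\<lambda>j. fourier (snd (v (s n))) j - fourier (snd (u1, u2)) j))) (a t)"
      using ell2_le_heat_half[OF kp(4) _ d2, of t "s n"] frac_pow_heat_half_le[OF kp(4) _ n(2), of t]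
      by (auto simp: a_def min_def)
  qed
  have aA: "\<forall>t\<in>{0..T}. a t + a t \<le> A0" by (auto simp: a_def A0_def)
  have aB: "\<forall>t\<in>{0<..T}. a t + a t \<le> (2 * \<delta>) * t powr - (1/2)" by (auto simp: a_def min_def mult.commute)
  have "\<forall>t\<in>{0..T}. V_nrm \<nu> Pr (\<lambda>p. \<omega> (s n) t p - fst (S t (u1, u2)) p, \<lambda>p. \<rho> (s n) t p - snd (S t (u1, u2)) p) \<le> a t + a t + C * (2 * \<delta>)"
    by (intro ballI stability_constD[OF stab m mS fi[rule_format] fi[rule_format] K[rule_format] a1[rule_format]
          a2[rule_format] aA[rule_format] aB[rule_format]]) (use \<delta> in auto)
  moreover have tn: "t (s n) \<in> {0..T}" by (rule t)
  ultimately have "V_nrm \<nu> Pr (\<lambda>p. \<omega> (s n) (t (s n)) p - fst (S (t (s n)) (u1, u2)) p, \<lambda>p. \<rho> (s n) (t (s n)) p - snd (S (t (s n)) (u1, u2)) p) \<le> A0 + 1"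
    using aA \<delta>(2) by force
  moreover have "V_nrm \<nu> Pr (fst (S (t (s n)) (u1, u2)), snd (S (t (s n)) (u1, u2))) \<le> K" using K tn by blast
  ultimately have "V_nrm \<nu> Pr (\<omega> (s n) (t (s n)), \<rho> (s n) (t (s n))) \<le> K + A0 + 1"
    using V_nrm_triangle[OF mild_solution_V_space[OF m[of "s n"] tn] mild_solution_V_space[OF mS tn] \<nu>] by linarith
  moreover have "K + A0 + 1 \<le> real (s n)" using n(3) s[of n] by linarith
  ultimately show False using big[of "s n"] by linarith
qed

section \<open>The averaging theorem\<close>

theorem theorem3p6:
  fixes \<nu> N Pr \<gamma> M T R0 :: real
    and \<sigma> :: "real \<Rightarrow> real"
    and f :: "real \<Rightarrow> real \<times> real \<Rightarrow> real"
    and f0 :: "int \<times> int \<Rightarrow> complex"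
    and S :: "real \<Rightarrow> (real \<times> real \<Rightarrow> real) \<times> (real \<times> real \<Rightarrow> real) \<Rightarrow>
                (real \<times> real \<Rightarrow> real) \<times> (real \<times> real \<Rightarrow> real)"
  assumes "\<nu> > 0" and "N\<^sup>2 > 0" and "Pr > 0"
    and "\<gamma> > - 1/2"
    and "Linfty_loc_H f"
    and "AE \<tau> in lebesgue. 0 \<le> \<tau> \<longrightarrow> fourier (f \<tau>) \<in> frac_dom \<nu> \<gamma>"
    and "f0 \<in> frac_dom \<nu> \<gamma>"
    and "M > 0" and "(\<sigma> \<longlongrightarrow> 0) at_top"
    and "\<And>t l. 0 \<le> t \<Longrightarrow> 0 < l \<Longrightarrow>
           (\<lambda>k. of_real (1 / l) * hat_integral t (t + l) (\<lambda>s. fourier (f s)) k - f0 k) \<in> frac_dom \<nu> \<gamma> \<and>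
           frac_nrm \<nu> \<gamma>
             (\<lambda>k. of_real (1 / l) * hat_integral t (t + l) (\<lambda>s. fourier (f s)) k - f0 k)
             \<le> min M (\<sigma> l)"
    and "T > 0"
    and "R0 > 0"
    and "averaged_semigroup \<nu> Pr N f0 S"
    and "absorbing_ball \<nu> Pr S R0"
  shows "\<exists>\<epsilon>0>0. \<exists>\<eta> :: real \<Rightarrow> real.
           (\<forall>\<epsilon>\<in>{0<..\<epsilon>0}. 0 \<le> \<eta> \<epsilon>) \<and> (\<eta> \<longlongrightarrow> 0) (at_right 0) \<and>
           (\<forall>\<epsilon>\<in>{0<..\<epsilon>0}. \<forall>v0\<in>V_ball \<nu> Pr R0. \<forall>\<omega> \<rho> \<omega>' \<rho>'.
              mild_solution \<nu> Pr N \<epsilon> (\<lambda>\<tau>. fourier (f \<tau>)) {0..T/\<epsilon>} v0 \<omega> \<rho> \<longrightarrow>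
              mild_solution \<nu> Pr N \<epsilon> (\<lambda>_. f0) {0..T/\<epsilon>} v0 \<omega>' \<rho>' \<longrightarrow>
              (\<forall>\<tau>\<in>{0..T/\<epsilon>}.
                 half_nrm \<nu> (\<lambda>p. \<omega> \<tau> p - \<omega>' \<tau> p) + half_nrm (\<nu> / Pr) (\<lambda>p. \<rho> \<tau> p - \<rho>' \<tau> p) \<le> \<eta> \<epsilon>))"
proof -
  note \<nu> = \<open>\<nu> > 0\<close> \<open>Pr > 0\<close> and f = \<open>Linfty_loc_H f\<close>
  obtain R where R0: "0 \<le> R" and R: "\<And>v \<omega> \<rho>. v \<in> V_ball \<nu> Pr R0 \<Longrightarrow> mild_solution \<nu> Pr N 1 (\<lambda>_. f0) {0..T} v \<omega> \<rho> \<Longrightarrow>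
      \<forall>t\<in>{0..T}. V_nrm \<nu> Pr (\<omega> t, \<rho> t) \<le> R"
    using averaged_solutions_uniformly_bounded[OF \<nu> \<open>T > 0\<close> \<open>R0 > 0\<close> \<open>averaged_semigroup \<nu> Pr N f0 S\<close>] by blast
  \<comment> \<open>The level \<open>1\<close> of the bootstrap is arbitrary: the distance of the solutions is going to be small.\<close>
  obtain C where C: "0 \<le> C" and stab: "stability_const \<nu> Pr N T R 1 C"
    using mild_solution_stability[OF \<nu>, of T R 1 N] \<open>T > 0\<close> R0 by auto
  define diff where "diff \<omega> \<rho> \<omega>' \<rho>' = half_nrm \<nu> (\<lambda>p. \<omega> p - \<omega>' p) + half_nrm (\<nu> / Pr) (\<lambda>p. \<rho> p - \<rho>' p)" for \<omega> \<rho> \<omega>' \<rho>'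
  \<comment> \<open>All distances that occur for a given \<open>\<epsilon>\<close>. Their supremum is the required modulus; it depends neither on
     the data nor on the time.\<close>
  define Z where "Z \<epsilon> = {z. \<exists>v0\<in>V_ball \<nu> Pr R0. \<exists>\<omega> \<rho> \<omega>' \<rho>'. \<exists>\<tau>\<in>{0..T/\<epsilon>}.
      mild_solution \<nu> Pr N \<epsilon> (\<lambda>\<tau>. fourier (f \<tau>)) {0..T/\<epsilon>} v0 \<omega> \<rho> \<and>
      mild_solution \<nu> Pr N \<epsilon> (\<lambda>_. f0) {0..T/\<epsilon>} v0 \<omega>' \<rho>' \<and> z = diff (\<omega> \<tau>) (\<rho> \<tau>) (\<omega>' \<tau>) (\<rho>' \<tau>)}" for \<epsilon>
  have main: "\<exists>\<epsilon>0>0. \<forall>\<epsilon>\<in>{0<..\<epsilon>0}. \<forall>z\<in>Z \<epsilon>. z \<le> \<delta>" if \<delta>: "0 < \<delta>" for \<delta>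
  proof -
    define K where "K = 1 + C * sqrt T"
    have K: "0 < K" using C \<open>T > 0\<close> by (simp add: K_def add_pos_nonneg)
    \<comment> \<open>The stability estimate enlarges a forcing error \<open>d\<close> to \<open>d * K\<close>, which has to be at most \<open>\<delta>\<close> and below
       the bootstrap level.\<close>
    define d where "d = min \<delta> (1/2) / K"
    have d: "0 < d" "d * K \<le> \<delta>" "d * K < 1" using K \<delta> by (simp_all add: d_def)
    obtain \<epsilon>0 where \<epsilon>0: "0 < \<epsilon>0" and small: "\<And>\<epsilon> t. \<epsilon> \<in> {0<..\<epsilon>0} \<Longrightarrow> t \<in> {0..T} \<Longrightarrow>
        ell2_le (frac_pow \<nu> (1/2) (hat_integral 0 t (\<lambda>s. heat \<nu> (t - s) (\<lambda>j. fourier (f (s / \<epsilon>)) j - f0 j)))) d"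
      using averaged_forcing_small[OF \<nu>(1) assms(4) f \<open>M > 0\<close> \<open>(\<sigma> \<longlongrightarrow> 0) at_top\<close> assms(10) \<open>T > 0\<close> d(1)] by blast
    have "z \<le> \<delta>" if \<epsilon>: "\<epsilon> \<in> {0<..\<epsilon>0}" and z: "z \<in> Z \<epsilon>" for \<epsilon> z
    proof -
      obtain v0 \<omega> \<rho> \<omega>' \<rho>' \<tau> where v0: "v0 \<in> V_ball \<nu> Pr R0" and \<tau>: "\<tau> \<in> {0..T/\<epsilon>}"
        and m: "mild_solution \<nu> Pr N \<epsilon> (\<lambda>\<tau>. fourier (f \<tau>)) {0..T/\<epsilon>} v0 \<omega> \<rho>"
        and m': "mild_solution \<nu> Pr N \<epsilon> (\<lambda>_. f0) {0..T/\<epsilon>} v0 \<omega>' \<rho>'"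
        and zd: "z = diff (\<omega> \<tau>) (\<rho> \<tau>) (\<omega>' \<tau>) (\<rho>' \<tau>)"
        using z unfolding Z_def by blast
      have e: "0 < \<epsilon>" using \<epsilon> by simp
      note r = mild_solution_rescale[OF m e] and r' = mild_solution_rescale[OF m' e]
      have F: "\<forall>k. set_integrable lebesgue {0..T} (\<lambda>s. fourier (f (s / \<epsilon>)) k)"
        by (intro allI set_integrable_rescale[OF e] fourier_forcing_integrable[OF f])
      have F0: "\<forall>k. set_integrable lebesgue {0..T} (\<lambda>s. f0 k)"
        by (intro allI absolutely_integrable_continuous_real continuous_on_const)
      have h0: "heat \<kappa> t (\<lambda>j. c j - c j) = (\<lambda>_. 0)" for \<kappa> t c by (simp add: heat_def)
      have a: "\<forall>t\<in>{0..T}. ell2_le (frac_pow \<nu> (1/2) (\<lambda>k. heat \<nu> t (\<lambda>j. fourier (fst v0) j - fourier (fst v0) j) k +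
          hat_integral 0 t (\<lambda>s. heat \<nu> (t - s) (\<lambda>j. fourier (f (s / \<epsilon>)) j - f0 j)) k)) d"
        using small[OF \<epsilon>] unfolding h0 by simp
      have b: "\<forall>t\<in>{0..T}. ell2_le (frac_pow (\<nu> / Pr) (1/2) (heat (\<nu> / Pr) t (\<lambda>j. fourier (snd v0) j - fourier (snd v0) j))) 0"
        unfolding h0 by (simp add: frac_pow_def ell2_le_def L2_set_def)
      have dA: "\<forall>t\<in>{0..T}. d + 0 \<le> d" by simp
      have dB: "\<forall>t\<in>{0<..T}. d + 0 \<le> (d * sqrt T) * t powr - (1/2)"
      proof
        fix t assume t: "t \<in> {0<..T}"
        then have "sqrt t \<le> sqrt T" by simp
        then have "1 \<le> sqrt T / sqrt t" using t by simp
        also have "\<dots> = sqrt T * t powr - (1/2)"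
        proof -
          have "t powr (1/2) = sqrt t" using t by (intro powr_half_sqrt) auto
          then show ?thesis by (simp only: powr_minus divide_inverse[of "sqrt T"])
        qed
        finally have "d * 1 \<le> d * (sqrt T * t powr - (1/2))" using d(1) by (intro mult_left_mono) auto
        then show "d + 0 \<le> (d * sqrt T) * t powr - (1/2)" by (simp add: mult.assoc)
      qed
      have bound: "d + 0 + C * (d * sqrt T) = d * K" by (simp add: K_def algebra_simps)
      have "\<forall>t\<in>{0..T}. V_nrm \<nu> Pr (\<lambda>p. \<omega> (t / \<epsilon>) p - \<omega>' (t / \<epsilon>) p, \<lambda>p. \<rho> (t / \<epsilon>) p - \<rho>' (t / \<epsilon>) p) \<le> d + 0 + C * (d * sqrt T)"
        by (intro ballI stability_constD[OF stab r r' F[rule_format] F0[rule_format] R[OF v0 r', rule_format] a[rule_format]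
              b[rule_format] dA[rule_format] dB[rule_format]]) (use d bound \<open>T > 0\<close> in auto)
      moreover have "\<epsilon> * \<tau> \<in> {0..T}" using \<tau> e by (auto simp: pos_le_divide_eq mult.commute)
      ultimately have "V_nrm \<nu> Pr (\<lambda>p. \<omega> (\<epsilon> * \<tau> / \<epsilon>) p - \<omega>' (\<epsilon> * \<tau> / \<epsilon>) p, \<lambda>p. \<rho> (\<epsilon> * \<tau> / \<epsilon>) p - \<rho>' (\<epsilon> * \<tau> / \<epsilon>) p) \<le> d * K"
        unfolding bound by blast
      then show ?thesis using e d(2) by (simp add: zd diff_def V_nrm_def)
    qed
    then show ?thesis using \<epsilon>0 by blast
  qed
  obtain \<epsilon>1 where \<epsilon>1: "0 < \<epsilon>1" and Z1: "\<And>\<epsilon> z. \<epsilon> \<in> {0<..\<epsilon>1} \<Longrightarrow> z \<in> Z \<epsilon> \<Longrightarrow> z \<le> 1"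
    using main[of 1] by auto
  \<comment> \<open>The element \<open>0\<close> gives the supremum a value if there are no solutions.\<close>
  define \<eta> where "\<eta> \<epsilon> = Sup (insert 0 (Z \<epsilon>))" for \<epsilon>
  have bdd: "bdd_above (insert 0 (Z \<epsilon>))" if "\<epsilon> \<in> {0<..\<epsilon>1}" for \<epsilon>
    using Z1[OF that] by (intro bdd_aboveI[of _ 1]) auto
  have \<eta>0: "0 \<le> \<eta> \<epsilon>" if "\<epsilon> \<in> {0<..\<epsilon>1}" for \<epsilon>
    unfolding \<eta>_def by (rule cSup_upper[OF _ bdd[OF that]]) simp
  have \<eta>Z: "z \<le> \<eta> \<epsilon>" if "\<epsilon> \<in> {0<..\<epsilon>1}" "z \<in> Z \<epsilon>" for \<epsilon> z
    unfolding \<eta>_def by (rule cSup_upper[OF _ bdd[OF that(1)]]) (use that in simp)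
  have "(\<eta> \<longlongrightarrow> 0) (at_right 0)"
  proof (rule tendstoI)
    fix e :: real assume e: "0 < e"
    obtain \<epsilon>2 where \<epsilon>2: "0 < \<epsilon>2" and Z2: "\<And>\<epsilon> z. \<epsilon> \<in> {0<..\<epsilon>2} \<Longrightarrow> z \<in> Z \<epsilon> \<Longrightarrow> z \<le> e / 2"
      using main[of "e / 2"] e by auto
    have "\<forall>\<^sub>F \<epsilon> in at_right 0. \<epsilon> \<in> {0<..<min \<epsilon>1 \<epsilon>2}"
      using \<epsilon>1 \<epsilon>2 by (intro eventually_at_right_real) auto
    then show "\<forall>\<^sub>F \<epsilon> in at_right 0. dist (\<eta> \<epsilon>) 0 < e"
    proof eventually_elim
      case (elim \<epsilon>)
      then have "\<eta> \<epsilon> \<le> e / 2" unfolding \<eta>_def by (intro cSup_least) (use Z2[of \<epsilon>] e in auto)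
      then show ?case using \<eta>0[of \<epsilon>] elim e by simp
    qed
  qed
  moreover have "\<forall>\<epsilon>\<in>{0<..\<epsilon>1}. \<forall>v0\<in>V_ball \<nu> Pr R0. \<forall>\<omega> \<rho> \<omega>' \<rho>'.
      mild_solution \<nu> Pr N \<epsilon> (\<lambda>\<tau>. fourier (f \<tau>)) {0..T/\<epsilon>} v0 \<omega> \<rho> \<longrightarrow>
      mild_solution \<nu> Pr N \<epsilon> (\<lambda>_. f0) {0..T/\<epsilon>} v0 \<omega>' \<rho>' \<longrightarrow>
      (\<forall>\<tau>\<in>{0..T/\<epsilon>}.
         half_nrm \<nu> (\<lambda>p. \<omega> \<tau> p - \<omega>' \<tau> p) + half_nrm (\<nu> / Pr) (\<lambda>p. \<rho> \<tau> p - \<rho>' \<tau> p) \<le> \<eta> \<epsilon>)"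
  proof (intro ballI allI impI)
    fix \<epsilon> v0 \<omega> \<rho> \<omega>' \<rho>' \<tau>
    assume asm: "\<epsilon> \<in> {0<..\<epsilon>1}" "v0 \<in> V_ball \<nu> Pr R0"
      "mild_solution \<nu> Pr N \<epsilon> (\<lambda>\<tau>. fourier (f \<tau>)) {0..T/\<epsilon>} v0 \<omega> \<rho>"
      "mild_solution \<nu> Pr N \<epsilon> (\<lambda>_. f0) {0..T/\<epsilon>} v0 \<omega>' \<rho>'" "\<tau> \<in> {0..T/\<epsilon>}"
    have "diff (\<omega> \<tau>) (\<rho> \<tau>) (\<omega>' \<tau>) (\<rho>' \<tau>) \<in> Z \<epsilon>"
      unfolding Z_def mem_Collect_eq
      by (rule bexI[OF _ asm(2)], rule exI[of _ \<omega>], rule exI[of _ \<rho>], rule exI[of _ \<omega>'], rule exI[of _ \<rho>'],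
          rule bexI[OF _ asm(5)], intro conjI asm(3,4) refl)
    then have "diff (\<omega> \<tau>) (\<rho> \<tau>) (\<omega>' \<tau>) (\<rho>' \<tau>) \<le> \<eta> \<epsilon>"
      by (rule \<eta>Z[OF asm(1)])
    then show "half_nrm \<nu> (\<lambda>p. \<omega> \<tau> p - \<omega>' \<tau> p) + half_nrm (\<nu> / Pr) (\<lambda>p. \<rho> \<tau> p - \<rho>' \<tau> p) \<le> \<eta> \<epsilon>"
      by (simp add: diff_def)
  qed
  ultimately show ?thesis using \<epsilon>1 \<eta>0 by blast
qed

end
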